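(* Let $C\subset\mathbb{P}^2$ be an irreducible cubic curve, and let $X\subset C$ be a reduced set of $n=3t+\delta$ points, where $0\le\delta\le 2$, such that $$\Delta h_X(0)=1,\quad \Delta h_X(1)=2,\quad \Delta h_X(i)=3\ \text{ for } 2\le i\le t,\quad \Delta h_X(t+1)=\delta,\quad \Delta h_X(i)=0\ \text{ for } i\ge t+2.$$ Assume that either $C$ is smooth, or else that no point of $X$ is the singular point of $C$. Assume further that $t>5-\delta$. Then the Hilbert function of the double point scheme $Z=2X$ satisfies $$\Delta h_Z(i)=i+1\ (0\le i\le 5),\quad \Delta h_Z(i)=6\ (5\le i\le t+3),\quad \Delta h_Z(t+4)=3+\delta,\quad \Delta h_Z(i)=3\ (t+5\le i\le 2t+\delta-1).$$ For the behavior in degrees $\ge 2t+\delta$: (a) If $\delta=1$ or $\delta=2$, then $\Delta h_Z(2t+\delta)=3-\delta$ and $\Delta h_Z(k)=0$ for $k>2t+\delta$. (b) If $\delta=0$, there are two possible Hilbert functions (every such $Z$ has one of them, and both occur), determined by i. $\Delta h_Z(2t)=3$ and $\Delta h_Z(k)=0$ for $k>2t$; and ii. $\Delta h_Z(2t)=2$, $\Delta h_Z(2t+1)=1$, $\Delta h_Z(k)=0$ for $k\ge 2t+2$. Moreover (in case $\delta=0$), if the points $p_1,\dots,p_n$ of $X$ are sufficiently general on $C$ and $C$ is smooth, then the Hilbert function is the one in i.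
   Context: $\mathbb{P}^2$ is the projective plane over an algebraically closed field $k$, with homogeneous coordinate ring $R=k[\mathbb{P}^2]$. For a zero-dimensional subscheme $Z\subset\mathbb{P}^2$ with saturated homogeneous ideal $I_Z$, $h_Z(t)=\dim_k(R/I_Z)_t$ and $\Delta h_Z(t)=h_Z(t)-h_Z(t-1)$. For a reduced finite set of points $X$, $2X$ denotes the double point scheme supported on $X$, defined by the saturated ideal $\bigcap_{p\in X}I(p)^2$. "Sufficiently general" means that $(p_1,\dots,p_n)$ lies in a suitable nonempty Zariski open subset of $C^n$. *)

theory Defs
  imports
    "HOL-Analysis.Finite_Cartesian_Product"
    "HOL-Analysis.Abstract_Topology"
    "HOL-Library.FuncSet"
    "HOL-Library.Poly_Mapping"
    "HOL-Computational_Algebra.Polynomial"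
    "HOL-Computational_Algebra.Factorial_Ring"
begin

section \<open>Polynomials in several variables\<close>

text \<open>
  A polynomial with variables indexed by \<open>'v\<close> is a finitely supported map from exponent vectors
  to coefficients; multiplication is the convolution product of \<^theory>\<open>HOL-Library.Poly_Mapping\<close>.
  The homogeneous coordinate ring of the plane is the case \<open>'v = 3\<close>.
\<close>

type_synonym ('v, 'k) mpoly = "('v \<Rightarrow>\<^sub>0 nat) \<Rightarrow>\<^sub>0 'k"

definition const :: "'k::field \<Rightarrow> ('v, 'k) mpoly" where
  "const c = Poly_Mapping.single 0 c"

definition eval_mpoly :: "('v, 'k::field) mpoly \<Rightarrow> ('v \<Rightarrow> 'k) \<Rightarrow> 'k" where
  "eval_mpoly F x =
     (\<Sum>m\<in>Poly_Mapping.keys F. Poly_Mapping.lookup F m *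
        (\<Prod>i\<in>Poly_Mapping.keys m. x i ^ Poly_Mapping.lookup m i))"

text \<open>
  If the variable \<open>i\<close> does not occur in \<open>m\<close>, the subtraction of exponents is truncated, but the
  coefficient of that summand is zero.
\<close>

definition partial_deriv :: "'v \<Rightarrow> ('v, 'k::field) mpoly \<Rightarrow> ('v, 'k) mpoly" where
  "partial_deriv i F =
     (\<Sum>m\<in>Poly_Mapping.keys F.
        Poly_Mapping.single (m - Poly_Mapping.single i 1)
          (of_nat (Poly_Mapping.lookup m i) * Poly_Mapping.lookup F m))"

text \<open>The graded piece of degree \<open>d\<close>: all forms of degree \<open>d\<close>, including the zero polynomial.\<close>

definition forms :: "nat \<Rightarrow> ('v::finite, 'k::field) mpoly set" where
  "forms d = {F. \<forall>m\<in>Poly_Mapping.keys F. (\<Sum>i\<in>UNIV. Poly_Mapping.lookup m i) = d}"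

definition ideal_generated :: "'r::comm_ring_1 set \<Rightarrow> 'r set" where
  "ideal_generated S = module.span (*) S"

definition ideal_square :: "'r::comm_ring_1 set \<Rightarrow> 'r set" where
  "ideal_square I = ideal_generated {a * b | a b. a \<in> I \<and> b \<in> I}"


section \<open>The projective plane\<close>

quotient_type (overloaded) 'k proj_plane = "('k::field) ^ 3" / partial:
  "\<lambda>u v. u \<noteq> 0 \<and> v \<noteq> 0 \<and> (\<exists>c. c \<noteq> 0 \<and> v = c *s u)"
proof (rule part_equivpI)
  show "\<exists>u::'k^3. u \<noteq> 0 \<and> u \<noteq> 0 \<and> (\<exists>c. c \<noteq> 0 \<and> u = c *s u)"
    by (rule exI[of _ "vec 1"], intro conjI exI[of _ 1]) (simp_all add: vec_eq_iff)
  show "symp (\<lambda>u v::'k^3. u \<noteq> 0 \<and> v \<noteq> 0 \<and> (\<exists>c. c \<noteq> 0 \<and> v = c *s u))"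
  proof (rule sympI)
    fix u v :: "'k^3"
    assume "u \<noteq> 0 \<and> v \<noteq> 0 \<and> (\<exists>c. c \<noteq> 0 \<and> v = c *s u)"
    then obtain c where c: "u \<noteq> 0" "v \<noteq> 0" "c \<noteq> 0" "v = c *s u"
      by blast
    then have "u = inverse c *s v"
      by (simp add: vec_eq_iff mult.assoc[symmetric])
    then show "v \<noteq> 0 \<and> u \<noteq> 0 \<and> (\<exists>c. c \<noteq> 0 \<and> u = c *s v)"
      using c nonzero_imp_inverse_nonzero by blast
  qed
  show "transp (\<lambda>u v::'k^3. u \<noteq> 0 \<and> v \<noteq> 0 \<and> (\<exists>c. c \<noteq> 0 \<and> v = c *s u))"
  proof (rule transpI)
    fix u v w :: "'k^3"
    assume "u \<noteq> 0 \<and> v \<noteq> 0 \<and> (\<exists>c. c \<noteq> 0 \<and> v = c *s u)"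
      and "v \<noteq> 0 \<and> w \<noteq> 0 \<and> (\<exists>c. c \<noteq> 0 \<and> w = c *s v)"
    then obtain c d where c: "u \<noteq> 0" "w \<noteq> 0" "c \<noteq> 0" "d \<noteq> 0" "v = c *s u" "w = d *s v"
      by blast
    then have "d * c \<noteq> 0" "w = (d * c) *s u"
      by (simp_all add: vec_eq_iff mult.assoc)
    with c show "u \<noteq> 0 \<and> w \<noteq> 0 \<and> (\<exists>c. c \<noteq> 0 \<and> w = c *s u)"
      by blast
  qed
qed

definition represents :: "('k::field) ^ 3 \<Rightarrow> 'k proj_plane \<Rightarrow> bool" where
  "represents v p \<longleftrightarrow> v \<noteq> 0 \<and> abs_proj_plane v = p"

definition vanishes_at :: "(3, 'k::field) mpoly \<Rightarrow> 'k proj_plane \<Rightarrow> bool" where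
  "vanishes_at F p \<longleftrightarrow> (\<forall>v. represents v p \<longrightarrow> eval_mpoly F (\<lambda>j. v $ j) = 0)"


section \<open>Ideals of points and double points, Hilbert functions\<close>

definition ideal_of_point :: "'k::field proj_plane \<Rightarrow> (3, 'k) mpoly set" where
  "ideal_of_point p = ideal_generated {F. (\<exists>d. F \<in> forms d) \<and> vanishes_at F p}"

definition ideal_of_points :: "'k::field proj_plane set \<Rightarrow> (3, 'k) mpoly set" where
  "ideal_of_points X = (\<Inter>p\<in>X. ideal_of_point p)"

definition ideal_of_double_points :: "'k::field proj_plane set \<Rightarrow> (3, 'k) mpoly set" where
  "ideal_of_double_points X = (\<Inter>p\<in>X. ideal_square (ideal_of_point p))"

text \<open>
  The dimension of the image of \<open>V\<close> in the quotient by \<open>W\<close>: the number of elements of a finite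
  \<open>B \<subseteq> V\<close> whose classes modulo \<open>W\<close> form a basis of that image.
\<close>

definition dim_modulo :: "('v, 'k::field) mpoly set \<Rightarrow> ('v, 'k) mpoly set \<Rightarrow> nat" where
  "dim_modulo V W =
     (THE n. \<exists>B. B \<subseteq> V \<and> finite B \<and> card B = n \<and>
        (\<forall>F\<in>V. \<exists>!c. (\<forall>b. b \<notin> B \<longrightarrow> c b = 0) \<and> F - (\<Sum>b\<in>B. const (c b) * b) \<in> W))"

definition hilbert_function :: "(3, 'k::field) mpoly set \<Rightarrow> nat \<Rightarrow> nat" where
  "hilbert_function I d = dim_modulo (forms d) I"

text \<open>The value in degree \<open>-1\<close> is zero.\<close>

definition first_difference :: "(nat \<Rightarrow> nat) \<Rightarrow> nat \<Rightarrow> int" where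
  "first_difference h d = int (h d) - (if d = 0 then 0 else int (h (d - 1)))"

definition \<Delta>h_reduced :: "'k::field proj_plane set \<Rightarrow> nat \<Rightarrow> int" where
  "\<Delta>h_reduced X = first_difference (hilbert_function (ideal_of_points X))"

definition \<Delta>h_double :: "'k::field proj_plane set \<Rightarrow> nat \<Rightarrow> int" where
  "\<Delta>h_double X = first_difference (hilbert_function (ideal_of_double_points X))"


section \<open>Cubic curves and the points on them\<close>

text \<open>An irreducible cubic curve is given by an irreducible cubic form, unique up to scalars.\<close>

definition irreducible_cubic :: "(3, 'k::field) mpoly \<Rightarrow> bool" where
  "irreducible_cubic F \<longleftrightarrow> F \<in> forms 3 \<and> irreducible F"

definition curve :: "(3, 'k::field) mpoly \<Rightarrow> 'k proj_plane set" where
  "curve F = {p. vanishes_at F p}"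

definition singular_point :: "(3, 'k::field) mpoly \<Rightarrow> 'k proj_plane \<Rightarrow> bool" where
  "singular_point F p \<longleftrightarrow> p \<in> curve F \<and> (\<forall>j. vanishes_at (partial_deriv j F) p)"

definition smooth_curve :: "(3, 'k::field) mpoly \<Rightarrow> bool" where
  "smooth_curve F \<longleftrightarrow> (\<forall>p. \<not> singular_point F p)"

definition cubic_configuration ::
    "nat \<Rightarrow> nat \<Rightarrow> (3, 'k::field) mpoly \<Rightarrow> 'k proj_plane set \<Rightarrow> bool" where
  "cubic_configuration t \<delta> F X \<longleftrightarrow>
     irreducible_cubic F \<and>
     X \<subseteq> curve F \<and> finite X \<and> card X = 3 * t + \<delta> \<and>
     \<Delta>h_reduced X 0 = 1 \<and>
     \<Delta>h_reduced X 1 = 2 \<and>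
     (\<forall>i\<in>{2..t}. \<Delta>h_reduced X i = 3) \<and>
     \<Delta>h_reduced X (t + 1) = int \<delta> \<and>
     (\<forall>i\<ge>t + 2. \<Delta>h_reduced X i = 0) \<and>
     (smooth_curve F \<or> (\<forall>p\<in>X. \<not> singular_point F p))"


section \<open>The Zariski topology on tuples of points\<close>

text \<open>
  The coordinate \<open>j\<close> of the point number \<open>i\<close> is the variable \<open>(i, j)\<close>. A polynomial is
  multihomogeneous of multidegree \<open>d\<close> if it is homogeneous of degree \<open>d i\<close> in the coordinates of
  the point number \<open>i\<close>; only the points numbered below \<open>n\<close> may be involved.
\<close>

definition multihomogeneous :: "nat \<Rightarrow> (nat \<times> 3, 'k::field) mpoly \<Rightarrow> bool" where
  "multihomogeneous n G \<longleftrightarrow>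
     (\<exists>d. (\<forall>i\<ge>n. d i = 0) \<and>
        (\<forall>m\<in>Poly_Mapping.keys G. \<forall>i. (\<Sum>j\<in>UNIV. Poly_Mapping.lookup m (i, j)) = d i))"

definition tuple_nonvanishing ::
    "nat \<Rightarrow> (nat \<times> 3, 'k::field) mpoly \<Rightarrow> (nat \<Rightarrow> 'k proj_plane) set" where
  "tuple_nonvanishing n G =
     {p \<in> {..<n} \<rightarrow>\<^sub>E UNIV.
        \<forall>v. (\<forall>i<n. represents (v i) (p i)) \<longrightarrow> eval_mpoly G (\<lambda>(i, j). v i $ j) \<noteq> 0}"

text \<open>
  The Zariski topology on the \<open>n\<close>-fold product of the projective plane with itself (not the
  product of the Zariski topologies): the closed sets are the common zero loci of families of
  multihomogeneous polynomials. Tuples are extensional functions on \<open>{..<n}\<close>.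
\<close>

definition zariski_tuples :: "nat \<Rightarrow> (nat \<Rightarrow> 'k::field proj_plane) topology" where
  "zariski_tuples n = topology_generated_by {tuple_nonvanishing n G | G. multihomogeneous n G}"

definition zariski_curve_power ::
    "nat \<Rightarrow> (3, 'k::field) mpoly \<Rightarrow> (nat \<Rightarrow> 'k proj_plane) topology" where
  "zariski_curve_power n F = subtopology (zariski_tuples n) ({..<n} \<rightarrow>\<^sub>E curve F)"

end

theory Submission
  imports
    Defs
    "Berlekamp_Zassenhaus.Unique_Factorization_Poly"
    "Jordan_Normal_Form.Determinant"
begin

text \<open>
  Let \<open>Y d\<close> be the space of forms of degree \<open>d\<close> whose restriction to the cubic \<open>F\<close> vanishes
  doubly along \<open>X\<close>. A form that is singular along \<open>X\<close> lies in \<open>Y d\<close>, and \<open>F H\<close> is singular along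
  \<open>X\<close> iff \<open>H\<close> vanishes on \<open>X\<close>. If \<open>3 d < 2 n\<close>, then every element of \<open>Y d\<close> is a multiple of \<open>F\<close> by
  the theorem of Bezout. If \<open>X\<close> imposes independent conditions in degree \<open>d - 3\<close>, then every element
  of \<open>Y d\<close> becomes singular along \<open>X\<close> after adding a multiple of \<open>F\<close>. One of the two applies in
  each degree, so that the Hilbert function of \<open>2X\<close> is determined by that of \<open>X\<close> and by the
  dimension of \<open>Y d\<close> for \<open>3 d \<ge> 2 n\<close>, a Riemann-Roch problem for a divisor of degree \<open>3 d - 2 n\<close> on
  the cubic. Only degree zero, that is \<open>\<delta> = 0\<close> and \<open>d = 2 t\<close>, leaves a choice: whether or not
  \<open>Y (2 t)\<close> exceeds the multiples of \<open>F\<close> by one dimension.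

  Both cases occur on a nodal or cuspidal cubic, where \<open>Y (2 t)\<close> can be read off from a
  parametrization. On a smooth cubic the choice is decided by a determinant in the coordinates of
  the points, and moving a single point shows that this determinant does not vanish identically.
\<close>

section \<open>Substitution homomorphisms\<close>

text \<open>Bezout and Riemann-Roch are obtained by counting dimensions, without intersection
  multiplicities, so singular cubics are covered as long as the points are simple. In one large
  degree all conditions at the points are independent, while a form \<open>G\<close> not divisible
  by \<open>F\<close> generates together with \<open>F\<close> at least as much as a complete
  intersection; the comparison is Bezout. The arithmetic genus of a cubic enters in a single place,
  residual degree \<open>3 d - \<nu> = 1\<close>: a nonconstant quotient of two such forms would
  give a relation of degree two modulo \<open>F\<close>, too small to be a multiple of
  \<open>F\<close>. The other degrees are reduced to \<open>1\<close> or to a negative one by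
  imposing extra simple points, each costing at most one dimension.

  The characteristic is arbitrary: a smooth cubic might a priori be strange, and the square roots of
  \<open>1\<close> that separate the two Hilbert functions on a nodal cubic coincide in
  characteristic two. On a parametrized cubic both questions, for points and for their doubles,
  become whether a polynomial, respectively its square, descends from the line to the curve.\<close>

abbreviation (input) lookup where "lookup \<equiv> Poly_Mapping.lookup"
abbreviation (input) keys where "keys \<equiv> Poly_Mapping.keys"

definition monomial_at :: "('v \<Rightarrow> 'r::comm_ring_1) \<Rightarrow> ('v \<Rightarrow>\<^sub>0 nat) \<Rightarrow> 'r" where
  "monomial_at x m = (\<Prod>i\<in>keys m. x i ^ lookup m i)"

text \<open>Evaluation, restriction to a line, passage to iterated univariate polynomials, pullback
  to a parametrization and renaming of variables are all instances, for different coefficient maps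
  \<open>c\<close>.\<close>

definition mhom :: "('k::field \<Rightarrow> 'r::comm_ring_1) \<Rightarrow> ('v \<Rightarrow> 'r) \<Rightarrow> ('v, 'k) mpoly \<Rightarrow> 'r" where
  "mhom c x F = (\<Sum>m\<in>keys F. c (lookup F m) * monomial_at x m)"

definition Var :: "'v \<Rightarrow> ('v, 'k::field) mpoly" where
  "Var i = Poly_Mapping.single (Poly_Mapping.single i 1) 1"

lemma eval_mpoly_mhom: "eval_mpoly F x = mhom (\<lambda>a. a) x F"
  by (simp add: eval_mpoly_def mhom_def monomial_at_def)

lemma comm_ring_hom_id: "comm_ring_hom (\<lambda>a :: 'a::comm_ring_1. a)"
  by unfold_locales auto

lemma comm_ring_hom_const: "comm_ring_hom (const :: 'k::field \<Rightarrow> ('v, 'k) mpoly)"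
  by unfold_locales (auto simp: const_def single_add mult_single)

lemma comm_ring_hom_pCons: "comm_ring_hom (\<lambda>a :: 'a::comm_ring_1. [:a:])"
  by unfold_locales (auto simp: one_pCons)

lemma comm_ring_hom_poly: "comm_ring_hom (\<lambda>p :: 'a::comm_ring_1 poly. poly p u)"
  by unfold_locales auto

lemma const_simps [simp]: "const 0 = 0" "const 1 = 1"
  "const (a + b) = const a + const b" "const (a * b) = const a * const b"
  "const (- a) = - const a" "const (a - b) = const a - const b"
  by (auto simp: const_def single_add mult_single single_uminus single_diff)

lemma const_eq_iff [simp]: "const a = const b \<longleftrightarrow> a = b"
  unfolding const_def by (metis lookup_single_eq)

lemma const_eq_0_iff [simp]: "const a = 0 \<longleftrightarrow> a = 0"
  using const_eq_iff[of a 0] by (simp del: const_eq_iff)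

lemma lookup_const_mult [simp]: "lookup (const c * F) m = c * lookup F m"
proof -
  have "const c * F = Poly_Mapping.map ((*) c) F"
    by (simp add: const_def mult_map_scale_conv_mult)
  then show ?thesis
    by (simp add: Poly_Mapping.map.rep_eq when_def)
qed

lemma const_divide_mult: "const (1 / b) * (const a * G) = const (a / b) * G"
  by (simp add: mult.assoc[symmetric] const_simps(4)[symmetric] del: const_simps(4))

lemma const_inverse_mult: "a \<noteq> 0 \<Longrightarrow> const (1 / a) * (const a * G) = G"
  by (simp add: const_divide_mult)

lemma monomial_at_superset:
  assumes "finite S" "keys m \<subseteq> S"
  shows "monomial_at x m = (\<Prod>i\<in>S. x i ^ lookup m i)"
  unfolding monomial_at_def using assms
  by (intro prod.mono_neutral_left) (auto simp: in_keys_iff)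

lemma monomial_at_0 [simp]: "monomial_at x 0 = 1"
  by (simp add: monomial_at_def)

lemma monomial_at_add: "monomial_at x (m + n) = monomial_at x m * monomial_at x n"
proof -
  let ?S = "keys m \<union> keys n"
  have "monomial_at x (m + n) = (\<Prod>i\<in>?S. x i ^ lookup (m + n) i)"
    by (rule monomial_at_superset) (auto simp: Poly_Mapping.keys_add)
  also have "\<dots> = (\<Prod>i\<in>?S. x i ^ lookup m i) * (\<Prod>i\<in>?S. x i ^ lookup n i)"
    by (simp add: lookup_add power_add prod.distrib)
  also have "\<dots> = monomial_at x m * monomial_at x n"
    by (simp add: monomial_at_superset[of ?S m] monomial_at_superset[of ?S n])
  finally show ?thesis .
qed

lemma monomial_at_single: "monomial_at x (Poly_Mapping.single i n) = x i ^ n"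
  by (cases "n = 0") (auto simp: monomial_at_def)

lemma mpoly_sum_monomials:
  "F = (\<Sum>m\<in>keys F. Poly_Mapping.single m (lookup F m))"
  by (rule poly_mapping_eqI)
     (auto simp: lookup_sum lookup_single when_def in_keys_iff)

lemma mpoly_induct [case_names zero monomial add]:
  assumes "P 0" and "\<And>m a. P (Poly_Mapping.single m a)"
    and "\<And>F G. P F \<Longrightarrow> P G \<Longrightarrow> P (F + G)"
  shows "P (F :: ('v, 'k::field) mpoly)"
proof -
  have "P (\<Sum>m\<in>S. Poly_Mapping.single m (lookup F m))" if "finite S" for S
    using that by (induction S rule: finite_induct) (use assms in auto)
  then show ?thesis
    using mpoly_sum_monomials[of F] finite_keys[of F] by metis
qed

lemma mhom_superset:
  assumes "comm_ring_hom c" "finite S" "keys F \<subseteq> S"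
  shows "mhom c x F = (\<Sum>m\<in>S. c (lookup F m) * monomial_at x m)"
proof -
  interpret comm_ring_hom c by fact
  show ?thesis
    unfolding mhom_def using assms
    by (intro sum.mono_neutral_left) (auto simp: in_keys_iff)
qed

context
  fixes c :: "'k::field \<Rightarrow> 'r::comm_ring_1"
  assumes c: "comm_ring_hom c"
begin

interpretation comm_ring_hom c by (fact c)

lemma mhom_0 [simp]: "mhom c x 0 = 0"
  by (simp add: mhom_def)

lemma mhom_monomial: "mhom c x (Poly_Mapping.single m a) = c a * monomial_at x m"
  by (subst mhom_superset[OF c, of "{m}"]) auto

lemma mhom_add: "mhom c x (F + G) = mhom c x F + mhom c x G"
proof -
  let ?S = "keys F \<union> keys G"
  have "mhom c x (F + G) = (\<Sum>m\<in>?S. c (lookup (F + G) m) * monomial_at x m)"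
    by (rule mhom_superset[OF c]) (auto simp: Poly_Mapping.keys_add)
  also have "\<dots> = mhom c x F + mhom c x G"
    by (simp add: mhom_superset[OF c, of ?S F] mhom_superset[OF c, of ?S G]
        lookup_add hom_add distrib_right sum.distrib)
  finally show ?thesis .
qed

lemma mhom_mult: "mhom c x (F * G) = mhom c x F * mhom c x G"
proof (induction F rule: mpoly_induct)
  case (monomial m a)
  show ?case
  proof (induction G rule: mpoly_induct)
    case (monomial n b)
    show ?case
      by (simp add: mult_single mhom_monomial monomial_at_add hom_mult)
  qed (simp_all add: mhom_add distrib_left)
qed (simp_all add: mhom_add distrib_right)

lemma mhom_const [simp]: "mhom c x (const a) = c a"
  by (simp add: const_def mhom_monomial)

lemma mhom_Var [simp]: "mhom c x (Var i) = x i"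
  by (simp add: Var_def mhom_monomial monomial_at_single)

lemma comm_ring_hom_mhom: "comm_ring_hom (mhom c x)"
  by unfold_locales (use mhom_const[of x 1] in \<open>auto simp: mhom_add mhom_mult\<close>)

lemma hom_mhom:
  assumes "comm_ring_hom h"
  shows "h (mhom c x F) = mhom (\<lambda>a. h (c a)) (\<lambda>i. h (x i)) F"
proof -
  interpret h: comm_ring_hom h by fact
  show ?thesis
    by (simp add: mhom_def h.hom_sum h.hom_mult monomial_at_def h.hom_prod h.hom_power)
qed

end

text \<open>Ring homomorphisms and derivations are determined by constants and variables; identities
  between them are checked by this induction.\<close>

lemma mpoly_generated [case_names const Var add mult]:
  assumes const: "\<And>a. P (const a)" and var: "\<And>i. P (Var i)"
    and add: "\<And>F G. P F \<Longrightarrow> P G \<Longrightarrow> P (F + G)"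
    and mult: "\<And>F G. P F \<Longrightarrow> P G \<Longrightarrow> P (F * G)"
  shows "P (F :: ('v, 'k::field) mpoly)"
proof (induction F rule: mpoly_induct)
  case zero
  show ?case using const[of 0] by simp
next
  case (monomial m a)
  have one: "P 1" using const[of 1] by simp
  have pw: "P (Poly_Mapping.single (Poly_Mapping.single i n) 1)" for i n
  proof (induction n)
    case (Suc n)
    have "Poly_Mapping.single (Poly_Mapping.single i (Suc n)) 1 =
        Var i * Poly_Mapping.single (Poly_Mapping.single i n) (1::'k)"
      by (simp add: Var_def mult_single flip: single_add)
    with Suc show ?case by (auto intro: mult var)
  qed (use one in simp)
  have m: "m = (\<Sum>i\<in>keys m. Poly_Mapping.single i (lookup m i))"
    by (rule poly_mapping_eqI) (auto simp: lookup_sum lookup_single when_def in_keys_iff)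
  have "P (Poly_Mapping.single (\<Sum>i\<in>S. Poly_Mapping.single i (lookup m i)) 1)"
    if "finite S" for S
    using that
  proof (induction S rule: finite_induct)
    case (insert i S)
    have "Poly_Mapping.single (\<Sum>i\<in>insert i S. Poly_Mapping.single i (lookup m i)) 1 =
        Poly_Mapping.single (Poly_Mapping.single i (lookup m i)) 1 *
        Poly_Mapping.single (\<Sum>i\<in>S. Poly_Mapping.single i (lookup m i)) (1::'k)"
      using insert by (simp add: mult_single)
    with insert pw show ?case by (auto intro: mult)
  qed (use one in simp)
  from this[of "keys m"] m have "P (Poly_Mapping.single m 1)" by simp
  moreover have "Poly_Mapping.single m a = const a * Poly_Mapping.single m 1"
    by (simp add: const_def mult_single)
  ultimately show ?case by (auto intro: mult const)
qed (rule add)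

lemma eval_simps [simp]:
  "eval_mpoly 0 v = 0" "eval_mpoly 1 v = 1"
  "eval_mpoly (F + G) v = eval_mpoly F v + eval_mpoly G v"
  "eval_mpoly (F * G) v = eval_mpoly F v * eval_mpoly G v"
  "eval_mpoly (- F) v = - eval_mpoly F v"
  "eval_mpoly (F - G) v = eval_mpoly F v - eval_mpoly G v"
  "eval_mpoly (const c) v = c" "eval_mpoly (Var i) v = v i"
  "eval_mpoly (F ^ n) v = eval_mpoly F v ^ n"
proof -
  have e: "comm_ring_hom (\<lambda>F. eval_mpoly F v)"
    using comm_ring_hom_mhom[OF comm_ring_hom_id, of v] by (simp add: eval_mpoly_mhom[abs_def])
  interpret comm_ring_hom "\<lambda>F. eval_mpoly F v" by (fact e)
  show "eval_mpoly 0 v = 0" "eval_mpoly 1 v = 1"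
    "eval_mpoly (F + G) v = eval_mpoly F v + eval_mpoly G v"
    "eval_mpoly (F * G) v = eval_mpoly F v * eval_mpoly G v"
    "eval_mpoly (- F) v = - eval_mpoly F v"
    "eval_mpoly (F - G) v = eval_mpoly F v - eval_mpoly G v"
    "eval_mpoly (F ^ n) v = eval_mpoly F v ^ n"
    by (simp_all add: hom_add hom_mult hom_power hom_uminus hom_minus)
  show "eval_mpoly (const c) v = c" "eval_mpoly (Var i) v = v i"
    by (simp_all add: eval_mpoly_mhom mhom_const[OF comm_ring_hom_id] mhom_Var[OF comm_ring_hom_id])
qed

lemma eval_sum [simp]: "eval_mpoly (\<Sum>i\<in>S. f i) v = (\<Sum>i\<in>S. eval_mpoly (f i) v)"
  by (induction S rule: infinite_finite_induct) auto

lemma eval_prod [simp]: "eval_mpoly (\<Prod>i\<in>S. f i) v = (\<Prod>i\<in>S. eval_mpoly (f i) v)"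
  by (induction S rule: infinite_finite_induct) auto

section \<open>Forms\<close>

definition total_deg :: "('v::finite \<Rightarrow>\<^sub>0 nat) \<Rightarrow> nat" where
  "total_deg m = (\<Sum>i\<in>UNIV. lookup m i)"

lemma total_deg_simps [simp]:
  "total_deg 0 = 0" "total_deg (m + n) = total_deg m + total_deg n"
  "total_deg (Poly_Mapping.single i k) = k"
  by (auto simp: total_deg_def lookup_add sum.distrib lookup_single when_def)

lemma forms_iff: "F \<in> forms d \<longleftrightarrow> (\<forall>m. lookup F m \<noteq> 0 \<longrightarrow> total_deg m = d)"
  by (auto simp: forms_def total_deg_def in_keys_iff)

lemma forms_0 [simp]: "0 \<in> forms d"
  by (simp add: forms_iff)

lemma forms_add [intro]: "F \<in> forms d \<Longrightarrow> G \<in> forms d \<Longrightarrow> F + G \<in> forms d"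
  unfolding forms_iff lookup_add by (metis add_0)

lemma forms_uminus [intro]: "F \<in> forms d \<Longrightarrow> - F \<in> forms d"
  by (simp add: forms_iff)

lemma forms_diff [intro]: "F \<in> forms d \<Longrightarrow> G \<in> forms d \<Longrightarrow> F - G \<in> forms d"
  using forms_add[of F d "- G"] by auto

lemma forms_sum [intro]: "(\<And>i. i \<in> S \<Longrightarrow> f i \<in> forms d) \<Longrightarrow> (\<Sum>i\<in>S. f i) \<in> forms d"
  by (induction S rule: infinite_finite_induct) auto

lemma forms_monomial: "total_deg m = d \<Longrightarrow> Poly_Mapping.single m a \<in> forms d"
  by (auto simp: forms_iff lookup_single when_def)

lemma forms_const [intro]: "const c \<in> forms 0"
  unfolding const_def by (rule forms_monomial) simp

lemma forms_1 [intro]: "1 \<in> forms 0"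
  using forms_const[of 1] by simp

lemma forms_Var [intro]: "Var i \<in> forms 1"
  unfolding Var_def by (rule forms_monomial) simp

lemma forms_mult: "F \<in> forms d \<Longrightarrow> G \<in> forms e \<Longrightarrow> F * G \<in> forms (d + e)"
  unfolding forms_def total_deg_def[symmetric]
  using keys_mult[of F G] by force

lemma forms_mult': "F \<in> forms d \<Longrightarrow> G \<in> forms e \<Longrightarrow> n = d + e \<Longrightarrow> F * G \<in> forms n"
  using forms_mult by blast

lemma forms_const_mult [intro]: "F \<in> forms d \<Longrightarrow> const c * F \<in> forms d"
  using forms_mult[OF forms_const, of F d c] by simp

lemma forms_power: "F \<in> forms d \<Longrightarrow> F ^ n \<in> forms (n * d)"
  by (induction n) (auto intro: forms_mult')

lemma forms_prod: "(\<And>i. i \<in> S \<Longrightarrow> f i \<in> forms (d i)) \<Longrightarrow> (\<Prod>i\<in>S. f i) \<in> forms (\<Sum>i\<in>S. d i)"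
  by (induction S rule: infinite_finite_induct) (auto intro: forms_mult)

lemma total_deg_0_iff: "total_deg m = 0 \<longleftrightarrow> m = 0"
  by (auto simp: total_deg_def intro: poly_mapping_eqI)

lemma forms_0E:
  assumes "F \<in> forms 0" obtains c where "F = const c"
proof
  show "F = const (lookup F 0)"
    using assms by (intro poly_mapping_eqI) (auto simp: forms_iff const_def lookup_single when_def total_deg_0_iff)
qed

lemma mhom_homogeneous:
  assumes "comm_ring_hom c" "F \<in> forms d"
  shows "mhom c (\<lambda>i. t * x i) F = t ^ d * mhom c x F"
proof -
  have "monomial_at (\<lambda>i. t * x i) m = t ^ d * monomial_at x m" if "m \<in> keys F" for m
    using assms(2) that
    by (simp add: monomial_at_superset[of UNIV] power_mult_distrib prod.distrib forms_def flip: power_sum)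
  then show ?thesis
    by (simp add: mhom_def sum_distrib_left algebra_simps)
qed

lemma eval_homogeneous: "F \<in> forms d \<Longrightarrow> eval_mpoly F (\<lambda>i. t * x i) = t ^ d * eval_mpoly F x"
  by (simp add: eval_mpoly_mhom mhom_homogeneous comm_ring_hom_id)

lemma eval_form_zero: "F \<in> forms d \<Longrightarrow> d > 0 \<Longrightarrow> eval_mpoly F (\<lambda>i. 0) = 0"
  using eval_homogeneous[of F d 0 "\<lambda>i. 0"] by (simp add: zero_power)

definition hcomp :: "nat \<Rightarrow> ('v::finite, 'k::field) mpoly \<Rightarrow> ('v, 'k) mpoly" where
  "hcomp d F = (\<Sum>m\<in>keys F. if total_deg m = d then Poly_Mapping.single m (lookup F m) else 0)"

lemma lookup_hcomp: "lookup (hcomp d F) m = (if total_deg m = d then lookup F m else 0)"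
proof -
  have "lookup (hcomp d F) m =
      (\<Sum>n\<in>keys F. if n = m then (if total_deg m = d then lookup F m else 0) else 0)"
    unfolding hcomp_def lookup_sum by (rule sum.cong) (auto simp: lookup_single when_def)
  then show ?thesis by (auto simp: in_keys_iff)
qed

lemma hcomp_in_forms: "hcomp d F \<in> forms d"
  by (auto simp: forms_iff lookup_hcomp)

lemma hcomp_add: "hcomp d (F + G) = hcomp d F + hcomp d G"
  by (rule poly_mapping_eqI) (simp add: lookup_hcomp lookup_add)

lemma hcomp_0 [simp]: "hcomp d 0 = 0"
  by (rule poly_mapping_eqI) (simp add: lookup_hcomp)

lemma hcomp_sum: "hcomp d (\<Sum>i\<in>S. f i) = (\<Sum>i\<in>S. hcomp d (f i))"
  by (induction S rule: infinite_finite_induct) (auto simp: hcomp_add)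

lemma hcomp_form: "F \<in> forms e \<Longrightarrow> hcomp d F = (if d = e then F else 0)"
  by (rule poly_mapping_eqI) (auto simp: lookup_hcomp forms_iff)

lemma hcomp_mult_form:
  assumes "F \<in> forms e"
  shows "hcomp d (F * G) = (if d < e then 0 else F * hcomp (d - e) G)"
proof (induction G rule: mpoly_induct)
  case (monomial m a)
  have m: "Poly_Mapping.single m a \<in> forms (total_deg m)"
    by (rule forms_monomial) simp
  show ?case
    by (auto simp: hcomp_form[OF m] hcomp_form[OF forms_mult[OF assms m]])
qed (simp_all add: hcomp_add distrib_left)

lemma sum_hcomp: "\<exists>N. F = (\<Sum>d\<le>N. hcomp d F)"
proof
  let ?N = "\<Sum>m\<in>keys F. total_deg m"
  have "total_deg m \<le> ?N" if "lookup F m \<noteq> 0" for m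
    using that by (intro member_le_sum) (auto simp: in_keys_iff)
  then have "lookup F m = 0" if "?N < total_deg m" for m
    using that by (metis not_le)
  then show "F = (\<Sum>d\<le>?N. hcomp d F)"
    by (intro poly_mapping_eqI) (auto simp: lookup_sum lookup_hcomp not_le)
qed

text \<open>The cofactor may be replaced by its component of degree \<open>d - e\<close>, because
  multiplication by the form \<open>F\<close> only shifts homogeneous components.\<close>

lemma form_dvd_formE:
  fixes F G :: "(3, 'k::field) mpoly"
  assumes "F \<in> forms e" "G \<in> forms d" "F dvd G" "G \<noteq> 0"
  obtains H where "G = F * H" "H \<in> forms (d - e)" "e \<le> d"
proof -
  from assms obtain A where A: "G = F * A" by (auto elim: dvdE)
  have "G = hcomp d G" using assms by (simp add: hcomp_form)
  with A hcomp_mult_form[OF assms(1), of d A] assms(4) that hcomp_in_forms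
  show ?thesis by (metis linorder_not_less)
qed

section \<open>Restriction to lines and derivatives\<close>

definition line_poly :: "('v, 'k::field) mpoly \<Rightarrow> ('v \<Rightarrow> 'k) \<Rightarrow> ('v \<Rightarrow> 'k) \<Rightarrow> 'k poly" where
  "line_poly F v w = mhom (\<lambda>a. [:a:]) (\<lambda>i. [:v i, w i:]) F"

text \<open>The linear coefficient of the restriction to the line \<open>v + s w\<close> makes sense
  in every characteristic, and the product rule is multiplication of polynomials modulo the square
  of the parameter.\<close>

definition dir_deriv :: "('v, 'k::field) mpoly \<Rightarrow> ('v \<Rightarrow> 'k) \<Rightarrow> ('v \<Rightarrow> 'k) \<Rightarrow> 'k" where
  "dir_deriv F v w = coeff (line_poly F v w) 1"

lemma line_poly_simps [simp]:
  "line_poly 0 v w = 0" "line_poly 1 v w = 1"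
  "line_poly (F + G) v w = line_poly F v w + line_poly G v w"
  "line_poly (F * G) v w = line_poly F v w * line_poly G v w"
  "line_poly (- F) v w = - line_poly F v w"
  "line_poly (F - G) v w = line_poly F v w - line_poly G v w"
  "line_poly (const a) v w = [:a:]" "line_poly (Var i) v w = [:v i, w i:]"
  "line_poly (F ^ n) v w = line_poly F v w ^ n"
proof -
  have e: "comm_ring_hom (\<lambda>F. line_poly F v w)"
    using comm_ring_hom_mhom[OF comm_ring_hom_pCons, of "\<lambda>i. [:v i, w i:]"]
    by (simp add: line_poly_def[abs_def])
  interpret comm_ring_hom "\<lambda>F. line_poly F v w" by (fact e)
  show "line_poly 0 v w = 0" "line_poly 1 v w = 1"
    "line_poly (F + G) v w = line_poly F v w + line_poly G v w"
    "line_poly (F * G) v w = line_poly F v w * line_poly G v w"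
    "line_poly (- F) v w = - line_poly F v w"
    "line_poly (F - G) v w = line_poly F v w - line_poly G v w"
    "line_poly (F ^ n) v w = line_poly F v w ^ n"
    by (simp_all add: hom_add hom_mult hom_power hom_uminus hom_minus)
  show "line_poly (const a) v w = [:a:]" "line_poly (Var i) v w = [:v i, w i:]"
    by (simp_all add: line_poly_def mhom_const[OF comm_ring_hom_pCons] mhom_Var[OF comm_ring_hom_pCons])
qed

lemma poly_line_poly: "poly (line_poly F v w) u = eval_mpoly F (\<lambda>i. v i + u * w i)"
  unfolding line_poly_def hom_mhom[OF comm_ring_hom_pCons comm_ring_hom_poly]
  by (simp add: eval_mpoly_mhom)

lemma coeff_0_line_poly: "coeff (line_poly F v w) 0 = eval_mpoly F v"
  using poly_line_poly[of F v w 0] by (simp add: poly_0_coeff_0)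

lemma coeff_1_mult: "coeff (p * q) 1 = coeff p 0 * coeff q 1 + coeff p 1 * coeff q (0::nat)"
  by (simp add: coeff_mult)

lemma dir_deriv_simps [simp]:
  "dir_deriv 0 v w = 0" "dir_deriv 1 v w = 0"
  "dir_deriv (F + G) v w = dir_deriv F v w + dir_deriv G v w"
  "dir_deriv (- F) v w = - dir_deriv F v w"
  "dir_deriv (F - G) v w = dir_deriv F v w - dir_deriv G v w"
  "dir_deriv (const c) v w = 0" "dir_deriv (Var i) v w = w i"
  by (simp_all add: dir_deriv_def)

lemma dir_deriv_mult [simp]:
  "dir_deriv (F * G) v w = eval_mpoly F v * dir_deriv G v w + dir_deriv F v w * eval_mpoly G v"
  unfolding dir_deriv_def line_poly_simps coeff_1_mult coeff_0_line_poly ..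

lemma dir_deriv_sum [simp]: "dir_deriv (\<Sum>i\<in>S. f i) v w = (\<Sum>i\<in>S. dir_deriv (f i) v w)"
  by (induction S rule: infinite_finite_induct) auto

lemma dir_deriv_add_right: "dir_deriv F v (\<lambda>i. w i + u i) = dir_deriv F v w + dir_deriv F v u"
  by (induction F rule: mpoly_generated) (auto simp: algebra_simps)

lemma dir_deriv_scale_right: "dir_deriv F v (\<lambda>i. c * w i) = c * dir_deriv F v w"
  by (induction F rule: mpoly_generated) (auto simp: algebra_simps)

text \<open>On the line through \<open>v\<close> in its own direction the moving point is
  \<open>(1 + s) v\<close>, so homogeneity gives \<open>(1 + s) ^ d\<close> times the value at
  \<open>v\<close>.\<close>

lemma dir_deriv_euler:
  assumes "F \<in> forms d" shows "dir_deriv F v v = of_nat d * eval_mpoly F v"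
proof -
  have "line_poly F v v = mhom (\<lambda>a. [:a:]) (\<lambda>i. [:1, 1:] * [:v i:]) F"
    by (simp add: line_poly_def mult.commute)
  also have "\<dots> = [:1, 1:] ^ d * mhom (\<lambda>a. [:a:]) (\<lambda>i. [:v i:]) F"
    by (rule mhom_homogeneous[OF comm_ring_hom_pCons assms])
  also have "mhom (\<lambda>a. [:a:]) (\<lambda>i. [:v i:]) F = [:eval_mpoly F v:]"
    using hom_mhom[OF comm_ring_hom_id comm_ring_hom_pCons, of v F] by (simp add: eval_mpoly_mhom)
  finally have *: "line_poly F v v = [:1, 1:] ^ d * [:eval_mpoly F v:]" .
  have "coeff ([:1, 1:] ^ d :: 'b poly) 0 = 1 \<and> coeff ([:1, 1:] ^ d :: 'b poly) 1 = of_nat d"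
    by (induction d) (auto simp: coeff_1_mult mult.commute coeff_mult)
  then show ?thesis by (simp add: dir_deriv_def *)
qed

lemma dir_deriv_homogeneous:
  assumes "F \<in> forms d" shows "t * dir_deriv F (\<lambda>i. t * v i) w = t ^ d * dir_deriv F v w"
proof -
  have "line_poly F (\<lambda>i. t * v i) (\<lambda>i. t * w i) = [:t:] ^ d * line_poly F v w"
    unfolding line_poly_def
    using mhom_homogeneous[OF comm_ring_hom_pCons assms, of "[:t:]" "\<lambda>i. [:v i, w i:]"] by (simp add: mult.commute)
  then have "dir_deriv F (\<lambda>i. t * v i) (\<lambda>i. t * w i) = t ^ d * dir_deriv F v w"
    by (simp add: dir_deriv_def poly_const_pow)
  then show ?thesis by (simp add: dir_deriv_scale_right)
qed

lemma coeff_mult_top: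
  fixes p q :: "'a::comm_semiring_1 poly"
  assumes "degree p \<le> m" "degree q \<le> n"
  shows "coeff (p * q) (m + n) = coeff p m * coeff q n"
proof -
  have "coeff (p * q) (m + n) = (\<Sum>i\<le>m + n. if i = m then coeff p m * coeff q n else 0)"
    unfolding coeff_mult
  proof (rule sum.cong)
    fix i assume "i \<in> {..m + n}"
    show "coeff p i * coeff q (m + n - i) = (if i = m then coeff p m * coeff q n else 0)"
    proof (cases i m rule: linorder_cases)
      case less
      then show ?thesis using assms by (simp add: coeff_eq_0)
    next
      case greater
      then show ?thesis using assms by (simp add: coeff_eq_0)
    qed simp
  qed simp
  then show ?thesis by simp
qed

text \<open>The direction \<open>w\<close> is the point at infinity of the line, so the value there
  is the coefficient in degree \<open>d\<close>, and the degree falls below \<open>d\<close> only if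
  that value vanishes.\<close>

lemma line_poly_form:
  assumes "F \<in> forms d"
  shows "degree (line_poly F v w) \<le> d" "coeff (line_poly F v w) d = eval_mpoly F w"
proof -
  have pow: "degree ([:a, b:] ^ n) \<le> n \<and> coeff ([:a, b:] ^ n) n = b ^ n" for a b :: 'b and n
  proof (induction n)
    case (Suc n)
    have "degree [:a, b:] \<le> 1" by simp
    from coeff_mult_top[OF this conjunct1[OF Suc]] Suc
      degree_mult_le[of "[:a, b:]" "[:a, b:] ^ n"]
    show ?case by (auto split: if_splits)
  qed simp
  have prd: "degree (\<Prod>i\<in>S. [:v i, w i:] ^ e i) \<le> (\<Sum>i\<in>S. e i) \<and>
      coeff (\<Prod>i\<in>S. [:v i, w i:] ^ e i) (\<Sum>i\<in>S. e i) = (\<Prod>i\<in>S. w i ^ e i)"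
    if "finite S" for S and e :: "'a \<Rightarrow> nat"
    using that
  proof (induction S rule: finite_induct)
    case (insert i S)
    from coeff_mult_top[OF conjunct1[OF pow] conjunct1[OF insert(3)], of "v i" "w i" "e i"]
      degree_mult_le[of "[:v i, w i:] ^ e i" "\<Prod>i\<in>S. [:v i, w i:] ^ e i"]
      pow[of "v i" "w i" "e i"] insert
    show ?case by auto
  qed simp
  have mon: "degree (monomial_at (\<lambda>i. [:v i, w i:]) m) \<le> d \<and>
      coeff (monomial_at (\<lambda>i. [:v i, w i:]) m) d = monomial_at w m" if "m \<in> keys F" for m
    using prd[of UNIV "lookup m"] that assms
    by (simp add: monomial_at_superset[of UNIV] forms_def)
  show "degree (line_poly F v w) \<le> d"
    unfolding line_poly_def mhom_def using mon
    by (intro degree_sum_le) (auto intro: order.trans[OF degree_smult_le])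
  show "coeff (line_poly F v w) d = eval_mpoly F w"
    unfolding line_poly_def mhom_def eval_mpoly_mhom using mon
    by (auto simp: coeff_sum intro!: sum.cong)
qed

section \<open>Partial derivatives\<close>

lemma partial_deriv_superset:
  assumes "finite S" "keys F \<subseteq> S"
  shows "partial_deriv j F = (\<Sum>m\<in>S. Poly_Mapping.single (m - Poly_Mapping.single j 1)
     (of_nat (lookup m j) * lookup F m))"
  unfolding partial_deriv_def using assms
  by (intro sum.mono_neutral_left) (auto simp: in_keys_iff)

lemma partial_deriv_add [simp]: "partial_deriv j (F + G) = partial_deriv j F + partial_deriv j G"
proof -
  let ?S = "keys F \<union> keys G"
  show ?thesis
    by (subst (1 2 3) partial_deriv_superset[of ?S])
       (auto simp: Poly_Mapping.keys_add lookup_add distrib_left single_add sum.distrib)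
qed

lemma partial_deriv_monomial:
  "partial_deriv j (Poly_Mapping.single m a) =
     Poly_Mapping.single (m - Poly_Mapping.single j 1) (of_nat (lookup m j) * a)"
  by (subst partial_deriv_superset[of "{m}"]) auto

lemma partial_deriv_0 [simp]: "partial_deriv j 0 = 0"
  by (simp add: partial_deriv_def)

lemma partial_deriv_mult:
  "partial_deriv j (F * G) = F * partial_deriv j G + partial_deriv j F * G"
proof (induction F rule: mpoly_induct)
  case (monomial m a)
  show ?case
  proof (induction G rule: mpoly_induct)
    case (monomial n b)
    have 1: "m + (n - Poly_Mapping.single j 1) = m + n - Poly_Mapping.single j 1"
      if "lookup n j \<noteq> 0"
      using that by (intro poly_mapping_eqI) (auto simp: lookup_add lookup_minus lookup_single when_def)
    have 2: "(m - Poly_Mapping.single j 1) + n = m + n - Poly_Mapping.single j 1"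
      if "lookup m j \<noteq> 0"
      using that by (intro poly_mapping_eqI) (auto simp: lookup_add lookup_minus lookup_single when_def)
    show ?case
      using 1 2
      by (cases "lookup m j = 0"; cases "lookup n j = 0")
         (auto simp: mult_single partial_deriv_monomial lookup_add algebra_simps simp flip: single_add)
  qed (simp_all add: distrib_left)
qed (simp_all add: distrib_right)

lemma partial_deriv_const [simp]: "partial_deriv j (const a) = 0"
  by (simp add: const_def partial_deriv_monomial)

lemma partial_deriv_Var [simp]: "partial_deriv j (Var i) = (if i = j then 1 else 0)"
  by (auto simp: Var_def partial_deriv_monomial lookup_single when_def)

lemma dir_deriv_partial:
  fixes F :: "('v::finite, 'k::field) mpoly"
  shows "dir_deriv F v w = (\<Sum>j\<in>UNIV. w j * eval_mpoly (partial_deriv j F) v)"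
proof (induction F rule: mpoly_generated)
  case (Var i)
  have "(\<Sum>j\<in>UNIV. w j * eval_mpoly (partial_deriv j (Var i)) v) = (\<Sum>j\<in>UNIV. if i = j then w j else 0)"
    by (rule sum.cong) auto
  then show ?case by simp
next
  case (mult F G)
  then show ?case
    by (simp add: partial_deriv_mult sum.distrib algebra_simps sum_distrib_left sum_distrib_right)
qed (simp_all add: algebra_simps sum.distrib)

lemma partial_deriv_forms:
  assumes "F \<in> forms d" shows "partial_deriv j F \<in> forms (d - 1)"
  unfolding partial_deriv_def
proof (rule forms_sum)
  fix m assume m: "m \<in> keys F"
  show "Poly_Mapping.single (m - Poly_Mapping.single j 1) (of_nat (lookup m j) * lookup F m) \<in> forms (d - 1)"
  proof (cases "lookup m j = 0")
    case False
    then have "m = (m - Poly_Mapping.single j 1) + Poly_Mapping.single j 1"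
      by (intro poly_mapping_eqI) (auto simp: lookup_add lookup_minus lookup_single when_def)
    from arg_cong[OF this, of total_deg] have "total_deg m = total_deg (m - Poly_Mapping.single j 1) + 1"
      by simp
    then show ?thesis using assms m by (intro forms_monomial) (auto simp: forms_def total_deg_def)
  qed simp
qed

section \<open>Dimensions of finite-dimensional subspaces\<close>

locale kspace = vector_space scale
  for scale :: "'a::field \<Rightarrow> 'b::ab_group_add \<Rightarrow> 'b"
begin

definition findim :: "'b set \<Rightarrow> bool" where
  "findim V \<longleftrightarrow> subspace V \<and> (\<exists>B. finite B \<and> V \<subseteq> span B)"

lemma findim_subspace: "findim V \<Longrightarrow> subspace V"
  by (simp add: findim_def)

lemma findim_mono: "findim V \<Longrightarrow> subspace W \<Longrightarrow> W \<subseteq> V \<Longrightarrow> findim W"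
  unfolding findim_def by blast

lemma findim_independent:
  assumes "findim V" "independent B" "B \<subseteq> V"
  shows "finite B"
  using assms independent_span_bound unfolding findim_def by blast

lemma findim_basis_extend:
  assumes "findim V" "independent B" "B \<subseteq> V"
  obtains C where "B \<subseteq> C" "C \<subseteq> V" "finite C" "independent C" "span C = V" "card C = dim V"
proof -
  obtain C where C: "B \<subseteq> C" "C \<subseteq> V" "independent C" "V \<subseteq> span C"
    using maximal_independent_subset_extend[OF assms(3,2)] by blast
  moreover from C assms have "finite C" by (intro findim_independent)
  moreover have "span C = V"
    using C assms(1) by (metis findim_subspace span_minimal subset_antisym)
  moreover from C have "card C = dim V" by (intro basis_card_eq_dim)
  ultimately show ?thesis using that by blast
qed

lemma findim_basis:
  assumes "findim V"
  obtains C where "C \<subseteq> V" "finite C" "independent C" "span C = V" "card C = dim V"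
  using findim_basis_extend[OF assms, of "{}"] by (auto simp: independent_empty)

lemma dim_subspace_le:
  assumes "findim V" "subspace W" "W \<subseteq> V"
  shows "dim W \<le> dim V"
proof -
  obtain B where B: "B \<subseteq> W" "finite B" "independent B" "span B = W" "card B = dim W"
    using findim_basis[OF findim_mono[OF assms]] by blast
  then obtain C where "B \<subseteq> C" "finite C" "card C = dim V"
    using findim_basis_extend[OF assms(1) B(3) order_trans[OF B(1) assms(3)]] by metis
  with B show ?thesis by (metis card_mono)
qed

lemma subspace_eq_if_dim_ge:
  assumes "findim V" "subspace W" "W \<subseteq> V" "dim V \<le> dim W"
  shows "W = V"
proof -
  obtain B where B: "B \<subseteq> W" "finite B" "independent B" "span B = W" "card B = dim W"
    using findim_basis[OF findim_mono[OF assms(1-3)]] by blast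
  then obtain C where C: "B \<subseteq> C" "finite C" "card C = dim V" "span C = V"
    using findim_basis_extend[OF assms(1) B(3) order_trans[OF B(1) assms(3)]] by metis
  with B assms(4) have "B = C" by (metis card_seteq)
  with B C show ?thesis by simp
qed

lemma span_Int_independent:
  assumes "independent C" "B \<subseteq> C" "x \<in> span B" "x \<in> span (C - B)"
  shows "x = 0"
proof -
  have B: "independent B" "independent (C - B)" using assms(1,2) independent_mono by blast+
  have "representation C x = representation B x" "representation C x = representation (C - B) x"
    using representation_extend[OF assms(1,3,2)] representation_extend[OF assms(1,4)] by auto
  then have "representation C x b = 0" for b
    by (metis DiffE representation_ne_zero)
  moreover have "x \<in> span C" using assms(2,3) span_mono by blast
  ultimately show ?thesis
    using sum_nonzero_representation_eq[OF assms(1), of x] by simp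
qed

text \<open>A substitute for the quotient by \<open>W\<close> inside the same space: extend a basis
  of \<open>W\<close>, send its members to zero and fix the other basis vectors.\<close>

lemma linear_with_kernel:
  assumes "subspace W"
  shows "\<exists>f. Vector_Spaces.linear scale scale f \<and> (\<forall>x. f x = 0 \<longleftrightarrow> x \<in> W)"
proof -
  interpret vector_space_pair scale scale by unfold_locales
  obtain B where B: "B \<subseteq> W" "independent B" "W \<subseteq> span B"
    using maximal_independent_subset by blast
  then have sB: "span B = W" using assms by (metis span_minimal subset_antisym)
  obtain C where C: "B \<subseteq> C" "independent C" "UNIV \<subseteq> span C"
    using maximal_independent_subset_extend[OF subset_UNIV B(2)] by metis
  define f where "f = construct C (\<lambda>b. if b \<in> B then 0 else b)"
  have lin: "Vector_Spaces.linear scale scale f" unfolding f_def by (rule linear_construct[OF C(2)])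
  interpret f: Vector_Spaces.linear scale scale f by (fact lin)
  have fb: "f b = (if b \<in> B then 0 else b)" if "b \<in> C" for b
    unfolding f_def using construct_basis[OF C(2) that] by simp
  have f0: "f x = 0" if "x \<in> span B" for x
    using that by (rule f.eq_0_on_span[rotated]) (use fb C(1) in auto)
  have f1: "f x = x" if "x \<in> span (C - B)" for x
  proof -
    have "Vector_Spaces.linear scale scale (\<lambda>x. x)" by unfold_locales auto
    from linear_eq_on[OF lin this that] fb show ?thesis by auto
  qed
  have "f x = 0 \<longleftrightarrow> x \<in> W" for x
  proof
    assume x: "f x = 0"
    have "x \<in> span (B \<union> (C - B))" using C by (auto simp: Un_absorb1)
    then obtain y z where yz: "x = y + z" "y \<in> span B" "z \<in> span (C - B)"
      unfolding span_Un by blast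
    with x f0[of y] f1[of z] have "z = 0" by (simp add: f.add)
    with yz sB show "x \<in> W" by simp
  qed (use f0 sB in auto)
  with lin show ?thesis by blast
qed

end

locale kspace_pair = vs1: kspace s1 + vs2: vector_space s2
  for s1 :: "'a::field \<Rightarrow> 'b::ab_group_add \<Rightarrow> 'b" and s2 :: "'a \<Rightarrow> 'c::ab_group_add \<Rightarrow> 'c"

lemma (in kspace_pair) rank_nullity:
  assumes f: "Vector_Spaces.linear s1 s2 f" and V: "vs1.findim V"
  shows "vs1.dim V = vs1.dim {x\<in>V. f x = 0} + vs2.dim (f ` V)"
proof -
  interpret f: Vector_Spaces.linear s1 s2 f by (fact f)
  let ?K = "{x\<in>V. f x = 0}"
  have K: "vs1.subspace ?K"
    using vs1.findim_subspace[OF V]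
    by (auto simp: vs1.subspace_def f.add f.scale)
  obtain B where B: "B \<subseteq> ?K" "finite B" "vs1.independent B" "vs1.span B = ?K" "card B = vs1.dim ?K"
    using vs1.findim_basis[OF vs1.findim_mono[OF V K]] by blast
  then obtain C where C: "B \<subseteq> C" "C \<subseteq> V" "finite C" "vs1.independent C" "vs1.span C = V" "card C = vs1.dim V"
    using vs1.findim_basis_extend[OF V B(3)] B(1) by (metis (no_types, lifting) mem_Collect_eq subset_iff)
  have inj: "inj_on f (vs1.span (C - B))"
  proof (subst f.inj_on_iff_eq_0[OF vs1.subspace_span], safe)
    fix x assume x: "x \<in> vs1.span (C - B)" "f x = 0"
    then have "x \<in> V" using C(5) vs1.span_mono[of "C - B" C] by blast
    with x B have "x \<in> vs1.span B" by simp
    with x C show "x = 0" by (blast intro: vs1.span_Int_independent)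
  qed
  have ind: "vs2.independent (f ` (C - B))"
    by (intro f.independent_inj_on_image inj vs1.independent_mono[OF C(4)]) auto
  have "f ` V = vs2.span (f ` (C - B))"
  proof -
    have "f ` V = vs2.span (f ` C)" using C(5) f.span_image by metis
    also have "\<dots> = vs2.span (f ` (C - B))"
    proof (rule antisym)
      have "f ` C \<subseteq> insert 0 (f ` (C - B))" using B(1) by auto
      then show "vs2.span (f ` C) \<subseteq> vs2.span (f ` (C - B))"
        by (metis vs2.span_insert_0 vs2.span_mono)
    qed (intro vs2.span_mono, auto)
    finally show ?thesis .
  qed
  then have "vs2.dim (f ` V) = card (f ` (C - B))"
    using ind vs2.dim_span_eq_card_independent by simp
  also have "\<dots> = card (C - B)"
    by (intro card_image inj_on_subset[OF inj] vs1.span_superset)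
  also have "\<dots> = card C - card B" using B(2) C(1) by (simp add: card_Diff_subset)
  finally show ?thesis using B C by (metis card_mono le_add_diff_inverse)
qed

context kspace
begin

lemma findim_sum:
  assumes "findim U" "findim W"
  shows "findim {x + y |x y. x \<in> U \<and> y \<in> W}"
proof -
  from assms obtain A B where "finite A" "U \<subseteq> span A" "finite B" "W \<subseteq> span B"
    unfolding findim_def by blast
  then have "finite (A \<union> B)" "{x + y |x y. x \<in> U \<and> y \<in> W} \<subseteq> span (A \<union> B)"
    unfolding span_Un by auto
  with assms show ?thesis unfolding findim_def by (blast intro: subspace_sums)
qed

text \<open>Dividing by \<open>W\<close> gives \<open>U\<close> and the sum the same image, with
  kernels \<open>U \<inter> W\<close> and \<open>W\<close>; rank-nullity is applied to both.\<close>

lemma dim_sum_Int: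
  assumes U: "findim U" and W: "findim W"
  shows "dim {x + y |x y. x \<in> U \<and> y \<in> W} + dim (U \<inter> W) = dim U + dim W"
proof -
  interpret kspace_pair scale scale by unfold_locales
  let ?S = "{x + y |x y. x \<in> U \<and> y \<in> W}"
  note sU = findim_subspace[OF U] and sW = findim_subspace[OF W]
  obtain f where f: "Vector_Spaces.linear scale scale f" "\<And>x. f x = 0 \<longleftrightarrow> x \<in> W"
    using linear_with_kernel[OF sW] by blast
  interpret f: Vector_Spaces.linear scale scale f by (fact f(1))
  have "W \<subseteq> ?S" using subspace_0[OF sU] by force
  then have 1: "{x\<in>?S. f x = 0} = W" using f(2) by blast
  have 2: "f ` ?S = f ` U"
  proof
    have "f (x + y) = f x" if "y \<in> W" for x y using f(2)[of y] that by (simp add: f.add)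
    then show "f ` ?S \<subseteq> f ` U" by auto
    show "f ` U \<subseteq> f ` ?S" using subspace_0[OF sW] by force
  qed
  have 3: "{x\<in>U. f x = 0} = U \<inter> W" using f(2) by blast
  show ?thesis
    using rank_nullity[OF f(1) findim_sum[OF U W]] rank_nullity[OF f(1) U] unfolding 1 2 3 by simp
qed

lemma dim_image_inj:
  assumes "findim V" "Vector_Spaces.linear scale scale f" "\<And>x. x \<in> V \<Longrightarrow> f x = 0 \<Longrightarrow> x = 0"
  shows "dim (f ` V) = dim V"
proof -
  interpret kspace_pair scale scale by unfold_locales
  have "{x\<in>V. f x = 0} = {0}"
    using assms(3) subspace_0[OF findim_subspace[OF assms(1)]] module_hom.zero[OF Vector_Spaces.linear.axioms(3)[OF assms(2)]] by auto
  then have "dim {x\<in>V. f x = 0} = 0"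
    using dim_span_eq_card_independent[OF independent_empty] by simp
  with rank_nullity[OF assms(2,1)] show ?thesis by simp
qed

abbreviation functional :: "('b \<Rightarrow> 'a) \<Rightarrow> bool" where
  "functional \<equiv> Vector_Spaces.linear scale (*)"

lemma functionalD:
  assumes "functional \<phi>"
  shows "\<phi> (x + y) = \<phi> x + \<phi> y" "\<phi> (scale c x) = c * \<phi> x" "\<phi> 0 = 0" "\<phi> (x - y) = \<phi> x - \<phi> y"
proof -
  interpret Vector_Spaces.linear scale "(*)" \<phi> by (fact assms)
  show "\<phi> (x + y) = \<phi> x + \<phi> y" "\<phi> (scale c x) = c * \<phi> x" "\<phi> 0 = 0" "\<phi> (x - y) = \<phi> x - \<phi> y"
    by (simp_all add: add scale diff)
qed

definition common_kernel :: "'b set \<Rightarrow> ('i \<Rightarrow> 'b \<Rightarrow> 'a) \<Rightarrow> 'i set \<Rightarrow> 'b set" where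
  "common_kernel V \<phi> I = {x\<in>V. \<forall>i\<in>I. \<phi> i x = 0}"

lemma common_kernel_subset: "common_kernel V \<phi> I \<subseteq> V"
  by (auto simp: common_kernel_def)

lemma subspace_common_kernel:
  assumes "subspace V" "\<And>i. i \<in> I \<Longrightarrow> functional (\<phi> i)"
  shows "subspace (common_kernel V \<phi> I)"
  using assms by (auto simp: subspace_def common_kernel_def functionalD)

lemma dim_kernel_functional:
  assumes V: "findim V" and \<phi>: "functional \<phi>"
  shows "dim V = dim {x\<in>V. \<phi> x = 0} + (if \<exists>x\<in>V. \<phi> x \<noteq> 0 then 1 else 0)"
proof -
  interpret vs: vector_space "(*) :: 'a \<Rightarrow> 'a \<Rightarrow> 'a" by unfold_locales (auto simp: algebra_simps)
  interpret kspace_pair scale "(*)" by unfold_locales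
  have "vs.dim (\<phi> ` V) = (if \<exists>x\<in>V. \<phi> x \<noteq> 0 then 1 else 0)"
  proof (cases "\<exists>x\<in>V. \<phi> x \<noteq> 0")
    case True
    then obtain x where x: "x \<in> V" "\<phi> x \<noteq> 0" by blast
    have "a \<in> vs.span {1}" for a using vs.span_scale[OF vs.span_base[of 1 "{1}"], of a] by simp
    moreover have "a \<in> \<phi> ` V" for a
    proof
      show "a = \<phi> (scale (a / \<phi> x) x)" using x by (simp add: functionalD[OF \<phi>])
      show "scale (a / \<phi> x) x \<in> V" using x V by (intro subspace_scale findim_subspace)
    qed
    ultimately have "\<phi> ` V = vs.span {1}" by blast
    then have "vs.dim (\<phi> ` V) = card {1::'a}"
      using vs.dim_span_eq_card_independent[of "{1}"] by simp
    with True show ?thesis by simp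
  next
    case False
    then have "\<phi> ` V \<subseteq> vs.span {}" by auto
    then have "vs.dim (\<phi> ` V) \<le> card ({} :: 'a set)" by (intro vs.dim_le_card) auto
    with False show ?thesis by auto
  qed
  with rank_nullity[OF \<phi> V] show ?thesis by simp
qed

lemma common_kernel_insert:
  "common_kernel V \<phi> (insert i I) = {x\<in>common_kernel V \<phi> I. \<phi> i x = 0}"
  by (auto simp: common_kernel_def)

lemma findim_common_kernel:
  assumes "findim V" "\<And>i. i \<in> I \<Longrightarrow> functional (\<phi> i)"
  shows "findim (common_kernel V \<phi> I)"
  by (rule findim_mono[OF assms(1) subspace_common_kernel[OF findim_subspace[OF assms(1)] assms(2)]
        common_kernel_subset])

lemma dim_common_kernel_ge:
  assumes V: "findim V" and "finite I" "\<And>i. i \<in> I \<Longrightarrow> functional (\<phi> i)"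
  shows "dim V \<le> dim (common_kernel V \<phi> I) + card I"
  using assms(2,3)
proof (induction I rule: finite_induct)
  case empty
  then show ?case by (simp add: common_kernel_def)
next
  case (insert i I)
  have "dim (common_kernel V \<phi> I) \<le> dim {x\<in>common_kernel V \<phi> I. \<phi> i x = 0} + 1"
    using dim_kernel_functional[OF findim_common_kernel[OF V], of I \<phi> "\<phi> i"] insert by auto
  then show ?case unfolding common_kernel_insert using insert by force
qed

text \<open>A vector dual to each functional ensures that every further condition lowers the
  dimension by exactly one.\<close>

lemma dim_common_kernel_eq:
  assumes V: "findim V" and "finite I" "\<And>i. i \<in> I \<Longrightarrow> functional (\<phi> i)"
    and "\<And>i. i \<in> I \<Longrightarrow> \<exists>x\<in>V. \<phi> i x \<noteq> 0 \<and> (\<forall>j\<in>I - {i}. \<phi> j x = 0)"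
  shows "dim V = dim (common_kernel V \<phi> I) + card I"
  using assms(2-4)
proof (induction I rule: finite_induct)
  case empty
  then show ?case by (simp add: common_kernel_def)
next
  case (insert i I)
  obtain x where x: "x \<in> V" "\<phi> i x \<noteq> 0" "\<forall>j\<in>insert i I - {i}. \<phi> j x = 0"
    using insert.prems(2)[of i] by blast
  then have "x \<in> common_kernel V \<phi> I" using insert.hyps by (auto simp: common_kernel_def)
  with x have "dim (common_kernel V \<phi> I) = dim {x\<in>common_kernel V \<phi> I. \<phi> i x = 0} + 1"
    using dim_kernel_functional[OF findim_common_kernel[OF V], of I \<phi> "\<phi> i"] insert by auto
  moreover have "dim V = dim (common_kernel V \<phi> I) + card I"
  proof (rule insert.IH)
    fix j assume j: "j \<in> I"
    from insert.prems(2)[of j] j obtain y where "y \<in> V" "\<phi> j y \<noteq> 0" "\<forall>k\<in>insert i I - {j}. \<phi> k y = 0"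
      by blast
    then show "\<exists>x\<in>V. \<phi> j x \<noteq> 0 \<and> (\<forall>k\<in>I - {j}. \<phi> k x = 0)" by blast
  qed (use insert.prems in auto)
  ultimately show ?case unfolding common_kernel_insert using insert.hyps by simp
qed

text \<open>A converse to the preceding count: if the conditions are independent, dropping the
  \<open>i\<close>-th one enlarges the common kernel, and a new element can be scaled to the value
  one.\<close>

lemma common_kernel_separating:
  assumes V: "findim V" and "finite I" "\<And>i. i \<in> I \<Longrightarrow> functional (\<phi> i)"
    and "dim V = dim (common_kernel V \<phi> I) + card I" "i \<in> I"
  obtains x where "x \<in> V" "\<phi> i x = 1" "\<And>j. j \<in> I - {i} \<Longrightarrow> \<phi> j x = 0"
proof -
  let ?W = "common_kernel V \<phi> (I - {i})"
  have "dim V \<le> dim ?W + card (I - {i})"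
    using assms by (intro dim_common_kernel_ge) auto
  moreover have "card I = card (I - {i}) + 1" using assms by (metis Suc_eq_plus1 card.remove)
  moreover have "common_kernel V \<phi> I = {x\<in>?W. \<phi> i x = 0}"
    using assms(5) by (auto simp: common_kernel_def)
  moreover have "dim ?W = dim {x\<in>?W. \<phi> i x = 0} + (if \<exists>x\<in>?W. \<phi> i x \<noteq> 0 then 1 else 0)"
    using assms by (intro dim_kernel_functional findim_common_kernel) auto
  ultimately obtain x where x: "x \<in> ?W" "\<phi> i x \<noteq> 0" using assms(4) by (force split: if_splits)
  show ?thesis
  proof (rule that)
    show "scale (1 / \<phi> i x) x \<in> V"
      using x V by (auto simp: common_kernel_def intro: subspace_scale findim_subspace)
  qed (use x assms in \<open>auto simp: common_kernel_def functionalD\<close>)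
qed

end

section \<open>Spaces of ternary forms and the dimension modulo an ideal\<close>

interpretation mp: kspace "\<lambda>c (F :: ('v, 'k::field) mpoly). const c * F"
  by unfold_locales (auto simp: algebra_simps)


declare mp.scale_scale [simp del]

lemma subspace_forms: "mp.subspace (forms d)"
  by (auto simp: mp.subspace_def)

lemma functional_eval: "mp.functional (\<lambda>F. eval_mpoly F v)"
  by unfold_locales (auto simp: algebra_simps)

lemma functional_dir_deriv: "mp.functional (\<lambda>F. dir_deriv F v w)"
  by unfold_locales (auto simp: algebra_simps)

lemma functional_lookup: "mp.functional (\<lambda>F. lookup F m)"
  by unfold_locales (auto simp: distrib_left distrib_right mult.assoc lookup_add)

lemma linear_mult: "Vector_Spaces.linear (\<lambda>c (G :: ('v, 'k::field) mpoly). const c * G) (\<lambda>c G. const c * G) (\<lambda>G. F * G)"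
  by unfold_locales (auto simp: algebra_simps)

lemma UNIV_3: "(UNIV :: 3 set) = {1, 2, 3}"
proof -
  have "card {1, 2, 3 :: 3} = card (UNIV :: 3 set)" by simp
  then show ?thesis by (metis card_subset_eq finite subset_UNIV)
qed

lemma sum_UNIV_3: "(\<Sum>i\<in>(UNIV :: 3 set). f i) = f 1 + f 2 + f 3"
  unfolding UNIV_3 by (simp add: add.assoc)

lemma prod_UNIV_3: "(\<Prod>i\<in>(UNIV :: 3 set). f i) = f 1 * f 2 * f 3"
  unfolding UNIV_3 by (simp add: mult.assoc)

lemma cases_3: "i = 1 \<or> i = 2 \<or> i = (3 :: 3)"
  using UNIV_3 by blast

lemma fun3_eq_iff: "(f :: 3 \<Rightarrow> 'a) = g \<longleftrightarrow> f 1 = g 1 \<and> f 2 = g 2 \<and> f 3 = g 3"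
  using cases_3 by (metis ext)

definition exponent3 :: "nat \<Rightarrow> nat \<Rightarrow> nat \<Rightarrow> (3 \<Rightarrow>\<^sub>0 nat)" where
  "exponent3 a b c = Poly_Mapping.single 1 a + Poly_Mapping.single 2 b + Poly_Mapping.single 3 c"

lemma lookup_exponent3:
  "lookup (exponent3 a b c) 1 = a" "lookup (exponent3 a b c) 2 = b" "lookup (exponent3 a b c) 3 = c"
  by (simp_all add: exponent3_def lookup_add lookup_single when_def)

lemma exponent3_lookup: "exponent3 (lookup m 1) (lookup m 2) (lookup m 3) = m"
proof (rule poly_mapping_eqI)
  fix i show "lookup (exponent3 (lookup m 1) (lookup m 2) (lookup m 3)) i = lookup m i"
    using cases_3[of i] by (auto simp: lookup_exponent3)
qed

lemma total_deg_3: "total_deg (m :: 3 \<Rightarrow>\<^sub>0 nat) = lookup m 1 + lookup m 2 + lookup m 3"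
  by (simp add: total_deg_def sum_UNIV_3)

lemma exponents_of_degree:
  "{m. total_deg m = d} = (\<lambda>(a, b). exponent3 a b (d - a - b)) ` (SIGMA a:{..d}. {..d - a})"
proof
  show "{m. total_deg m = d} \<subseteq> (\<lambda>(a, b). exponent3 a b (d - a - b)) ` (SIGMA a:{..d}. {..d - a})"
  proof
    fix m :: "3 \<Rightarrow>\<^sub>0 nat" assume "m \<in> {m. total_deg m = d}"
    then show "m \<in> (\<lambda>(a, b). exponent3 a b (d - a - b)) ` (SIGMA a:{..d}. {..d - a})"
      using exponent3_lookup[of m]
      by (intro image_eqI[of _ _ "(lookup m 1, lookup m 2)"]) (auto simp: total_deg_3)
  qed
qed (auto simp: total_deg_3 lookup_exponent3)

lemma finite_exponents: "finite {m :: 3 \<Rightarrow>\<^sub>0 nat. total_deg m = d}"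
  unfolding exponents_of_degree by auto

lemma card_exponents: "2 * card {m :: 3 \<Rightarrow>\<^sub>0 nat. total_deg m = d} = (d + 1) * (d + 2)"
proof -
  have "inj_on (\<lambda>(a, b). exponent3 a b (d - a - b)) (SIGMA a:{..d}. {..d - a})"
    by (auto simp: inj_on_def dest: arg_cong[of _ _ "\<lambda>m. (lookup m 1, lookup m 2)"] simp: lookup_exponent3)
  then have "card {m :: 3 \<Rightarrow>\<^sub>0 nat. total_deg m = d} = (\<Sum>a\<le>d. card {..d - a})"
    unfolding exponents_of_degree by (simp add: card_image)
  also have "\<dots> = (\<Sum>a\<le>d. a + 1)"
    by (rule sum.reindex_bij_witness[of _ "\<lambda>a. d - a" "\<lambda>a. d - a"]) auto
  also have "2 * \<dots> = (d + 1) * (d + 2)"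
    by (induction d) auto
  finally show ?thesis .
qed

lemma findim_forms: "mp.findim (forms d :: (3, 'k::field) mpoly set)"
  unfolding mp.findim_def
proof (intro conjI exI)
  let ?B = "(\<lambda>m. Poly_Mapping.single m 1) ` {m. total_deg m = d} :: (3, 'k) mpoly set"
  show "finite ?B" using finite_exponents by blast
  show "forms d \<subseteq> mp.span ?B"
  proof
    fix F :: "(3, 'k) mpoly" assume F: "F \<in> forms d"
    have "(\<Sum>m\<in>keys F. const (lookup F m) * Poly_Mapping.single m 1) \<in> mp.span ?B"
      using F by (intro mp.span_sum mp.span_scale mp.span_base) (auto simp: forms_def total_deg_def)
    then show "F \<in> mp.span ?B"
      using mpoly_sum_monomials[of F] by (simp add: const_def mult_single)
  qed
qed (rule subspace_forms)

lemma dim_zero_subspace: "mp.dim {0} = 0"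
  using mp.dim_span_eq_card_independent[OF mp.independent_empty] by simp

lemma dim_forms: "2 * mp.dim (forms d :: (3, 'k::field) mpoly set) = (d + 1) * (d + 2)"
proof -
  let ?I = "{m :: 3 \<Rightarrow>\<^sub>0 nat. total_deg m = d}"
  have "mp.dim (forms d :: (3, 'k) mpoly set) = mp.dim (mp.common_kernel (forms d) (\<lambda>m F :: (3, 'k) mpoly. lookup F m) ?I) + card ?I"
  proof (rule mp.dim_common_kernel_eq)
    show "mp.functional (\<lambda>F :: (3, 'k) mpoly. lookup F m)" for m by (rule functional_lookup)
    fix m :: "3 \<Rightarrow>\<^sub>0 nat" assume "m \<in> ?I"
    then show "\<exists>x\<in>forms d. lookup x m \<noteq> (0::'k) \<and> (\<forall>j\<in>?I - {m}. lookup x j = 0)"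
      by (intro bexI[of _ "Poly_Mapping.single m 1"] forms_monomial) (auto simp: lookup_single when_def)
  qed (rule findim_forms finite_exponents)+
  moreover have "mp.common_kernel (forms d) (\<lambda>m F :: (3, 'k) mpoly. lookup F m) ?I = {0}"
    by (auto simp: mp.common_kernel_def forms_iff intro!: poly_mapping_eqI)
  ultimately show ?thesis using card_exponents by (simp add: dim_zero_subspace)
qed

text \<open>The difference \<open>3 * d\<close> is the Hilbert function of a plane cubic:
  multiplication by its equation embeds \<open>forms (d - 3)\<close> into
  \<open>forms d\<close>.\<close>

lemma dim_forms_diff:
  assumes "d \<ge> 3"
  shows "mp.dim (forms d :: (3, 'k::field) mpoly set) = mp.dim (forms (d - 3) :: (3, 'k) mpoly set) + 3 * d"
proof -
  obtain e where "d = e + 3" using assms by (metis add.commute le_Suc_ex)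
  then show ?thesis
    using dim_forms[of d, where 'k = 'k] dim_forms[of e, where 'k = 'k] by (simp add: algebra_simps)
qed

lemma dim_forms_shift:
  fixes F :: "(3, 'k::field) mpoly"
  assumes "F \<noteq> 0" "mp.findim V"
  shows "mp.dim ((*) F ` V) = mp.dim V"
  using mp.dim_image_inj[OF assms(2) linear_mult[of F]] assms(1) by simp

lemma findim_mult_image:
  fixes F :: "('v, 'k::field) mpoly"
  assumes "mp.findim V" shows "mp.findim ((*) F ` V)"
proof -
  interpret f: Vector_Spaces.linear "\<lambda>c (G :: ('v, 'k) mpoly). const c * G" "\<lambda>c G. const c * G" "\<lambda>G. F * G"
    by (rule linear_mult)
  from assms obtain B where B: "mp.subspace V" "finite B" "V \<subseteq> mp.span B" unfolding mp.findim_def by blast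
  have "(*) F ` V \<subseteq> mp.span ((*) F ` B)"
    using B(3) f.span_image[of B] by (metis image_mono)
  moreover have "mp.subspace ((*) F ` V)"
    using B(1) f.subspace_image[of V] by simp
  ultimately show ?thesis using B(2) unfolding mp.findim_def by blast
qed

lemma ex1_eq: "\<exists>!x. P x \<Longrightarrow> P a \<Longrightarrow> P b \<Longrightarrow> a = b"
  by blast

text \<open>The definite description is well defined because the admissible sets \<open>B\<close>
  are those that a linear map \<open>f\<close> with kernel \<open>W\<close> sends injectively onto a
  basis of the image of \<open>V\<close>; hence all of them have the same size.\<close>

lemma dim_modulo_eq:
  fixes V W :: "('v, 'k::field) mpoly set"
  assumes V: "mp.findim V" and W: "mp.subspace W"
  shows "dim_modulo V W = mp.dim V - mp.dim (V \<inter> W)"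
proof -
  interpret pr: kspace_pair "\<lambda>c (G :: ('v, 'k) mpoly). const c * G" "\<lambda>c (G :: ('v, 'k) mpoly). const c * G"
    by unfold_locales
  obtain f where f0: "Vector_Spaces.linear (\<lambda>c (G :: ('v, 'k) mpoly). const c * G) (\<lambda>c (G :: ('v, 'k) mpoly). const c * G) f \<and>
      (\<forall>x. f x = 0 \<longleftrightarrow> x \<in> W)"
    using mp.linear_with_kernel[OF W] by (rule exE)
  note f = conjunct1[OF f0] conjunct2[OF f0, rule_format]
  interpret f: Vector_Spaces.linear "\<lambda>c (G :: ('v, 'k) mpoly). const c * G" "\<lambda>c (G :: ('v, 'k) mpoly). const c * G" f by (fact f(1))
  have "{x \<in> V. f x = 0} = V \<inter> W" using f(2) by blast
  then have rn: "mp.dim V - mp.dim (V \<inter> W) = mp.dim (f ` V)" using pr.rank_nullity[OF f(1) V] by simp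
  have fsum: "f (\<Sum>b\<in>B. const (c b) * b) = (\<Sum>b\<in>B. const (c b) * f b)" for B c
    by (simp add: f.sum f.scale)
  let ?P = "\<lambda>B. \<forall>F\<in>V. \<exists>!c. (\<forall>b. b \<notin> B \<longrightarrow> c b = 0) \<and> F - (\<Sum>b\<in>B. const (c b) * b) \<in> W"
  have uniq: "card B = mp.dim (f ` V)" if B: "B \<subseteq> V" "finite B" "?P B" for B
  proof -
    \<comment> \<open>Uniqueness of the coordinates of zero amounts to linear independence of the
      images.\<close>
    have zero: "c b = 0" if "(\<Sum>b\<in>B. const (c b) * f b) = 0" "b \<in> B" for c b
    proof -
      let ?c = "\<lambda>b. if b \<in> B then c b else 0"
      have "(\<Sum>b\<in>B. const (?c b) * f b) = 0" using that(1) by simp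
      then have "f (0 - (\<Sum>b\<in>B. const (?c b) * b)) = 0" by (simp only: fsum f.diff f.zero diff_zero)
      then have "0 - (\<Sum>b\<in>B. const (?c b) * b) \<in> W" using f(2) by blast
      moreover have "0 - (\<Sum>b\<in>B. const ((\<lambda>_. 0) b) * b) \<in> W" using mp.subspace_0[OF W] by simp
      ultimately have "?c = (\<lambda>_. 0)"
        by (intro ex1_eq[OF B(3)[rule_format, OF mp.subspace_0[OF mp.findim_subspace[OF V]]]]) auto
      with that(2) show ?thesis by metis
    qed
    have inj: "inj_on f B"
    proof (rule inj_onI, rule ccontr)
      fix a b assume ab: "a \<in> B" "b \<in> B" "f a = f b" "a \<noteq> b"
      \<comment> \<open>Two elements with the same image would give a relation with coefficients
        \<open>1\<close> and \<open>- 1\<close>.\<close>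
      let ?c = "\<lambda>x. (if x = a then 1 else 0) - (if x = b then 1 else (0::'k))"
      have "(\<Sum>x\<in>B. const (?c x) * f x) = (\<Sum>x\<in>B. if x = a then f x else 0) - (\<Sum>x\<in>B. if x = b then f x else 0)"
        by (subst sum_subtractf[symmetric], rule sum.cong) (auto simp: algebra_simps)
      then have "(\<Sum>x\<in>B. const (?c x) * f x) = 0" using ab B(2) by simp
      from zero[OF this ab(1)] ab show False by simp
    qed
    have ind: "mp.independent (f ` B)"
    proof (rule mp.independent_if_scalars_zero)
      fix c x assume s: "(\<Sum>x\<in>f ` B. const (c x) * x) = 0" and "x \<in> f ` B"
      then obtain b where b: "b \<in> B" "x = f b" by blast
      from s have "(\<Sum>b\<in>B. const (c (f b)) * f b) = 0" by (simp add: sum.reindex[OF inj])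
      from zero[OF this b(1)] b show "c x = 0" by simp
    qed (use B in simp)
    have "f ` V \<subseteq> mp.span (f ` B)"
    proof (rule image_subsetI)
      fix F assume "F \<in> V"
      then obtain c where "F - (\<Sum>b\<in>B. const (c b) * b) \<in> W" using B(3) by blast
      then have "f F = (\<Sum>b\<in>B. const (c b) * f b)"
        using f(2)[of "F - (\<Sum>b\<in>B. const (c b) * b)"] by (simp add: f.diff fsum)
      also have "\<dots> \<in> mp.span (f ` B)" by (intro mp.span_sum mp.span_scale mp.span_base) auto
      finally show "f F \<in> mp.span (f ` B)" .
    qed
    then have "card (f ` B) = mp.dim (f ` V)"
      using B(1) by (intro mp.basis_card_eq_dim ind) auto
    then show ?thesis using inj by (simp add: card_image)
  qed
  have ex: "\<exists>B. B \<subseteq> V \<and> finite B \<and> ?P B"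
  proof -
    from V obtain B' where "finite B'" "V \<subseteq> mp.span B'" unfolding mp.findim_def by blast
    then have "finite (f ` B')" "f ` V \<subseteq> mp.span (f ` B')" using f.span_image[of B'] by auto
    moreover have "mp.subspace (f ` V)" by (rule f.subspace_image[OF mp.findim_subspace[OF V]])
    ultimately have fV: "mp.findim (f ` V)" unfolding mp.findim_def by blast
    obtain D where D: "D \<subseteq> f ` V" "finite D" "mp.independent D" "mp.span D = f ` V"
      using mp.findim_basis[OF fV] by metis
    obtain B where B: "B \<subseteq> V" "inj_on f B" "f ` B = D"
      using D(1) subset_image_inj by metis
    have fB: "finite B" using B D(2) by (metis finite_image_iff)
    have "?P B"
    proof
      fix F assume F: "F \<in> V"
      have key: "F - (\<Sum>b\<in>B. const (c b) * b) \<in> W \<longleftrightarrow> f F = (\<Sum>b\<in>B. const (c b) * f b)" for c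
        using f(2)[of "F - (\<Sum>b\<in>B. const (c b) * b)"] by (simp add: f.diff fsum)
      have "f F \<in> mp.span D" using D(4) F by blast
      then obtain u where u: "f F = (\<Sum>x\<in>D. const (u x) * x)"
        using D(2) by (auto simp: mp.span_finite)
      have u': "f F = (\<Sum>b\<in>B. const (u (f b)) * f b)"
        unfolding u B(3)[symmetric] by (simp add: sum.reindex[OF B(2)])
      show "\<exists>!c. (\<forall>b. b \<notin> B \<longrightarrow> c b = 0) \<and> F - (\<Sum>b\<in>B. const (c b) * b) \<in> W"
      proof (rule ex1I)
        show "(\<forall>b. b \<notin> B \<longrightarrow> (if b \<in> B then u (f b) else 0) = 0) \<and>
          F - (\<Sum>b\<in>B. const (if b \<in> B then u (f b) else 0) * b) \<in> W"
          unfolding key u' by simp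
        fix c assume c: "(\<forall>b. b \<notin> B \<longrightarrow> c b = 0) \<and> F - (\<Sum>b\<in>B. const (c b) * b) \<in> W"
        then have "(\<Sum>b\<in>B. const (c b - u (f b)) * f b) = 0"
          unfolding key using u' by (simp add: sum_subtractf left_diff_distrib)
        then have *: "(\<Sum>x\<in>D. const (c (inv_into B f x) - u x) * x) = 0"
          unfolding B(3)[symmetric] by (simp add: sum.reindex[OF B(2)] inv_into_f_f[OF B(2)])
        have "c (inv_into B f x) - u x = 0" if "x \<in> D" for x
          using mp.independentD[OF D(3,2) order_refl *] that by simp
        then have "c b = u (f b)" if "b \<in> B" for b
          using that B by (metis imageI inv_into_f_f right_minus_eq)
        with c show "c = (\<lambda>b. if b \<in> B then u (f b) else 0)" by auto
      qed
    qed
    with B fB show ?thesis by blast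
  qed
  then obtain B where B: "B \<subseteq> V \<and> finite B \<and> ?P B" by (rule exE)
  note B = conjunct1[OF B] conjunct1[OF conjunct2[OF B]] conjunct2[OF conjunct2[OF B]]
  show ?thesis unfolding dim_modulo_def rn
  proof (rule the_equality)
    show "\<exists>B. B \<subseteq> V \<and> finite B \<and> card B = mp.dim (f ` V) \<and> ?P B"
      by (intro exI[of _ B] conjI B uniq)
  next
    fix n assume "\<exists>B. B \<subseteq> V \<and> finite B \<and> card B = n \<and> ?P B"
    then obtain B' where B': "B' \<subseteq> V \<and> finite B' \<and> card B' = n \<and> ?P B'" by (rule exE)
    show "n = mp.dim (f ` V)"
      using uniq[OF conjunct1[OF B'] conjunct1[OF conjunct2[OF B']]
          conjunct2[OF conjunct2[OF conjunct2[OF B']]]] B' by (metis (no_types))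
  qed
qed

section \<open>Irreducible ternary polynomials are prime\<close>

text \<open>Unique factorization is transported along this isomorphism. The third variable is the
  outermost one; the rational cubics used later are linear in it.\<close>

definition to_poly3 :: "(3, 'k::field) mpoly \<Rightarrow> 'k poly poly poly" where
  "to_poly3 = mhom (\<lambda>a. [:[:[:a:]:]:])
     (\<lambda>i. if i = 1 then [:[:[:0, 1:]:]:] else if i = 2 then [:[:0, 1:]:] else [:0, 1:])"

lemma comm_ring_hom_compose:
  assumes "comm_ring_hom g" "comm_ring_hom h"
  shows "comm_ring_hom (\<lambda>a. h (g a))"
proof -
  interpret g: comm_ring_hom g by fact
  interpret h: comm_ring_hom h by fact
  show ?thesis
    by unfold_locales (simp_all add: g.hom_add g.hom_mult g.hom_one h.hom_add h.hom_mult h.hom_one)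
qed

lemma comm_ring_hom_pCons3: "comm_ring_hom (\<lambda>a :: 'a::comm_ring_1. [:[:[:a:]:]:])"
  by (intro comm_ring_hom_compose[OF _ comm_ring_hom_pCons] comm_ring_hom_pCons)

lemma to_poly3_hom: "comm_ring_hom to_poly3"
  unfolding to_poly3_def by (rule comm_ring_hom_mhom[OF comm_ring_hom_pCons3])

interpretation to_poly3: comm_ring_hom to_poly3
  by (rule to_poly3_hom)

lemma X_power_monom: "pCons 0 1 ^ n = monom (1 :: 'a::comm_ring_1) n"
  by (simp add: monom_altdef)

lemma to_poly3_monomial:
  "to_poly3 (Poly_Mapping.single m a) =
     monom (monom (monom a (lookup m 1)) (lookup m 2)) (lookup m 3)"
proof -
  show ?thesis
    unfolding to_poly3_def mhom_monomial[OF comm_ring_hom_pCons3]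
    by (simp add: monomial_at_superset[of UNIV] prod_UNIV_3 smult_monom poly_const_pow X_power_monom)
qed

lemma coeff_to_poly3: "coeff (coeff (coeff (to_poly3 F) c) b) a = lookup F (exponent3 a b c)"
proof (induction F rule: mpoly_induct)
  case (monomial m x)
  have "m = exponent3 a b c \<longleftrightarrow> lookup m 1 = a \<and> lookup m 2 = b \<and> lookup m 3 = c"
    by (metis exponent3_lookup lookup_exponent3)
  then show ?case
    by (simp add: to_poly3_monomial lookup_single when_def coeff_monom)
qed (simp_all add: to_poly3.hom_add lookup_add)

lemma to_poly3_inj: "to_poly3 F = to_poly3 G \<longleftrightarrow> F = G"
proof
  assume "to_poly3 F = to_poly3 G"
  then have "lookup F (exponent3 a b c) = lookup G (exponent3 a b c)" for a b c
    by (metis coeff_to_poly3)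
  then show "F = G" by (intro poly_mapping_eqI) (metis exponent3_lookup)
qed simp

lemma poly_generated:
  assumes c: "\<And>a. [:a:] \<in> R" and X: "[:0, 1:] \<in> R"
    and add: "\<And>p q. p \<in> R \<Longrightarrow> q \<in> R \<Longrightarrow> p + q \<in> R"
    and mult: "\<And>p q. p \<in> R \<Longrightarrow> q \<in> R \<Longrightarrow> p * q \<in> R"
  shows "(p :: 'b::comm_ring_1 poly) \<in> R"
proof (induction p)
  case 0
  show ?case using c[of 0] by simp
next
  case (pCons a p)
  have "pCons a p = [:a:] + [:0, 1:] * p" by simp
  with pCons c X add mult show ?case by metis
qed

text \<open>The range is a subring containing the constants and the three variables; the variables
  are adjoined one level at a time.\<close>

lemma to_poly3_surj: "\<exists>F. to_poly3 F = p"
proof -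
  let ?R = "range (to_poly3 :: (3, 'a) mpoly \<Rightarrow> _)"
  have add: "p + q \<in> ?R" and mult: "p * q \<in> ?R" if "p \<in> ?R" "q \<in> ?R" for p q
    using that by (auto simp flip: to_poly3.hom_add to_poly3.hom_mult)
  have V: "to_poly3 (Var i) = (if i = 1 then [:[:[:0, 1:]:]:] else if i = 2 then [:[:0, 1:]:] else [:0, 1:])" for i :: 3
    unfolding to_poly3_def by (simp add: mhom_Var[OF comm_ring_hom_pCons3])
  have c: "to_poly3 (const a) = [:[:[:a:]:]:]" for a
    unfolding to_poly3_def by (simp add: mhom_const[OF comm_ring_hom_pCons3])
  have v: "[:[:[:0, 1:]:]:] \<in> ?R" "[:[:0, 1:]:] \<in> ?R" "[:0, 1:] \<in> ?R"
    using rangeI[of to_poly3 "Var 1"] rangeI[of to_poly3 "Var 2"] rangeI[of to_poly3 "Var 3"]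
    by (simp_all add: V)
  have cc: "[:[:[:a:]:]:] \<in> ?R" for a using rangeI[of to_poly3 "const a"] by (simp add: c)
  have add1: "[:p + q:] \<in> ?R" and mult1: "[:p * q:] \<in> ?R" if "[:p:] \<in> ?R" "[:q:] \<in> ?R" for p q
    using add[OF that] mult[OF that] by (simp_all add: mult.commute)
  have add2: "[:[:p + q:]:] \<in> ?R" and mult2: "[:[:p * q:]:] \<in> ?R" if "[:[:p:]:] \<in> ?R" "[:[:q:]:] \<in> ?R" for p q
    using add[OF that] mult[OF that] by (simp_all add: mult.commute)
  have 1: "[:[:p:]:] \<in> ?R" for p
    by (rule poly_generated[of "{p. [:[:p:]:] \<in> ?R}" p, unfolded mem_Collect_eq, OF cc v(1) add2 mult2])
  have 2: "[:p:] \<in> ?R" for p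
    by (rule poly_generated[of "{p. [:p:] \<in> ?R}" p, unfolded mem_Collect_eq, OF 1 v(2) add1 mult1])
  have "p \<in> ?R"
    by (rule poly_generated[of ?R p, OF 2 v(3) add mult])
  then show ?thesis by blast
qed

lemma to_poly3_dvd: "to_poly3 F dvd to_poly3 G \<longleftrightarrow> F dvd G"
proof
  assume "to_poly3 F dvd to_poly3 G"
  then obtain q where "to_poly3 G = to_poly3 F * q" by (rule dvdE)
  then obtain H where "to_poly3 G = to_poly3 (F * H)"
    using to_poly3_surj[of q] by (auto simp: to_poly3.hom_mult)
  then show "F dvd G" by (simp add: to_poly3_inj)
qed (auto simp: to_poly3.hom_mult elim!: dvdE)

text \<open>In the factorial ring of iterated polynomials irreducible elements are prime, and the
  isomorphism preserves units and divisibility in both directions.\<close>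

lemma irreducible_imp_prime_elem_mpoly3:
  fixes F :: "(3, 'k::field) mpoly"
  assumes "irreducible F" shows "prime_elem F"
proof -
  have one: "to_poly3 (1 :: (3, 'k) mpoly) = 1" by (rule to_poly3.hom_one)
  have zero: "to_poly3 (0 :: (3, 'k) mpoly) = 0" by (rule to_poly3.hom_zero)
  have u: "to_poly3 G dvd 1 \<longleftrightarrow> G dvd 1" for G :: "(3, 'k) mpoly" using to_poly3_dvd[of G 1] by (simp add: one)
  have "irreducible (to_poly3 F)"
  proof (rule irreducibleI)
    show "to_poly3 F \<noteq> 0" using assms to_poly3_inj[of F 0] by (auto simp: zero)
    show "\<not> to_poly3 F dvd 1" using assms u by (auto simp: irreducible_def)
    fix a b assume "to_poly3 F = a * b"
    then obtain A B where AB: "to_poly3 F = to_poly3 (A * B)" "a = to_poly3 A" "b = to_poly3 B"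
      using to_poly3_surj[of a] to_poly3_surj[of b] by (auto simp: to_poly3.hom_mult)
    then have "F = A * B" by (simp add: to_poly3_inj)
    with assms AB show "a dvd 1 \<or> b dvd 1" by (auto simp: irreducible_def u)
  qed
  then have p: "prime_elem (to_poly3 F)" by simp
  show ?thesis
  proof (rule prime_elemI)
    show "F \<noteq> 0" "\<not> F dvd 1" using assms by (auto simp: irreducible_def)
    fix a b assume "F dvd a * b"
    then have "to_poly3 F dvd to_poly3 a * to_poly3 b" by (metis to_poly3.hom_mult to_poly3_dvd)
    with p show "F dvd a \<or> F dvd b" by (metis prime_elem_dvd_mult_iff to_poly3_dvd)
  qed
qed

section \<open>Linear forms in three variables\<close>

definition vec3 :: "'a \<Rightarrow> 'a \<Rightarrow> 'a \<Rightarrow> 3 \<Rightarrow> 'a" where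
  "vec3 a b c = (\<lambda>i. if i = 1 then a else if i = 2 then b else c)"

lemma vec3_simps [simp]: "vec3 a b c 1 = a" "vec3 a b c 2 = b" "vec3 a b c 3 = c"
  by (simp_all add: vec3_def)

definition dot3 :: "(3 \<Rightarrow> 'k::field) \<Rightarrow> (3 \<Rightarrow> 'k) \<Rightarrow> 'k" where
  "dot3 u v = u 1 * v 1 + u 2 * v 2 + u 3 * v 3"

text \<open>For two lines this is their intersection point, for two points the joining line; it
  vanishes iff the two vectors are proportional.\<close>

definition cross :: "(3 \<Rightarrow> 'k::field) \<Rightarrow> (3 \<Rightarrow> 'k) \<Rightarrow> 3 \<Rightarrow> 'k" where
  "cross u v = vec3 (u 2 * v 3 - u 3 * v 2) (u 3 * v 1 - u 1 * v 3) (u 1 * v 2 - u 2 * v 1)"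

definition linform :: "(3 \<Rightarrow> 'k::field) \<Rightarrow> (3, 'k) mpoly" where
  "linform u = const (u 1) * Var 1 + const (u 2) * Var 2 + const (u 3) * Var 3"

abbreviation zero3 :: "3 \<Rightarrow> 'k::zero" where "zero3 \<equiv> (\<lambda>_. 0)"

lemma eval_linform [simp]: "eval_mpoly (linform u) v = dot3 u v"
  by (simp add: linform_def dot3_def)

lemma dir_deriv_linform [simp]: "dir_deriv (linform u) v w = dot3 u w"
  by (simp add: linform_def dot3_def)

lemma linform_forms [intro]: "linform u \<in> forms 1"
  unfolding linform_def by (intro forms_add forms_const_mult forms_Var)

lemma line_poly_linform [simp]: "line_poly (linform u) v w = [:dot3 u v, dot3 u w:]"
  by (simp add: linform_def dot3_def)

lemma dot3_simps [simp]:
  "dot3 zero3 v = 0" "dot3 u zero3 = 0"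
  "dot3 u (\<lambda>i. v i + w i) = dot3 u v + dot3 u w" "dot3 u (\<lambda>i. c * v i) = c * dot3 u v"
  by (simp_all add: dot3_def algebra_simps)

lemma dot3_cross [simp]: "dot3 u (cross u v) = 0" "dot3 v (cross u v) = 0"
  by (simp_all add: dot3_def cross_def algebra_simps)

lemma dot3_cross_rotate: "dot3 u (cross v w) = dot3 v (cross w u)"
  by (simp add: dot3_def cross_def algebra_simps)

lemma cross_self [simp]: "cross u u = zero3"
  by (simp add: fun3_eq_iff cross_def mult.commute)

lemma cross_antisym: "cross v u = (\<lambda>i. - cross u v i)"
  by (simp add: fun3_eq_iff cross_def algebra_simps)

lemma ex_dot3_eq_1:
  assumes "v \<noteq> zero3" obtains u where "dot3 u v = 1"
proof -
  from assms consider "v 1 \<noteq> 0" | "v 2 \<noteq> 0" | "v 3 \<noteq> 0" by (auto simp: fun3_eq_iff)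
  then show ?thesis
  proof cases
    case 1 then show ?thesis by (intro that[of "vec3 (1 / v 1) 0 0"]) (simp add: dot3_def)
  next
    case 2 then show ?thesis by (intro that[of "vec3 0 (1 / v 2) 0"]) (simp add: dot3_def)
  next
    case 3 then show ?thesis by (intro that[of "vec3 0 0 (1 / v 3)"]) (simp add: dot3_def)
  qed
qed

lemma dot3_commute: "dot3 u v = dot3 v u"
  by (simp add: dot3_def mult.commute)

lemma cross_cross: "cross u (cross v w) = (\<lambda>i. dot3 u w * v i - dot3 u v * w i)"
  by (simp add: fun3_eq_iff cross_def dot3_def algebra_simps)

text \<open>A determinant with \<open>e\<close> as one vector ignores multiples of \<open>e\<close>
  in the others, so it distinguishes the parameters \<open>t\<close> after projection from
  \<open>e\<close>.\<close>

lemma dot3_cross_affine: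
  "dot3 e (cross (\<lambda>i. a i + t * b i + s * e i) (\<lambda>i. a i + t' * b i + s' * e i)) =
     (t' - t) * dot3 e (cross a b)"
proof -
  have "e1 * ((a2 + t * b2 + s * e2) * (a3 + t' * b3 + s' * e3) - (a3 + t * b3 + s * e3) * (a2 + t' * b2 + s' * e2)) +
    e2 * ((a3 + t * b3 + s * e3) * (a1 + t' * b1 + s' * e1) - (a1 + t * b1 + s * e1) * (a3 + t' * b3 + s' * e3)) +
    e3 * ((a1 + t * b1 + s * e1) * (a2 + t' * b2 + s' * e2) - (a2 + t * b2 + s * e2) * (a1 + t' * b1 + s' * e1)) =
    (t' - t) * (e1 * (a2 * b3 - a3 * b2) + e2 * (a3 * b1 - a1 * b3) + e3 * (a1 * b2 - a2 * b1))"
    for e1 e2 e3 a1 a2 a3 b1 b2 b3 :: 'a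
    by (simp add: algebra_simps)
  then show ?thesis unfolding dot3_def cross_def vec3_simps .
qed

lemma cross_eq_zero3_imp_multiple:
  assumes "cross u v = zero3" "u \<noteq> zero3"
  obtains c where "v = (\<lambda>i. c * u i)"
proof -
  obtain s where s: "dot3 s u = 1" using assms(2) by (rule ex_dot3_eq_1)
  have "cross s (cross u v) = zero3" using assms(1) by (simp add: fun3_eq_iff cross_def)
  then have "v = (\<lambda>i. dot3 s v * u i)" unfolding cross_cross s by (auto simp: fun_eq_iff)
  with that show ?thesis by blast
qed

lemma ex_cross_eq:
  assumes "u \<noteq> zero3" "dot3 u b = 0"
  obtains u' where "cross u u' = b"
proof -
  obtain s where s: "dot3 s u = 1" using assms(1) by (rule ex_dot3_eq_1)
  have "cross u (cross b s) = b"
    unfolding cross_cross using s assms(2) by (simp add: dot3_commute)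
  with that show ?thesis by blast
qed

lemma ex_nonzero_orthogonal:
  obtains b :: "3 \<Rightarrow> 'k::field" where "b \<noteq> zero3" "dot3 u b = 0"
proof (cases "u 1 = 0 \<and> u 2 = 0")
  case True
  then show ?thesis by (intro that[of "vec3 1 0 0"]) (auto simp: fun3_eq_iff dot3_def)
next
  case False
  then show ?thesis by (intro that[of "vec3 (u 2) (- u 1) 0"]) (auto simp: fun3_eq_iff dot3_def)
qed

text \<open>Cramer's rule for expanding \<open>v\<close> in \<open>u1\<close>, \<open>u2\<close>,
  \<open>u3\<close>.\<close>

lemma triple_product_basis:
  "dot3 u3 (cross u1 u2) * v i =
     dot3 v (cross u2 u3) * u1 i + dot3 v (cross u3 u1) * u2 i + dot3 v (cross u1 u2) * u3 i"
  using cases_3[of i] by (elim disjE) (simp_all add: dot3_def cross_def algebra_simps)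

lemma linform_add: "linform (\<lambda>i. u i + v i) = linform u + linform v"
  by (simp add: linform_def algebra_simps)

lemma linform_scale: "linform (\<lambda>i. c * u i) = const c * linform u"
  by (simp add: linform_def algebra_simps)

lemma linform_unit: "linform (\<lambda>j. if j = i then 1 else 0) = Var i"
  using cases_3[of i] by (auto simp: linform_def)

lemma Var_basis:
  assumes "dot3 u3 (cross u1 u2) = 1"
  obtains a b c where "Var i = const a * linform u1 + const b * linform u2 + const c * linform u3"
proof -
  let ?v = "\<lambda>j. if j = i then 1 else (0::'a)"
  have "?v = (\<lambda>j. (dot3 ?v (cross u2 u3) * u1 j + dot3 ?v (cross u3 u1) * u2 j) + dot3 ?v (cross u1 u2) * u3 j)"
    by (rule ext) (rule triple_product_basis[of u3 u1 u2 ?v, unfolded assms mult_1_left])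
  from arg_cong[OF this, of linform] have "Var i = const (dot3 ?v (cross u2 u3)) * linform u1 + const (dot3 ?v (cross u3 u1)) * linform u2
     + const (dot3 ?v (cross u1 u2)) * linform u3"
    by (simp only: linform_add linform_scale linform_unit)
  with that show ?thesis by blast
qed

lemma forms_Suc_decomp:
  assumes "F \<in> forms (Suc d)"
  obtains G :: "'v::finite \<Rightarrow> ('v, 'k::field) mpoly" where "\<And>j. G j \<in> forms d" "F = (\<Sum>j\<in>UNIV. Var j * G j)"
proof -
  let ?P = "\<lambda>F. \<exists>G. (\<forall>j. G j \<in> forms d) \<and> F = (\<Sum>j\<in>UNIV. Var j * G j :: ('v, 'k) mpoly)"
  have add: "?P (F + G)" if "?P F" "?P G" for F G
  proof -
    from that obtain A B where "\<forall>j. A j \<in> forms d" "F = (\<Sum>j\<in>UNIV. Var j * A j)"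
      "\<forall>j. B j \<in> forms d" "G = (\<Sum>j\<in>UNIV. Var j * B j)" by blast
    then show ?thesis
      by (intro exI[of _ "\<lambda>j. A j + B j"]) (auto simp: distrib_left sum.distrib)
  qed
  have mon: "?P (Poly_Mapping.single m (lookup F m))" if "m \<in> keys F" for m
  proof -
    from that assms have m: "total_deg m = Suc d" by (simp add: forms_def total_deg_def)
    then have "m \<noteq> 0" by auto
    then obtain j where j: "lookup m j \<noteq> 0" by (metis lookup_zero poly_mapping_eqI)
    have mj: "m = Poly_Mapping.single j 1 + (m - Poly_Mapping.single j 1)"
      using j by (intro poly_mapping_eqI) (auto simp: lookup_add lookup_minus lookup_single when_def)
    from arg_cong[OF this, of total_deg] m have "total_deg (m - Poly_Mapping.single j 1) = d" by simp
    then have f: "Poly_Mapping.single (m - Poly_Mapping.single j 1) (lookup F m) \<in> forms d"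
      by (rule forms_monomial)
    have "(\<Sum>i\<in>UNIV. Var i * (if i = j then Poly_Mapping.single (m - Poly_Mapping.single j 1) (lookup F m) else 0))
      = (\<Sum>i\<in>UNIV. if i = j then Var j * Poly_Mapping.single (m - Poly_Mapping.single j 1) (lookup F m) else 0)"
      by (rule sum.cong) auto
    also have "\<dots> = Poly_Mapping.single m (lookup F m)"
      using mj by (simp add: Var_def mult_single)
    finally show ?thesis using f
      by (intro exI[of _ "\<lambda>i. if i = j then Poly_Mapping.single (m - Poly_Mapping.single j 1) (lookup F m) else 0"]) auto
  qed
  have "?P (\<Sum>m\<in>S. Poly_Mapping.single m (lookup F m))" if "finite S" "S \<subseteq> keys F" for S
    using that
  proof (induction S rule: finite_induct)
    case empty
    show ?case by (intro exI[of _ "\<lambda>_. 0"]) auto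
  next
    case (insert m S)
    then show ?case using add mon by simp
  qed
  from this[of "keys F"] mpoly_sum_monomials[of F] have "?P F" by simp
  with that show ?thesis by blast
qed

text \<open>Modulo the two linear forms that define a point, only powers of a third linear form
  survive. The induction peels off one variable, itself a combination of the three linear
  forms.\<close>

lemma form_mod_two_linforms:
  assumes u: "dot3 u3 (cross u1 u2) = 1" and F: "F \<in> forms d"
  shows "\<exists>A\<in>forms (d - 1). \<exists>B\<in>forms (d - 1). \<exists>c.
    F = linform u1 * A + linform u2 * B + const c * linform u3 ^ d"
  using F
proof (induction d arbitrary: F)
  case 0
  then obtain c where "F = const c" by (rule forms_0E)
  then show ?case by (intro bexI[of _ 0] exI[of _ c]) auto
next
  case (Suc d)
  define p where "p = linform u3 ^ Suc d"
  let ?M = "{F. \<exists>A\<in>forms d. \<exists>B\<in>forms d. \<exists>c. F = linform u1 * A + linform u2 * B + const c * p}"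
  have add: "F + G \<in> ?M" if FG: "F \<in> ?M" "G \<in> ?M" for F G
  proof -
    from FG obtain A B c A' B' c' where *: "A \<in> forms d" "B \<in> forms d" "A' \<in> forms d" "B' \<in> forms d"
      "F = linform u1 * A + linform u2 * B + const c * p"
      "G = linform u1 * A' + linform u2 * B' + const c' * p" by blast
    have "F + G = linform u1 * (A + A') + linform u2 * (B + B') + const (c + c') * p"
      unfolding *(5,6) const_simps by (simp only: distrib_left distrib_right ac_simps)
    with forms_add[OF *(1,3)] forms_add[OF *(2,4)] show ?thesis by blast
  qed
  have mult: "Var i * G \<in> ?M" if G: "G \<in> forms d" for i G
  proof -
    obtain a b c where V: "Var i = const a * linform u1 + const b * linform u2 + const c * linform u3"
      using u by (rule Var_basis)
    obtain A B e where G': "A \<in> forms (d - 1)" "B \<in> forms (d - 1)"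
      "G = linform u1 * A + linform u2 * B + const e * linform u3 ^ d" using Suc.IH[OF G] by blast
    have Z: "linform u3 * H \<in> forms d" if "H \<in> forms (d - 1)" "d \<noteq> 0" for H
      using that by (intro forms_mult'[OF linform_forms]) auto
    \<comment> \<open>For \<open>d = 0\<close> the truncated degree \<open>d - 1\<close> is
      \<open>0\<close> too, so multiplying the cofactors by \<open>linform u3\<close> would
      overshoot the degree; constants are treated directly.\<close>
    have z: "d = 0 \<Longrightarrow> ?thesis"
    proof -
      assume d: "d = 0"
      then obtain g where g: "G = const g" using G forms_0E by blast
      have "Var i * G = linform u1 * const (g * a) + linform u2 * const (g * b) + const (c * g) * p"
        unfolding V g p_def d by (simp only: const_simps power_Suc0_right distrib_right distrib_left ac_simps)
      moreover have "const (g * a) \<in> forms d" "const (g * b) \<in> forms d" unfolding d by (rule forms_const)+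
      ultimately show ?thesis by blast
    qed
    show ?thesis
    proof (cases "d = 0")
      case False
      have L3: "linform u3 * G = linform u1 * (linform u3 * A) + linform u2 * (linform u3 * B) + const e * p"
        by (subst G'(3)) (simp only: p_def power_Suc distrib_left ac_simps)
      have "Var i * G = const a * (linform u1 * G) + const b * (linform u2 * G) + const c * (linform u3 * G)"
        by (simp only: V distrib_right mult.assoc)
      also have "\<dots> = linform u1 * (const a * G + const c * (linform u3 * A)) +
         linform u2 * (const b * G + const c * (linform u3 * B)) + const (c * e) * p"
        by (subst L3) (simp only: distrib_left const_simps ac_simps)
      finally have "Var i * G = linform u1 * (const a * G + const c * (linform u3 * A)) +
         linform u2 * (const b * G + const c * (linform u3 * B)) + const (c * e) * p" .
      moreover have "const a * G + const c * (linform u3 * A) \<in> forms d" "const b * G + const c * (linform u3 * B) \<in> forms d"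
        using G G' Z False by (auto intro!: forms_add forms_const_mult)
      ultimately show ?thesis by blast
    qed (rule z)
  qed
  obtain G where G: "\<And>j. G j \<in> forms d" "F = (\<Sum>j\<in>UNIV. Var j * G j)"
    using forms_Suc_decomp[OF Suc.prems] by blast
  have "F = Var 1 * G 1 + Var 2 * G 2 + Var 3 * G 3" by (simp add: G(2) sum_UNIV_3)
  moreover have "Var 1 * G 1 + Var 2 * G 2 + Var 3 * G 3 \<in> ?M"
    by (rule add[OF add[OF mult[OF G(1)] mult[OF G(1)]] mult[OF G(1)]])
  ultimately have "F \<in> ?M" by simp
  then show ?case unfolding p_def by simp
qed

lemma ex_third_vector:
  assumes "cross u1 u2 \<noteq> zero3" obtains u3 where "dot3 u3 (cross u1 u2) = 1"
  using ex_dot3_eq_1[OF assms] by blast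

lemma vanishing_formE:
  assumes u: "cross u1 u2 \<noteq> zero3" and F: "F \<in> forms d" "eval_mpoly F (cross u1 u2) = 0"
  obtains A B where "A \<in> forms (d - 1)" "B \<in> forms (d - 1)" "F = linform u1 * A + linform u2 * B"
proof -
  obtain u3 where u3: "dot3 u3 (cross u1 u2) = 1" using u by (rule ex_third_vector)
  obtain A B c where AB: "A \<in> forms (d - 1)" "B \<in> forms (d - 1)"
    "F = linform u1 * A + linform u2 * B + const c * linform u3 ^ d"
    using form_mod_two_linforms[OF u3 F(1)] by blast
  with F(2) u3 have "c = 0" by simp
  with AB that show ?thesis by simp
qed

lemma forms_1E:
  assumes "L \<in> forms 1" obtains u where "L = linform u"
proof -
  obtain G where G: "\<And>j. G j \<in> forms 0" "L = (\<Sum>j\<in>(UNIV :: 3 set). Var j * G j)"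
    using forms_Suc_decomp[of L 0] assms by auto
  have "\<exists>c. G j = const c" for j by (rule forms_0E[OF G(1)[of j]]) blast
  then obtain u where "\<And>j. G j = const (u j)" by metis
  with G(2) have "L = linform u" by (simp add: linform_def sum_UNIV_3 mult.commute)
  with that show ?thesis by blast
qed

lemma linform_eq_0_iff [simp]: "linform u = 0 \<longleftrightarrow> u = zero3"
proof
  assume u: "linform u = 0"
  have "dot3 u v = 0" for v using eval_linform[of u v] unfolding u by simp
  then have "dot3 v u = 0" for v by (metis dot3_commute)
  then show "u = zero3" by (metis ex_dot3_eq_1 zero_neq_one)
qed (simp add: linform_def)

section \<open>Forms over an algebraically closed field\<close>

text \<open>Euclid's argument: over a finite field, the product of all monic linear factors plus one
  has no root.\<close>

lemma infinite_UNIV_alg_closed: "infinite (UNIV :: 'k::alg_closed_field set)"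
proof
  assume fin: "finite (UNIV :: 'k set)"
  define p where "p = (\<Prod>a\<in>(UNIV :: 'k set). [:- a, 1:]) + 1"
  have p: "poly p x = 1" for x
  proof -
    have "poly (\<Prod>a\<in>(UNIV :: 'k set). [:- a, 1:]) x = (\<Prod>a\<in>UNIV. x - a)" by (simp add: poly_prod)
    also have "\<dots> = 0" using fin by (intro prod_zero) auto
    finally show ?thesis by (simp add: p_def)
  qed
  have d: "degree (\<Prod>a\<in>(UNIV :: 'k set). [:- a, 1:]) = card (UNIV :: 'k set)"
    by (subst degree_prod_eq_sum_degree) auto
  have "card (UNIV :: 'k set) > 0" using fin by (simp add: card_gt_0_iff)
  then have "degree p > 0" unfolding p_def using d by (subst degree_add_eq_left) auto
  from alg_closed_imp_poly_has_root[OF this] p show False by auto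
qed

lemma poly_eq_0_if_vanishes:
  fixes p :: "'k::alg_closed_field poly"
  assumes "\<And>x. poly p x = 0" shows "p = 0"
  using assms poly_roots_finite[of p] infinite_UNIV_alg_closed[where 'k = 'k] by auto

lemma line_poly_eq_0:
  fixes F :: "('v, 'k::alg_closed_field) mpoly"
  assumes "\<And>t. eval_mpoly F (\<lambda>i. v i + t * w i) = 0" shows "line_poly F v w = 0"
  by (rule poly_eq_0_if_vanishes) (simp add: poly_line_poly assms)

text \<open>Splitting at one point of the plane gives
  \<open>G = linform u * A + linform u2 * B\<close>, and \<open>B\<close>, of lower degree, again
  vanishes on the plane because \<open>linform u2\<close> is not identically zero there.\<close>

lemma form_vanishing_on_plane:
  fixes G :: "(3, 'k::alg_closed_field) mpoly"
  assumes "G \<in> forms d" "u \<noteq> zero3" "\<And>v. dot3 u v = 0 \<Longrightarrow> eval_mpoly G v = 0"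
  shows "linform u dvd G"
  using assms(1,3)
proof (induction d arbitrary: G)
  case 0
  then obtain c where "G = const c" using forms_0E by blast
  with 0(2)[of zero3] show ?case by simp
next
  case (Suc d)
  obtain b where b: "b \<noteq> zero3" "dot3 u b = 0" by (rule ex_nonzero_orthogonal)
  obtain u2 where u2: "cross u u2 = b" using assms(2) b(2) by (rule ex_cross_eq)
  with b have ne: "cross u u2 \<noteq> zero3" by simp
  obtain u3 where u3: "dot3 u3 (cross u u2) = 1" using ne by (rule ex_third_vector)
  obtain A B where AB: "A \<in> forms d" "B \<in> forms d" "G = linform u * A + linform u2 * B"
    using vanishing_formE[OF ne Suc.prems(1)] Suc.prems(2)[of "cross u u2"] by auto
  have "eval_mpoly B v = 0" if v: "dot3 u v = 0" for v
  proof -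
    \<comment> \<open>This direction lies in the plane and has \<open>u2\<close>-value one, so
      \<open>linform u2\<close> restricts to a nonzero polynomial on the line and can be cancelled
      even if it vanishes at \<open>v\<close> itself.\<close>
    let ?w = "cross u3 u"
    have "line_poly G v ?w = 0" by (rule line_poly_eq_0) (use Suc.prems(2) v in simp)
    moreover have "line_poly G v ?w = [:dot3 u2 v, 1:] * line_poly B v ?w"
      using v u3 by (simp add: AB(3) dot3_cross_rotate[of u2 u3 u])
    ultimately have "[:dot3 u2 v, 1:] * line_poly B v ?w = 0" by metis
    then have "line_poly B v ?w = 0" unfolding mult_eq_0_iff by simp
    then show ?thesis using coeff_0_line_poly[of B v ?w] by simp
  qed
  from Suc.IH[OF AB(2) this] AB(3) show ?case by (metis dvd_add dvd_mult dvd_triv_left)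
qed

text \<open>Along the multiples \<open>t v\<close> the values of the homogeneous components are the
  coefficients of a polynomial in \<open>t\<close> that vanishes identically.\<close>

lemma eval_hcomp_sum:
  assumes "\<And>t. eval_mpoly F (\<lambda>i. t * v i) = (0 :: 'k::alg_closed_field)"
  shows "eval_mpoly (hcomp d F) v = 0"
proof -
  obtain N where N: "F = (\<Sum>d\<le>N. hcomp d F)" using sum_hcomp by blast
  define p where "p = (\<Sum>d\<le>N. monom (eval_mpoly (hcomp d F) v) d)"
  have "poly p t = eval_mpoly F (\<lambda>i. t * v i)" for t
    by (subst N) (simp add: p_def poly_sum poly_monom eval_homogeneous[OF hcomp_in_forms] mult.commute)
  then have "p = 0" using assms by (intro poly_eq_0_if_vanishes) simp
  then have c: "(\<Sum>d\<le>N. coeff (monom (eval_mpoly (hcomp d F) v) d) d') = 0" for d'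
  proof -
    have "coeff p d' = 0" using \<open>p = 0\<close> by simp
    then show ?thesis by (simp only: p_def coeff_sum)
  qed
  show ?thesis
  proof (cases "d \<le> N")
    case True
    with c[of d] show ?thesis by (simp add: coeff_monom)
  next
    case False
    have "hcomp d F = (\<Sum>e\<le>N. hcomp d (hcomp e F))" by (subst N) (rule hcomp_sum)
    also have "\<dots> = 0" using False by (intro sum.neutral) (auto simp: hcomp_form[OF hcomp_in_forms])
    finally show ?thesis by simp
  qed
qed

lemma linform_dvd_iff:
  fixes G :: "(3, 'k::alg_closed_field) mpoly"
  assumes "u \<noteq> zero3"
  shows "linform u dvd G \<longleftrightarrow> (\<forall>v. dot3 u v = 0 \<longrightarrow> eval_mpoly G v = 0)"
proof
  assume *: "\<forall>v. dot3 u v = 0 \<longrightarrow> eval_mpoly G v = 0"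
  have "linform u dvd hcomp d G" for d
    by (rule form_vanishing_on_plane[OF hcomp_in_forms assms], rule eval_hcomp_sum) (use * in simp)
  then show "linform u dvd G" using sum_hcomp[of G] by (metis dvd_sum)
qed (auto elim!: dvdE)

text \<open>A point of the plane where \<open>G\<close> does not vanish and one where
  \<open>H\<close> does not are joined by a line inside the plane, and univariate polynomials have
  no zero divisors.\<close>

lemma prime_linform:
  fixes G H :: "(3, 'k::alg_closed_field) mpoly"
  assumes "u \<noteq> zero3" "linform u dvd G * H"
  shows "linform u dvd G \<or> linform u dvd H"
proof (rule ccontr)
  assume "\<not> ?thesis"
  then obtain v w where vw: "dot3 u v = 0" "dot3 u w = 0" "eval_mpoly G v \<noteq> 0" "eval_mpoly H w \<noteq> 0"
    using linform_dvd_iff[OF assms(1)] by blast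
  let ?w = "\<lambda>i. w i + (-1) * v i"
  have "line_poly (G * H) v ?w = 0"
  proof (rule line_poly_eq_0)
    fix t
    have "dot3 u (\<lambda>i. v i + t * (w i + - 1 * v i)) = 0"
      by (simp only: dot3_simps vw(1,2)) simp
    with assms(2) linform_dvd_iff[OF assms(1)] show "eval_mpoly (G * H) (\<lambda>i. v i + t * (w i + - 1 * v i)) = 0" by blast
  qed
  then have "line_poly G v ?w = 0 \<or> line_poly H v ?w = 0" by simp
  moreover have "poly (line_poly G v ?w) 0 \<noteq> 0" "poly (line_poly H v ?w) 1 \<noteq> 0"
    unfolding poly_line_poly using vw by simp_all
  ultimately show False by auto
qed

text \<open>Such a form is divisible by a variable, and the quotient again vanishes everywhere: on
  each line in the direction of that variable the variable is a nonzero polynomial and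
  cancels.\<close>

lemma form_eq_0_if_vanishes:
  fixes F :: "(3, 'k::alg_closed_field) mpoly"
  assumes "F \<in> forms d" "\<And>v. eval_mpoly F v = 0"
  shows "F = 0"
  using assms
proof (induction d arbitrary: F)
  case 0
  then obtain c where "F = const c" using forms_0E by blast
  with 0 show ?case by simp
next
  case (Suc d)
  let ?u = "vec3 1 0 0 :: 3 \<Rightarrow> 'k"
  have u: "?u \<noteq> zero3" by (simp add: fun3_eq_iff)
  show ?case
  proof (rule ccontr)
    assume F0: "F \<noteq> 0"
    have "linform ?u dvd F" using Suc.prems(2) linform_dvd_iff[OF u] by blast
    then obtain A where A: "F = linform ?u * A" "A \<in> forms (Suc d - 1)"
      by (rule form_dvd_formE[OF linform_forms Suc.prems(1) _ F0])
    have "eval_mpoly A v = 0" for v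
    proof -
      have "line_poly F v ?u = 0" by (rule line_poly_eq_0) (rule Suc.prems(2))
      then have "[:dot3 ?u v, dot3 ?u ?u:] * line_poly A v ?u = 0"
        by (simp only: A(1) line_poly_simps line_poly_linform)
      then have "line_poly A v ?u = 0" unfolding mult_eq_0_iff by (simp add: dot3_def)
      then show ?thesis using coeff_0_line_poly[of A v ?u] by simp
    qed
    with Suc.IH[of A] A F0 show False by simp
  qed
qed

lemma form_zero_on_line:
  fixes G :: "('v::finite, 'k::alg_closed_field) mpoly"
  assumes "G \<in> forms d" "d > 0"
  shows "\<exists>x y. (x \<noteq> 0 \<or> y \<noteq> 0) \<and> eval_mpoly G (\<lambda>i. x * a i + y * b i) = 0"
proof (cases "eval_mpoly G b = 0")
  case True
  then show ?thesis by (intro exI[of _ 0] exI[of _ 1]) simp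
next
  case False
  then have "degree (line_poly G a b) = d"
    using line_poly_form[OF assms(1), of a b] le_degree[of "line_poly G a b" d] by simp
  with assms(2) obtain y where "poly (line_poly G a b) y = 0"
    using alg_closed_imp_poly_has_root by metis
  then show ?thesis by (intro exI[of _ 1] exI[of _ y]) (simp add: poly_line_poly)
qed

lemma form_zero_on_plane:
  fixes F :: "(3, 'k::alg_closed_field) mpoly"
  assumes "F \<in> forms d" "d > 0"
  obtains v where "v \<noteq> zero3" "dot3 u v = 0" "eval_mpoly F v = 0"
proof -
  obtain a where a: "a \<noteq> zero3" "dot3 u a = 0" by (rule ex_nonzero_orthogonal)
  obtain b where b: "cross a b \<noteq> zero3" "dot3 u b = 0"
  proof (cases "u = zero3")
    case True
    obtain s where "s \<noteq> zero3" "dot3 a s = 0" by (rule ex_nonzero_orthogonal)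
    with ex_cross_eq[OF a(1)] obtain b where "cross a b \<noteq> zero3" by metis
    with True that show ?thesis by simp
  next
    case False
    from a have "dot3 a u = 0" by (simp add: dot3_commute)
    with ex_cross_eq[OF a(1)] obtain s where "cross a s = u" by blast
    obtain s where s: "dot3 s a = 1" using a(1) by (rule ex_dot3_eq_1)
    have "cross a (cross u a) = (\<lambda>i. dot3 a a * u i)" using \<open>dot3 a u = 0\<close> by (simp add: cross_cross)
    obtain c where c: "cross u c = a" using False a(2) by (rule ex_cross_eq)
    have "cross a (cross u s) = u"
      unfolding cross_cross using s \<open>dot3 a u = 0\<close> by (simp add: dot3_commute)
    with False that[of "cross u s"] show ?thesis by simp
  qed
  obtain x y where xy: "x \<noteq> 0 \<or> y \<noteq> 0" "eval_mpoly F (\<lambda>i. x * a i + y * b i) = 0"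
    using form_zero_on_line[OF assms, of a b] by blast
  have "cross a (\<lambda>i. x * a i + y * b i) = (\<lambda>i. y * cross a b i)"
    "cross (\<lambda>i. x * a i + y * b i) b = (\<lambda>i. x * cross a b i)"
    by (simp_all add: fun3_eq_iff cross_def algebra_simps)
  moreover have "cross a zero3 = zero3" "cross zero3 b = zero3" by (simp_all add: fun3_eq_iff cross_def)
  ultimately have "(\<lambda>i. x * a i + y * b i) \<noteq> zero3" using xy(1) b(1) by (metis mult_eq_0_iff ext)
  moreover have "dot3 u (\<lambda>i. x * a i + y * b i) = 0" using a(2) b(2) by simp
  ultimately show ?thesis using xy(2) by (intro that)
qed

text \<open>This says that \<open>G\<close> is a nonzerodivisor modulo \<open>linform u\<close> and
  \<open>F\<close> if \<open>F\<close> and \<open>G\<close> have no common zero on the line. The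
  induction removes one zero \<open>b\<close> of \<open>F\<close> on the line: \<open>G\<close> does
  not vanish at \<open>b\<close>, so \<open>C\<close> must, and modulo \<open>linform u\<close> a
  linear form through \<open>b\<close> is divided out of both \<open>F\<close> and
  \<open>C\<close>.\<close>

lemma coprime_on_line:
  fixes F G C :: "(3, 'k::alg_closed_field) mpoly"
  assumes u: "u \<noteq> zero3" and "F \<in> forms f" and G: "G \<in> forms g" and "C \<in> forms c"
    and "\<And>v. v \<noteq> zero3 \<Longrightarrow> dot3 u v = 0 \<Longrightarrow> eval_mpoly F v = 0 \<Longrightarrow> eval_mpoly G v \<noteq> 0"
    and "G * C = linform u * A + F * B"
  shows "\<exists>A' B'. C = linform u * A' + F * B'"
  using assms(2,4-6)
proof (induction f arbitrary: F C A B c)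
  case 0
  then obtain a where a: "F = const a" using forms_0E by blast
  show ?case
  proof (cases "a = 0")
    case False
    then have "C = linform u * 0 + F * (const (1 / a) * C)"
      by (simp add: a mult.assoc[symmetric] flip: const_simps)
    then show ?thesis by blast
  next
    case True
    \<comment> \<open>If \<open>F\<close> is zero, then \<open>G\<close> has no zero on the line at
      all and is a nonzero constant.\<close>
    have "g = 0"
      using form_zero_on_plane[OF G, of u] 0(3) a True by (metis eval_simps(1) const_simps(1) not_gr_zero)
    then obtain b where b: "G = const b" using G forms_0E by blast
    obtain v where "v \<noteq> zero3" "dot3 u v = 0" by (rule ex_nonzero_orthogonal)
    with 0(3)[of v] a True b have "b \<noteq> 0" by simp
    then have "C = const (1 / b) * (G * C)" by (simp add: b mult.assoc[symmetric] flip: const_simps)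
    also have "\<dots> = linform u * (const (1 / b) * A) + F * 0" using 0(4) a True by (simp add: mult.left_commute)
    finally show ?thesis by blast
  qed
next
  case (Suc f)
  obtain b where b: "b \<noteq> zero3" "dot3 u b = 0" "eval_mpoly F b = 0"
    using form_zero_on_plane[OF Suc.prems(1), of u] by blast
  obtain u' where u': "cross u u' = b" using u b(2) by (rule ex_cross_eq)
  have ne: "cross u u' \<noteq> zero3" using u' b by simp
  have Gb: "eval_mpoly G b \<noteq> 0" using Suc.prems(3) b by blast
  have "eval_mpoly (G * C) b = 0" unfolding Suc.prems(4) using b by simp
  with Gb have Cb: "eval_mpoly C b = 0" by simp
  obtain F'' F' where F': "F'' \<in> forms f" "F' \<in> forms f" "F = linform u * F'' + linform u' * F'"
    using vanishing_formE[OF ne Suc.prems(1)] b(3) u' by auto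
  obtain C'' C' where C': "C' \<in> forms (c - 1)" "C = linform u * C'' + linform u' * C'"
    using vanishing_formE[OF ne Suc.prems(2)] Cb u' by blast
  have "linform u' * (G * C' - F' * B) = linform u * (A + F'' * B - G * C'')"
    using Suc.prems(4) unfolding F'(3) C'(2) by (simp add: algebra_simps)
  then have "linform u dvd linform u' * (G * C' - F' * B)" by simp
  moreover have "\<not> linform u dvd linform u'"
  proof
    assume "linform u dvd linform u'"
    then have *: "dot3 u v = 0 \<Longrightarrow> dot3 u' v = 0" for v using linform_dvd_iff[OF u] by auto
    have "cross u' (cross u s) = (\<lambda>i. dot3 u' s * u i - dot3 u' u * s i)" for s by (rule cross_cross)
    obtain s where s: "dot3 s (cross u u') = 1" using ne by (rule ex_third_vector)
    from *[of "cross s u"] s show False by (simp add: dot3_cross_rotate[of u' s u])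
  qed
  ultimately have "linform u dvd G * C' - F' * B" using prime_linform[OF u] by blast
  then obtain E where "G * C' - F' * B = linform u * E" by (rule dvdE)
  then have "G * C' = linform u * E + F' * B" by (simp add: algebra_simps)
  moreover have "eval_mpoly G v \<noteq> 0" if "v \<noteq> zero3" "dot3 u v = 0" "eval_mpoly F' v = 0" for v
    using Suc.prems(3)[of v] that by (simp add: F'(3))
  ultimately obtain A' B' where "C' = linform u * A' + F' * B'"
    using Suc.IH[OF F'(2) C'(1)] by blast
  then have "C = linform u * (C'' + linform u' * A' - F'' * B') + F * B'"
    unfolding C'(2) F'(3) by (simp add: algebra_simps)
  then show ?case by blast
qed

text \<open>Interchange in a regular sequence: \<open>G\<close> is a nonzerodivisor modulo
  \<open>linform u\<close> and \<open>F\<close>, and the prime \<open>F\<close> does not divide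
  \<open>linform u\<close>; therefore \<open>linform u\<close> can be cancelled modulo
  \<open>F\<close> and \<open>G\<close>.\<close>

lemma linform_regular_mod_two_forms:
  fixes F G :: "(3, 'k::alg_closed_field) mpoly"
  assumes F: "prime_elem F" "F \<in> forms f" "\<not> F dvd linform u" and u: "u \<noteq> zero3"
    and G: "G \<in> forms g" and C: "C \<in> forms c"
    and nz: "\<And>v. v \<noteq> zero3 \<Longrightarrow> dot3 u v = 0 \<Longrightarrow> eval_mpoly F v = 0 \<Longrightarrow> eval_mpoly G v \<noteq> 0"
    and eq: "linform u * A = F * B + G * C"
  shows "\<exists>B' C'. A = F * B' + G * C'"
proof -
  have "G * C = linform u * A + F * (- B)" by (simp add: eq)
  from coprime_on_line[OF u F(2) G C nz this] obtain C' E where C': "C = linform u * C' + F * E"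
    by blast
  have "linform u * (A - G * C') = linform u * A - G * (linform u * C')"
    by (simp only: right_diff_distrib mult.left_commute)
  also have "\<dots> = F * B + G * (linform u * C' + F * E) - G * (linform u * C')"
    by (simp only: eq C')
  also have "\<dots> = F * (B + G * E)" by (simp add: distrib_left mult.left_commute)
  finally have "linform u * (A - G * C') = F * (B + G * E)" .
  then have "F dvd linform u * (A - G * C')" by (rule dvdI)
  from prime_elem_dvd_multD[OF F(1) this] F(3) have "F dvd A - G * C'" by metis
  then obtain H where "A - G * C' = F * H" by (rule dvdE)
  then have "A = F * H + G * C'" by (simp only: diff_eq_eq)
  then show ?thesis by blast
qed

section \<open>Points of the plane and their ideals\<close>

definition pt :: "'k::field proj_plane \<Rightarrow> 3 \<Rightarrow> 'k" where
  "pt p = (\<lambda>j. vec_nth (SOME v. represents v p) j)"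

definition proj :: "(3 \<Rightarrow> 'k::field) \<Rightarrow> 'k proj_plane" where
  "proj v = abs_proj_plane (\<chi> j. v j)"

lemma ex_represents: "\<exists>v. represents v p"
proof -
  have "rep_proj_plane p \<noteq> 0"
    using Quotient3_rep_reflp[OF Quotient3_proj_plane, of p] by simp
  moreover have "abs_proj_plane (rep_proj_plane p) = p"
    by (rule Quotient3_abs_rep[OF Quotient3_proj_plane])
  ultimately show ?thesis unfolding represents_def by blast
qed

lemma represents_unique:
  assumes "represents v p" "represents w p"
  obtains c where "c \<noteq> 0" "\<And>j. vec_nth w j = c * vec_nth v j"
proof -
  have v: "v \<noteq> 0" and w: "w \<noteq> 0" and vw: "abs_proj_plane v = abs_proj_plane w"
    using assms by (auto simp: represents_def)
  have r: "u \<noteq> 0 \<and> u \<noteq> 0 \<and> (\<exists>c. c \<noteq> 0 \<and> u = c *s u)" if "u \<noteq> 0" for u :: "'a ^ 3"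
    using that by (auto intro!: exI[of _ 1] simp: Finite_Cartesian_Product.vec_eq_iff)
  have "v \<noteq> 0 \<and> w \<noteq> 0 \<and> (\<exists>c. c \<noteq> 0 \<and> w = c *s v)"
    using Quotient3_rel[OF Quotient3_proj_plane, of v w] r[OF v] r[OF w] vw by simp
  then obtain c where "c \<noteq> 0" "w = c *s v" by blast
  then show ?thesis by (intro that[of c]) auto
qed

lemma represents_unique_fun:
  assumes "represents (\<chi> j. v j) p" "represents (\<chi> j. w j) p"
  shows "\<exists>c. w = (\<lambda>j. c * v j)"
proof -
  from represents_unique[OF assms]
  obtain c where "c \<noteq> 0" "\<And>j. vec_nth (\<chi> j. w j) j = c * vec_nth (\<chi> j. v j) j" by blast
  then have "w = (\<lambda>j. c * v j)" by (intro ext) simp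
  then show ?thesis by (rule exI)
qed

lemma represents_scale:
  assumes "represents v p" "c \<noteq> 0"
  shows "represents (c *s v) p"
proof -
  have v: "v \<noteq> 0" "c *s v \<noteq> 0" using assms by (auto simp: represents_def Finite_Cartesian_Product.vec_eq_iff)
  have r: "u \<noteq> 0 \<and> u \<noteq> 0 \<and> (\<exists>c. c \<noteq> 0 \<and> u = c *s u)" if "u \<noteq> 0" for u :: "'a ^ 3"
    using that by (auto intro!: exI[of _ 1] simp: Finite_Cartesian_Product.vec_eq_iff)
  have "abs_proj_plane v = abs_proj_plane (c *s v)"
    using Quotient3_rel[OF Quotient3_proj_plane, of v "c *s v"] r[OF v(1)] r[OF v(2)] v assms(2) by blast
  with assms v show ?thesis by (simp add: represents_def)
qed

lemma represents_pt: "represents (\<chi> j. pt p j) p"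
proof -
  have "represents (SOME v. represents v p) p" by (rule someI_ex[OF ex_represents])
  moreover have "(\<chi> j. pt p j) = (SOME v. represents v p)" by (simp add: pt_def Finite_Cartesian_Product.vec_eq_iff)
  ultimately show ?thesis by simp
qed

lemma represents_iff_pt: "represents v p \<longleftrightarrow> (\<exists>c. c \<noteq> 0 \<and> (\<forall>j. vec_nth v j = c * pt p j))"
proof
  assume "represents v p"
  from represents_unique[OF represents_pt this] show "\<exists>c. c \<noteq> 0 \<and> (\<forall>j. vec_nth v j = c * pt p j)"
    by (metis vec_lambda_beta)
next
  assume "\<exists>c. c \<noteq> 0 \<and> (\<forall>j. vec_nth v j = c * pt p j)"
  then obtain c where c: "c \<noteq> 0" "\<forall>j. vec_nth v j = c * pt p j" by blast
  then have "v = c *s (\<chi> j. pt p j)" by (simp add: Finite_Cartesian_Product.vec_eq_iff)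
  with represents_scale[OF represents_pt c(1)] show "represents v p" by simp
qed

lemma pt_nonzero [simp]: "pt p \<noteq> zero3"
  using represents_pt[of p] by (auto simp: represents_def Finite_Cartesian_Product.vec_eq_iff)

lemma pt_inj_parallel:
  assumes "pt q = (\<lambda>j. c * pt p j)" shows "p = q"
proof -
  have "c \<noteq> 0" using assms pt_nonzero[of q] by auto
  then have "represents (\<chi> j. pt q j) p" using assms by (auto simp: represents_iff_pt)
  with represents_pt[of q] show ?thesis by (simp add: represents_def)
qed

lemma cross_pt_nonzero: "p \<noteq> q \<Longrightarrow> cross (pt p) (pt q) \<noteq> zero3"
  using cross_eq_zero3_imp_multiple[OF _ pt_nonzero] pt_inj_parallel by metis

lemma represents_proj: "v \<noteq> zero3 \<Longrightarrow> represents (\<chi> j. v j) (proj v)"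
  by (auto simp: represents_def proj_def Finite_Cartesian_Product.vec_eq_iff)

lemma pt_proj:
  assumes "v \<noteq> zero3" obtains c where "c \<noteq> 0" "pt (proj v) = (\<lambda>j. c * v j)"
proof -
  from represents_unique[OF represents_proj[OF assms] represents_pt]
  obtain c where "c \<noteq> 0" "\<And>j. vec_nth (\<chi> j. pt (proj v) j) j = c * vec_nth (\<chi> j. v j) j" by blast
  then show ?thesis by (intro that[of c]) auto
qed

lemma vanishes_at_iff:
  assumes "F \<in> forms d" shows "vanishes_at F p \<longleftrightarrow> eval_mpoly F (pt p) = 0"
proof
  assume "vanishes_at F p"
  from this[unfolded vanishes_at_def, rule_format, OF represents_pt]
  have "eval_mpoly F (vec_nth (\<chi> j. pt p j)) = 0" .
  moreover have "vec_nth (\<chi> j. pt p j) = pt p" by (rule ext) simp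
  ultimately show "eval_mpoly F (pt p) = 0" by simp
next
  assume 0: "eval_mpoly F (pt p) = 0"
  show "vanishes_at F p" unfolding vanishes_at_def
  proof (intro allI impI)
    fix v assume "represents v p"
    then obtain c where "\<forall>j. vec_nth v j = c * pt p j" by (auto simp: represents_iff_pt)
    then have "(\<lambda>j. vec_nth v j) = (\<lambda>j. c * pt p j)" by auto
    with 0 show "eval_mpoly F (\<lambda>j. vec_nth v j) = 0" by (simp add: eval_homogeneous[OF assms])
  qed
qed

lemma eval_proj_iff:
  assumes "F \<in> forms d" "v \<noteq> zero3"
  shows "eval_mpoly F (pt (proj v)) = 0 \<longleftrightarrow> eval_mpoly F v = 0"
proof -
  obtain c where "c \<noteq> 0" "pt (proj v) = (\<lambda>j. c * v j)" using assms(2) by (rule pt_proj)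
  then show ?thesis by (simp add: eval_homogeneous[OF assms(1)])
qed

lemma module_mult: "Modules.module ((*) :: 'r::comm_ring_1 \<Rightarrow> 'r \<Rightarrow> 'r)"
  by unfold_locales (auto simp: algebra_simps)

interpretation ideal: Modules.module "(*) :: 'r::comm_ring_1 \<Rightarrow> 'r \<Rightarrow> 'r"
  by (rule module_mult)

declare ideal.scale_scale [simp del]

lemma subspace_if_ideal:
  fixes I :: "('v, 'k::field) mpoly set"
  assumes "ideal.subspace I" shows "mp.subspace I"
  using assms by (simp add: mp.subspace_def ideal.subspace_def)

lemma subspace_ideal_of_point: "ideal.subspace (ideal_of_point p)"
  unfolding ideal_of_point_def ideal_generated_def by (rule ideal.subspace_span)

lemma subspace_ideal_square: "ideal.subspace (ideal_square I)"
  unfolding ideal_square_def ideal_generated_def by (rule ideal.subspace_span)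

lemma subspace_ideal_of_points: "mp.subspace (ideal_of_points X)"
  unfolding ideal_of_points_def
  by (intro mp.subspace_Inter) (auto intro: subspace_if_ideal subspace_ideal_of_point)

lemma subspace_ideal_of_double_points: "mp.subspace (ideal_of_double_points X)"
  unfolding ideal_of_double_points_def
  by (intro mp.subspace_Inter) (auto intro: subspace_if_ideal subspace_ideal_square)

lemma eval_ideal_of_point:
  assumes "F \<in> ideal_of_point p" shows "eval_mpoly F (pt p) = 0"
  using assms unfolding ideal_of_point_def ideal_generated_def
proof (induction rule: ideal.span_induct)
  case base
  show ?case by (simp add: ideal.subspace_def)
next
  case (step F)
  then show ?case using vanishes_at_iff by auto
qed

lemma form_in_ideal_of_point:
  assumes "F \<in> forms d"
  shows "F \<in> ideal_of_point p \<longleftrightarrow> eval_mpoly F (pt p) = 0"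
proof
  assume "eval_mpoly F (pt p) = 0"
  with assms show "F \<in> ideal_of_point p"
    unfolding ideal_of_point_def ideal_generated_def
    by (intro ideal.span_base) (auto simp: vanishes_at_iff)
qed (rule eval_ideal_of_point)

lemma ideal_square_vanishing:
  assumes "F \<in> ideal_square (ideal_of_point p)"
  shows "eval_mpoly F (pt p) = 0 \<and> dir_deriv F (pt p) w = 0"
  using assms unfolding ideal_square_def ideal_generated_def
proof (induction rule: ideal.span_induct)
  case base
  show ?case by (simp add: ideal.subspace_def)
next
  case (step F)
  then show ?case by (auto simp: eval_ideal_of_point)
qed

lemma ex_two_linforms:
  assumes "v \<noteq> zero3"
  obtains u1 u2 :: "3 \<Rightarrow> 'k::field" where "cross u1 u2 = v"
proof -
  obtain u1 where u1: "u1 \<noteq> zero3" "dot3 v u1 = 0" by (rule ex_nonzero_orthogonal)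
  then have "dot3 u1 v = 0" by (simp add: dot3_commute)
  with ex_cross_eq[OF u1(1)] that show ?thesis by metis
qed

text \<open>Vanishing at the point gives \<open>F = linform u1 * A + linform u2 * B\<close> with
  both linear forms in the ideal of the point, and the derivatives of \<open>F\<close> there are
  combinations of the values of \<open>A\<close> and \<open>B\<close>.\<close>

lemma form_in_ideal_square:
  fixes F :: "(3, 'k::field) mpoly"
  assumes F: "F \<in> forms d"
  shows "F \<in> ideal_square (ideal_of_point p) \<longleftrightarrow>
    eval_mpoly F (pt p) = 0 \<and> (\<forall>w. dir_deriv F (pt p) w = 0)"
proof
  assume F0: "eval_mpoly F (pt p) = 0 \<and> (\<forall>w. dir_deriv F (pt p) w = 0)"
  obtain u1 u2 where u: "cross u1 u2 = pt p" using pt_nonzero[of p] by (rule ex_two_linforms)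
  have ne: "cross u1 u2 \<noteq> zero3" using u by simp
  obtain A B where AB: "A \<in> forms (d - 1)" "B \<in> forms (d - 1)" "F = linform u1 * A + linform u2 * B"
    using vanishing_formE[OF ne F] F0 u by metis
  obtain u3 where u3: "dot3 u3 (cross u1 u2) = 1" using ne by (rule ex_third_vector)
  have u12: "dot3 u1 (pt p) = 0" "dot3 u2 (pt p) = 0" by (simp_all flip: u)
  have der: "dot3 u1 w * eval_mpoly A (pt p) + dot3 u2 w * eval_mpoly B (pt p) = 0" for w
    using conjunct2[OF F0, rule_format, of w] by (simp add: AB(3) u12)
  \<comment> \<open>The directions \<open>cross u3 u1\<close> and \<open>cross u2 u3\<close> are
    dual to \<open>u2\<close> and \<open>u1\<close>: each isolates one of the two values.\<close>
  have "eval_mpoly B (pt p) = 0"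
    using der[of "cross u3 u1"] u3 by (simp add: dot3_cross_rotate[of u2 u3 u1])
  moreover have "eval_mpoly A (pt p) = 0"
    using der[of "cross u2 u3"] u3 by (simp flip: dot3_cross_rotate[of u3 u1 u2])
  ultimately have "A \<in> ideal_of_point p" "B \<in> ideal_of_point p"
    using AB form_in_ideal_of_point by auto
  moreover have "linform u1 \<in> ideal_of_point p" "linform u2 \<in> ideal_of_point p"
    by (simp_all add: form_in_ideal_of_point[OF linform_forms] u12)
  ultimately show "F \<in> ideal_square (ideal_of_point p)"
    unfolding AB(3) ideal_square_def ideal_generated_def
    by (intro ideal.span_add ideal.span_base) blast+
qed (use ideal_square_vanishing in blast)

lemma forms_Int_ideal_of_points:
  "forms d \<inter> ideal_of_points X = {F\<in>forms d. \<forall>p\<in>X. eval_mpoly F (pt p) = 0}"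
  using form_in_ideal_of_point by (auto simp: ideal_of_points_def)

lemma forms_Int_ideal_of_double_points:
  fixes X :: "'k::field proj_plane set"
  shows "forms d \<inter> ideal_of_double_points X =
    {F\<in>forms d. \<forall>p\<in>X. eval_mpoly F (pt p) = 0 \<and> (\<forall>w. dir_deriv F (pt p) w = 0)}"
  using form_in_ideal_square by (auto simp: ideal_of_double_points_def)

lemma hilbert_function_eq:
  fixes I :: "(3, 'k::field) mpoly set"
  assumes "mp.subspace I"
  shows "hilbert_function I d = mp.dim (forms d :: (3, 'k) mpoly set) - mp.dim (forms d \<inter> I)"
  unfolding hilbert_function_def by (rule dim_modulo_eq[OF findim_forms assms])

section \<open>Conditions along a cubic\<close>

definition gradient :: "(3, 'k::field) mpoly \<Rightarrow> (3 \<Rightarrow> 'k) \<Rightarrow> 3 \<Rightarrow> 'k" where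
  "gradient F v = (\<lambda>j. eval_mpoly (partial_deriv j F) v)"

lemma dir_deriv_gradient: "dir_deriv F v w = dot3 (gradient F v) w"
  by (simp add: dir_deriv_partial sum_UNIV_3 gradient_def dot3_def mult.commute)

lemma singular_point_iff:
  assumes "F \<in> forms d"
  shows "singular_point F p \<longleftrightarrow> eval_mpoly F (pt p) = 0 \<and> gradient F (pt p) = zero3"
  by (simp add: singular_point_def curve_def vanishes_at_iff[OF assms]
      vanishes_at_iff[OF partial_deriv_forms[OF assms]] gradient_def fun_eq_iff)

text \<open>At a simple point the choice is unique up to a scalar and a multiple of
  \<open>pt p\<close>. By Euler's formula neither affects whether the derivative of a form vanishing
  at \<open>p\<close> is zero.\<close>

definition tangent :: "(3, 'k::field) mpoly \<Rightarrow> 'k proj_plane \<Rightarrow> 3 \<Rightarrow> 'k" where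
  "tangent F p = (SOME w. cross (pt p) w \<noteq> zero3 \<and> dir_deriv F (pt p) w = 0)"

lemma tangent:
  assumes "F \<in> forms d" "eval_mpoly F (pt p) = 0" "gradient F (pt p) \<noteq> zero3"
  shows "cross (pt p) (tangent F p) \<noteq> zero3" "dir_deriv F (pt p) (tangent F p) = 0"
proof -
  let ?g = "gradient F (pt p)"
  have "dot3 ?g (pt p) = 0"
    using dir_deriv_euler[OF assms(1), of "pt p"] assms(2) by (simp add: dir_deriv_gradient)
  then have "dot3 (pt p) ?g = 0" by (simp add: dot3_commute)
  with ex_cross_eq[OF pt_nonzero] obtain w where w: "cross (pt p) w = ?g" by blast
  then have "cross (pt p) w \<noteq> zero3" "dot3 ?g w = 0"
    using assms(3) by (simp, metis dot3_commute dot3_cross(2))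
  then have "\<exists>w. cross (pt p) w \<noteq> zero3 \<and> dir_deriv F (pt p) w = 0"
    by (auto simp: dir_deriv_gradient)
  from someI_ex[OF this] show "cross (pt p) (tangent F p) \<noteq> zero3" "dir_deriv F (pt p) (tangent F p) = 0"
    unfolding tangent_def by blast+
qed

lemma annihilator_parallel:
  assumes "cross v w \<noteq> zero3" "dot3 g v = 0" "dot3 g w = 0"
  obtains c where "g = (\<lambda>i. c * cross v w i)"
proof -
  have "cross g (cross v w) = zero3" using assms(2,3) by (simp add: cross_cross)
  then have "cross (cross v w) g = zero3" by (subst cross_antisym) simp
  with assms(1) that cross_eq_zero3_imp_multiple show ?thesis by metis
qed

lemma ex_linform_values:
  assumes "cross v w \<noteq> zero3"
  obtains u where "dot3 u v = x" "dot3 u w = y"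
proof -
  obtain s where s: "dot3 s (cross v w) = 1" using assms by (rule ex_third_vector)
  let ?u = "\<lambda>i. x * cross w s i + y * cross s v i"
  have "dot3 v (cross w s) = 1" "dot3 w (cross s v) = 1"
    using s by (simp_all add: dot3_cross_rotate[of s v w] dot3_cross_rotate[of v w s])
  then have "dot3 v ?u = x" "dot3 w ?u = y" by simp_all
  then show ?thesis by (intro that[of ?u]) (simp_all only: dot3_commute[of ?u])
qed

lemma dot3_vec3_powers: "dot3 (vec3 1 t (t * t)) v = poly [:v 1, v 2, v 3:] t"
  unfolding dot3_def vec3_simps by (simp add: distrib_left mult.assoc)

text \<open>The line is taken from the family \<open>(1, t, t\<^sup>2)\<close>; passing through a
  given point is a nonzero polynomial condition on \<open>t\<close>, so finitely many points exclude
  finitely many \<open>t\<close>.\<close>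

lemma ex_line_avoiding:
  fixes S :: "'k::alg_closed_field proj_plane set"
  assumes "finite S" shows "\<exists>u. u \<noteq> zero3 \<and> (\<forall>p\<in>S. dot3 u (pt p) \<noteq> 0)"
proof -
  let ?q = "\<lambda>p. [:pt p 1, pt p 2, pt p 3:]"
  have "?q p \<noteq> 0" for p
  proof
    assume "?q p = 0"
    then have "pt p = zero3" unfolding fun3_eq_iff by simp
    with pt_nonzero show False by contradiction
  qed
  then have "finite {t. poly (?q p) t = 0}" for p by (rule poly_roots_finite)
  then have "finite (\<Union>p\<in>S. {t. poly (?q p) t = 0})" by (rule finite_UN_I[OF assms])
  from ex_new_if_finite[OF infinite_UNIV_alg_closed this]
  obtain t where t: "t \<notin> (\<Union>p\<in>S. {t. poly (?q p) t = 0})" by (rule exE)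
  show ?thesis
  proof (intro exI conjI ballI)
    show "vec3 1 t (t * t) \<noteq> zero3"
    proof
      assume "vec3 1 t (t * t) = zero3"
      from fun_cong[OF this, of 1] show False by simp
    qed
    fix p assume "p \<in> S"
    with t have "poly (?q p) t \<noteq> 0" by blast
    then show "dot3 (vec3 1 t (t * t)) (pt p) \<noteq> 0" unfolding dot3_vec3_powers .
  qed
qed

definition cond_functional :: "(3, 'k::field) mpoly \<Rightarrow> 'k proj_plane \<times> bool \<Rightarrow> (3, 'k) mpoly \<Rightarrow> 'k" where
  "cond_functional F i G = (if snd i then dir_deriv G (pt (fst i)) (tangent F (fst i)) else eval_mpoly G (pt (fst i)))"

definition cond_index :: "'a set \<Rightarrow> 'a set \<Rightarrow> ('a \<times> bool) set" where
  "cond_index X T = X \<times> {False, True} \<union> T \<times> {False}"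

text \<open>The forms of degree \<open>d\<close> whose restriction to the cubic vanishes doubly on \<open>X\<close> and simply on \<open>T\<close>.\<close>

definition tangent_forms ::
    "(3, 'k::field) mpoly \<Rightarrow> 'k proj_plane set \<Rightarrow> 'k proj_plane set \<Rightarrow> nat \<Rightarrow> (3, 'k) mpoly set" where
  "tangent_forms F X T d = mp.common_kernel (forms d) (cond_functional F) (cond_index X T)"

lemma tangent_forms_iff:
  "G \<in> tangent_forms F X T d \<longleftrightarrow> G \<in> forms d \<and>
    (\<forall>p\<in>X. eval_mpoly G (pt p) = 0 \<and> dir_deriv G (pt p) (tangent F p) = 0) \<and>
    (\<forall>p\<in>T. eval_mpoly G (pt p) = 0)"
  unfolding tangent_forms_def mp.common_kernel_def cond_index_def cond_functional_def
  by (auto simp: ball_Un)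

lemma functional_cond: "mp.functional (cond_functional F i)"
  unfolding cond_functional_def using functional_dir_deriv functional_eval by (cases "snd i") auto

lemma findim_tangent_forms: "mp.findim (tangent_forms F X T d)"
  unfolding tangent_forms_def by (rule mp.findim_common_kernel[OF findim_forms functional_cond])

lemma subspace_tangent_forms: "mp.subspace (tangent_forms F X T d)"
  by (rule mp.findim_subspace[OF findim_tangent_forms])

lemma tangent_forms_mult:
  "G \<in> tangent_forms F X T d \<Longrightarrow> H \<in> forms e \<Longrightarrow> H * G \<in> tangent_forms F X T (e + d)"
  by (simp add: tangent_forms_iff forms_mult)

lemma card_cond_index:
  assumes "finite X" "finite T" "X \<inter> T = {}"
  shows "card (cond_index X T) = 2 * card X + card T" "finite (cond_index X T)"
proof -
  have "(X \<times> {False, True}) \<inter> (T \<times> {False}) = {}" using assms(3) by auto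
  then show "card (cond_index X T) = 2 * card X + card T" "finite (cond_index X T)"
    unfolding cond_index_def using assms by (simp_all add: card_Un_disjoint card_cartesian_product)
qed

section \<open>Points of an irreducible cubic and independence of conditions in large degree\<close>

locale cubic_curve =
  fixes F :: "(3, 'k::alg_closed_field) mpoly"
  assumes cubic: "irreducible_cubic F"
begin

lemma F_forms: "F \<in> forms 3"
  using cubic by (simp add: irreducible_cubic_def)

lemma prime_F: "prime_elem F"
  by (rule irreducible_imp_prime_elem_mpoly3) (use cubic in \<open>simp add: irreducible_cubic_def\<close>)

lemma F_nonzero: "F \<noteq> 0"
  using prime_F by (rule prime_elem_not_zeroI)

lemma curve_iff: "p \<in> curve F \<longleftrightarrow> eval_mpoly F (pt p) = 0"
  by (simp add: curve_def vanishes_at_iff[OF F_forms])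

lemma not_dvd_small:
  assumes "G \<in> forms d" "d < 3" "G \<noteq> 0" shows "\<not> F dvd G"
proof
  assume "F dvd G"
  from form_dvd_formE[OF F_forms assms(1) this assms(3)] assms(2) show False by auto
qed

lemma dvd_mult_cancel: "F dvd G * H \<Longrightarrow> \<not> F dvd G \<Longrightarrow> F dvd H"
  by (drule prime_elem_dvd_multD[OF prime_F]) (erule disjE, erule notE)

abbreviation "simple_point p \<equiv> p \<in> curve F \<and> \<not> singular_point F p"

lemma simple_point_tangent:
  assumes "simple_point p"
  shows "cross (pt p) (tangent F p) \<noteq> zero3" "dir_deriv F (pt p) (tangent F p) = 0"
proof -
  have "eval_mpoly F (pt p) = 0" "gradient F (pt p) \<noteq> zero3"
    using assms by (simp_all add: curve_iff singular_point_iff[OF F_forms])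
  from tangent[OF F_forms this]
  show "cross (pt p) (tangent F p) \<noteq> zero3" "dir_deriv F (pt p) (tangent F p) = 0" .
qed

lemma ex_curve_point_on_line:
  assumes "eval_mpoly F e \<noteq> 0"
  shows "\<exists>s. eval_mpoly F (\<lambda>i. a i + t * b i + s * e i) = 0"
proof -
  obtain x y where xy: "x \<noteq> 0 \<or> y \<noteq> 0" "eval_mpoly F (\<lambda>i. x * e i + y * (a i + t * b i)) = 0"
    using form_zero_on_line[OF F_forms, of e "\<lambda>i. a i + t * b i"] by auto
  \<comment> \<open>The zero that was found is not \<open>e\<close> itself, so the coefficient of
    the moving point can be scaled to one.\<close>
  have y: "y \<noteq> 0"
  proof
    assume "y = 0"
    with xy have "x \<noteq> 0" "eval_mpoly F (\<lambda>i. x * e i) = 0" by simp_all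
    with assms show False by (simp add: eval_homogeneous[OF F_forms])
  qed
  have "(\<lambda>i. x * e i + y * (a i + t * b i)) = (\<lambda>i. y * (a i + t * b i + (x / y) * e i))"
    using y by (intro ext) (simp add: distrib_left)
  with xy(2) have "y ^ 3 * eval_mpoly F (\<lambda>i. a i + t * b i + (x / y) * e i) = 0"
    by (simp only: eval_homogeneous[OF F_forms])
  with y show ?thesis by (intro exI[of _ "x / y"]) simp
qed

text \<open>Projection from a point \<open>e\<close> off the curve: each line through
  \<open>e\<close> meets the curve away from \<open>e\<close>, and different parameters
  \<open>t\<close> give different points.\<close>

lemma infinite_curve: "infinite (curve F)"
proof -
  have "\<not> (\<forall>v. eval_mpoly F v = 0)"
  proof
    assume "\<forall>v. eval_mpoly F v = 0"
    then have "F = 0" by (intro form_eq_0_if_vanishes[OF F_forms]) simp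
    with F_nonzero show False by contradiction
  qed
  then obtain e where e: "eval_mpoly F e \<noteq> 0" by auto
  have e0: "e \<noteq> zero3"
  proof
    assume "e = zero3"
    with e eval_form_zero[OF F_forms] show False by simp
  qed
  then obtain z where z: "dot3 z e = 1" by (rule ex_dot3_eq_1)
  then have "z \<noteq> zero3" by auto
  then obtain a b where "cross a b = z" by (rule ex_two_linforms)
  with z have ab: "dot3 e (cross a b) = 1" by (simp add: dot3_commute[of e])
  define s where "s t = (SOME s. eval_mpoly F (\<lambda>i. a i + t * b i + s * e i) = 0)" for t
  define v where "v t = (\<lambda>i. a i + t * b i + s t * e i)" for t
  have v0: "eval_mpoly F (v t) = 0" for t
    unfolding v_def s_def by (rule someI_ex[OF ex_curve_point_on_line[OF e]])
  have cr: "dot3 e (cross (v t) (v t')) = t' - t" for t t'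
    unfolding v_def dot3_cross_affine ab by simp
  have vn: "v t \<noteq> zero3" for t
  proof
    assume "v t = zero3"
    then have "cross (v t) (v (t + 1)) = zero3" by (simp add: fun3_eq_iff cross_def)
    with cr[of t "t + 1"] show False by simp
  qed
  have "inj (\<lambda>t. proj (v t))"
  proof (rule injI)
    fix t t' assume "proj (v t) = proj (v t')"
    then have "represents (\<chi> j. v t' j) (proj (v t))" by (simp only: represents_proj[OF vn])
    with represents_proj[OF vn] have "\<exists>c. v t' = (\<lambda>j. c * v t j)" by (rule represents_unique_fun)
    then obtain c where "v t' = (\<lambda>j. c * v t j)" by (rule exE)
    then have "cross (v t) (v t') = zero3" by (simp add: fun3_eq_iff cross_def)
    with cr[of t t'] show "t = t'" by simp
  qed
  then have "infinite (range (\<lambda>t. proj (v t)))"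
    using infinite_UNIV_alg_closed[where 'k = 'k] by (simp add: finite_image_iff)
  moreover have "range (\<lambda>t. proj (v t)) \<subseteq> curve F"
  proof (rule image_subsetI)
    fix t
    show "proj (v t) \<in> curve F" by (simp add: curve_iff eval_proj_iff[OF F_forms vn] v0)
  qed
  ultimately show ?thesis by (meson infinite_super)
qed

lemma ex_points_on_curve:
  assumes "finite S" obtains T where "T \<subseteq> curve F - S" "finite T" "card T = n"
  using infinite_arbitrarily_large[OF Diff_infinite_finite[OF assms infinite_curve]] that by metis

lemma F_mult_tangent_forms:
  assumes "\<And>p. p \<in> X \<Longrightarrow> simple_point p" "T \<subseteq> curve F" "A \<in> forms e"
  shows "F * A \<in> tangent_forms F X T (3 + e)"
proof -
  have "eval_mpoly F (pt p) = 0" if "p \<in> X \<union> T" for p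
    using assms(1)[of p] assms(2) that by (auto simp flip: curve_iff)
  then show ?thesis
    using forms_mult[OF F_forms assms(3)] simple_point_tangent(2)[OF assms(1)]
    by (simp add: tangent_forms_iff)
qed

text \<open>For each \<open>q\<close> in \<open>Z\<close> take a line through \<open>q\<close> that
  avoids \<open>p\<close>. Squaring the product makes it singular at every \<open>q\<close>, which
  explains the degree \<open>2 * card Z\<close>.\<close>

lemma separating_form:
  assumes "finite Z" "p \<notin> Z"
  shows "\<exists>P. P \<in> forms (2 * card Z) \<and> eval_mpoly P (pt p) \<noteq> 0 \<and>
    (\<forall>q\<in>Z. eval_mpoly P (pt q) = 0 \<and> (\<forall>w. dir_deriv P (pt q) w = (0 :: 'k)))"
proof -
  have "\<exists>u. dot3 u (pt q) = 0 \<and> dot3 u (pt p) \<noteq> (0 :: 'k)" if "q \<noteq> p" for q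
    using ex_linform_values[OF cross_pt_nonzero[OF that], of 0 1] by (metis zero_neq_one)
  then obtain u where u: "\<And>q. q \<noteq> p \<Longrightarrow> dot3 (u q) (pt q) = 0 \<and> dot3 (u q) (pt p) \<noteq> (0 :: 'k)"
    by metis
  let ?Q = "\<Prod>q\<in>Z. linform (u q)"
  have "?Q \<in> forms (\<Sum>q\<in>Z. 1)" by (rule forms_prod[OF linform_forms])
  then have Q: "?Q \<in> forms (card Z)" by simp
  have neq: "q \<noteq> p" if "q \<in> Z" for q using assms(2) that by blast
  have "(\<Prod>q\<in>Z. dot3 (u q) (pt p)) \<noteq> 0" using u[OF neq] assms(1) by (simp add: prod_zero_iff)
  then have "eval_mpoly (?Q * ?Q) (pt p) \<noteq> 0" by simp
  moreover have "eval_mpoly (?Q * ?Q) (pt q) = 0 \<and> (\<forall>w. dir_deriv (?Q * ?Q) (pt q) w = 0)" if "q \<in> Z" for q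
  proof -
    have "eval_mpoly ?Q (pt q) = (\<Prod>q'\<in>Z. dot3 (u q') (pt q))" by simp
    also have "\<dots> = 0" using u[OF neq[OF that]] that assms(1) by (intro prod_zero) blast+
    finally show ?thesis by simp
  qed
  moreover have "?Q * ?Q \<in> forms (2 * card Z)" by (rule forms_mult'[OF Q Q]) simp
  ultimately show ?thesis by blast
qed

end

locale point_conditions = cubic_curve +
  fixes X T :: "'a proj_plane set"
  assumes X: "finite X" "\<And>p. p \<in> X \<Longrightarrow> simple_point p"
    and T: "finite T" "T \<subseteq> curve F" and XT: "X \<inter> T = {}"
begin

abbreviation "Y \<equiv> tangent_forms F X T"
abbreviation "\<nu> \<equiv> 2 * card X + card T"

lemma dim_tangent_forms_ge: "mp.dim (forms d :: (3, 'a) mpoly set) \<le> mp.dim (Y d) + \<nu>"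
proof -
  let ?I = "cond_index X T"
  have "mp.dim (forms d :: (3, 'a) mpoly set) \<le> mp.dim (mp.common_kernel (forms d) (cond_functional F) ?I) + card ?I"
    by (rule mp.dim_common_kernel_ge[OF findim_forms card_cond_index(2)[OF X(1) T(1) XT] functional_cond])
  then show ?thesis unfolding tangent_forms_def card_cond_index(1)[OF X(1) T(1) XT] .
qed

text \<open>Independence follows from a dual form for every condition: a form singular at all the
  other points, times a linear form that adjusts the value and the tangential derivative at the
  remaining point \<open>p\<close>.\<close>

lemma dim_tangent_forms_large:
  assumes m: "m \<ge> 2 * card (X \<union> T)"
  shows "mp.dim (forms m :: (3, 'a) mpoly set) = mp.dim (Y m) + \<nu>"
proof -
  let ?I = "cond_index X T"
  have "\<exists>G\<in>forms m. cond_functional F i G \<noteq> 0 \<and> (\<forall>j\<in>?I - {i}. cond_functional F j G = 0)"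
    if i: "i \<in> ?I" for i
  proof -
    obtain p b where pb: "i = (p, b)" by (cases i)
    let ?Z = "X \<union> T - {p}"
    have p: "p \<in> X \<union> T" "p \<in> X \<or> \<not> b" using i pb by (auto simp: cond_index_def)
    have fin: "finite (X \<union> T)" "finite ?Z" "p \<notin> ?Z" using X T by auto
    obtain P where P: "P \<in> forms (2 * card ?Z)" "eval_mpoly P (pt p) \<noteq> 0"
      "\<forall>q\<in>?Z. eval_mpoly P (pt q) = 0 \<and> (\<forall>w. dir_deriv P (pt q) w = 0)"
      using separating_form[OF fin(2,3)] by blast
    obtain l where l: "dot3 l (pt p) = 1" using pt_nonzero[of p] by (rule ex_dot3_eq_1)
    have "card (X \<union> T) = card ?Z + 1" using fin p by (metis Suc_eq_plus1 card.remove)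
    \<comment> \<open>Powers of a linear form that is nonzero at \<open>p\<close> fill up the
      degree; the \<open>+ 1\<close> reserves room for the adjusting linear factor.\<close>
    moreover define k where "k = m - (2 * card ?Z + 1)"
    ultimately have k: "m = 2 * card ?Z + (k + 1)" using m by simp
    define Q where "Q = P * linform l ^ k"
    have Q: "Q \<in> forms (2 * card ?Z + k)" "eval_mpoly Q (pt p) \<noteq> 0"
      unfolding Q_def using P l forms_power[OF linform_forms, of l k] by (auto intro!: forms_mult')
    have Q0: "eval_mpoly Q (pt q) = 0 \<and> dir_deriv Q (pt q) w = 0" if "q \<in> ?Z" for q w
      unfolding Q_def using P(3) that by simp
    \<comment> \<open>For the derivative condition \<open>u\<close> vanishes at \<open>p\<close>.
      For the value condition at a point of \<open>X\<close> its derivative compensates that of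
      \<open>Q\<close>; at a point of \<open>T\<close> only the value matters.\<close>
    obtain u where u: "b \<Longrightarrow> dot3 u (pt p) = 0 \<and> dot3 u (tangent F p) = 1"
      "\<not> b \<Longrightarrow> dot3 u (pt p) = 1"
      "\<not> b \<Longrightarrow> p \<in> X \<Longrightarrow> eval_mpoly Q (pt p) * dot3 u (tangent F p) + dir_deriv Q (pt p) (tangent F p) = 0"
    proof (cases "p \<in> X")
      case False
      with p l that[of l] show ?thesis by simp
    next
      case True
      then have ne: "cross (pt p) (tangent F p) \<noteq> zero3" using simple_point_tangent(1)[OF X(2)] by blast
      show ?thesis
      proof (cases b)
        case True
        obtain u where "dot3 u (pt p) = 0" "dot3 u (tangent F p) = 1" using ne by (rule ex_linform_values)
        with True that show ?thesis by simp
      next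
        case False
        obtain u where "dot3 u (pt p) = 1"
          "dot3 u (tangent F p) = - dir_deriv Q (pt p) (tangent F p) / eval_mpoly Q (pt p)"
          using ne by (rule ex_linform_values)
        with False Q(2) that show ?thesis by simp
      qed
    qed
    let ?G = "Q * linform u"
    show ?thesis
    proof (intro bexI[of _ ?G] conjI ballI)
      show "?G \<in> forms m" using Q(1) k by (intro forms_mult'[OF _ linform_forms]) auto
      show "cond_functional F i ?G \<noteq> 0"
        using u Q(2) pb by (cases b) (simp_all add: cond_functional_def)
      fix j assume j: "j \<in> ?I - {i}"
      obtain q c where qc: "j = (q, c)" by (cases j)
      show "cond_functional F j ?G = 0"
      proof (cases "q = p")
        case True
        then have "c = (\<not> b)" using j qc pb by auto
        moreover have "c \<Longrightarrow> p \<in> X" using True j qc XT by (auto simp: cond_index_def)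
        ultimately show ?thesis using u qc True by (cases b) (auto simp: cond_functional_def)
      next
        case False
        then have "q \<in> ?Z" using j qc by (auto simp: cond_index_def)
        then show ?thesis using Q0[of q] qc by (simp add: cond_functional_def)
      qed
    qed
  qed
  from mp.dim_common_kernel_eq[OF findim_forms card_cond_index(2)[OF X(1) T(1) XT] functional_cond this]
  show ?thesis unfolding tangent_forms_def card_cond_index(1)[OF X(1) T(1) XT] .
qed

end

context kspace
begin

text \<open>Modulo \<open>N\<close> the map \<open>h\<close> has rank at most one on
  \<open>W\<close>.\<close>

lemma dim_preimage_codim_one:
  assumes V: "findim V" and N: "subspace N" "N \<subseteq> V" "dim V \<le> dim N + 1"
    and W: "findim W" and h: "Vector_Spaces.linear scale scale h" "h ` W \<subseteq> V"
  shows "dim W \<le> dim {x\<in>W. h x \<in> N} + 1"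
proof -
  interpret kspace_pair scale scale by unfold_locales
  obtain f where f0: "Vector_Spaces.linear scale scale f \<and> (\<forall>x. f x = 0 \<longleftrightarrow> x \<in> N)"
    using linear_with_kernel[OF N(1)] by (rule exE)
  note f = conjunct1[OF f0] conjunct2[OF f0, rule_format]
  interpret f: Vector_Spaces.linear scale scale f by (fact f(1))
  interpret h: Vector_Spaces.linear scale scale h by (fact h(1))
  have g: "Vector_Spaces.linear scale scale (\<lambda>x. f (h x))"
    by unfold_locales (simp_all add: f.add f.scale h.add h.scale)
  interpret g: Vector_Spaces.linear scale scale "\<lambda>x. f (h x)" by (fact g)
  have "{x\<in>V. f x = 0} = N" using N(2) f(2) by auto
  then have dV: "dim V = dim N + dim (f ` V)" using rank_nullity[OF f(1) V] by simp
  have "{x\<in>W. f (h x) = 0} = {x\<in>W. h x \<in> N}" using f(2) by simp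
  then have dW: "dim W = dim {x\<in>W. h x \<in> N} + dim ((\<lambda>x. f (h x)) ` W)"
    using rank_nullity[OF g W] by simp
  have "findim (f ` V)"
  proof -
    from V obtain B where B: "finite B" "V \<subseteq> span B" unfolding findim_def by blast
    have "f ` V \<subseteq> span (f ` B)" using B(2) f.span_image[of B] by auto
    with B(1) f.subspace_image[OF findim_subspace[OF V]] show ?thesis unfolding findim_def by blast
  qed
  moreover have "subspace ((\<lambda>x. f (h x)) ` W)" by (rule g.subspace_image[OF findim_subspace[OF W]])
  moreover have "(\<lambda>x. f (h x)) ` W \<subseteq> f ` V" using h(2) by auto
  ultimately have "dim ((\<lambda>x. f (h x)) ` W) \<le> dim (f ` V)" by (rule dim_subspace_le)
  with dV dW N(3) show ?thesis by simp
qed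

end

lemma ex_two_independent_linforms:
  assumes K: "mp.subspace K" "K \<subseteq> (forms 1 :: (3, 'k::field) mpoly set)" and dim: "mp.dim K \<ge> 2"
  obtains u1 u2 where "cross u1 u2 \<noteq> zero3" "linform u1 \<in> K" "linform u2 \<in> K"
proof -
  obtain B where B: "B \<subseteq> K" "finite B" "mp.independent B" "mp.span B = K" "card B = mp.dim K"
    by (rule mp.findim_basis[OF mp.findim_mono[OF findim_forms K]])
  from dim B(5) have "\<not> card B \<le> Suc 0" by simp
  then obtain L1 L2 where L: "L1 \<in> B" "L2 \<in> B" "L1 \<noteq> L2"
    by (auto simp: card_le_Suc0_iff_eq[OF B(2)])
  obtain u1 where u1: "L1 = linform u1" using forms_1E[of L1] L B(1) K(2) by blast
  obtain u2 where u2: "L2 = linform u2" using forms_1E[of L2] L B(1) K(2) by blast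
  have "cross u1 u2 \<noteq> zero3"
  proof
    assume c0: "cross u1 u2 = zero3"
    have "L1 \<noteq> 0" using mp.dependent_zero[of B] B(3) L(1) by auto
    then have "u1 \<noteq> zero3" using u1 by simp
    with c0 obtain c where "u2 = (\<lambda>i. c * u1 i)" by (rule cross_eq_zero3_imp_multiple)
    then have "L2 = const c * L1" using u1 u2 linform_scale by simp
    moreover have "const c * L1 \<in> mp.span (B - {L2})" using L by (intro mp.span_scale mp.span_base) simp
    ultimately show False using B(3) L(2) unfolding mp.dependent_def by auto
  qed
  moreover have "linform u1 \<in> K" "linform u2 \<in> K" using L B(1) u1 u2 by auto
  ultimately show ?thesis by (rule that)
qed

lemma form_combination:
  fixes E F G :: "(3, 'k::field) mpoly"
  assumes "E \<in> forms e" "F \<in> forms f" "G \<in> forms d" "E = F * B + G * C"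
  shows "\<exists>B' C'. C' \<in> forms (e - d) \<and> E = F * B' + G * C'"
proof -
  have "E = hcomp e E" using hcomp_form[OF assms(1), of e] by simp
  also have "\<dots> = hcomp e (F * B) + hcomp e (G * C)" by (subst assms(4)) (rule hcomp_add)
  also have "\<dots> = F * (if e < f then 0 else hcomp (e - f) B) + G * (if e < d then 0 else hcomp (e - d) C)"
    by (simp add: hcomp_mult_form[OF assms(2)] hcomp_mult_form[OF assms(3)])
  finally show ?thesis
    by (intro exI[of _ "if e < f then 0 else hcomp (e - f) B"] exI[of _ "if e < d then 0 else hcomp (e - d) C"] conjI)
       (simp_all add: hcomp_in_forms)
qed

section \<open>Bezout by counting dimensions\<close>

context cubic_curve
begin

definition span_with :: "(3, 'k) mpoly \<Rightarrow> nat \<Rightarrow> nat \<Rightarrow> (3, 'k) mpoly set" where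
  "span_with G d m = {x + y |x y. x \<in> (*) G ` forms (m - d) \<and> y \<in> (*) F ` forms (m - 3)}"

lemma subspace_span_with: "mp.subspace (span_with G d m)"
  unfolding span_with_def by (rule mp.findim_subspace[OF mp.findim_sum]) (intro findim_mult_image findim_forms)+

text \<open>Since \<open>F\<close> is prime and does not divide \<open>G\<close>, common multiples
  of both are multiples of \<open>F * G\<close>. Combined with \<open>dim_forms_diff\<close>, the
  bound says that the ideal of \<open>F\<close> and \<open>G\<close> has codimension at most
  \<open>3 * d\<close> in degree \<open>m\<close>.\<close>

lemma dim_span_with:
  assumes G: "G \<in> forms d" "\<not> F dvd G" and m: "m \<ge> d + 3"
  shows "mp.dim (forms (m - d) :: (3, 'k) mpoly set) + mp.dim (forms (m - 3) :: (3, 'k) mpoly set)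
     \<le> mp.dim (span_with G d m) + mp.dim (forms (m - d - 3) :: (3, 'k) mpoly set)"
proof -
  let ?U = "(*) G ` forms (m - d)" and ?W = "(*) F ` forms (m - 3)" and ?V = "(*) (F * G) ` forms (m - d - 3)"
  have G0: "G \<noteq> 0" using G(2) by auto
  have fU: "mp.findim ?U" and fW: "mp.findim ?W" and fV: "mp.findim ?V"
    by (intro findim_mult_image findim_forms)+
  have "?U \<inter> ?W \<subseteq> ?V"
  proof
    fix x assume "x \<in> ?U \<inter> ?W"
    then obtain A B where A: "x = G * A" "A \<in> forms (m - d)" and B: "x = F * B" by blast
    show "x \<in> ?V"
    proof (cases "A = 0")
      case True
      then show ?thesis using A(1) by (intro image_eqI[of _ _ 0]) simp_all
    next
      case False
      have "F dvd G * A" using A(1) B by (metis dvd_triv_left)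
      then have "F dvd A" using G(2) by (rule dvd_mult_cancel)
      then obtain H where "A = F * H" "H \<in> forms (m - d - 3)"
        using form_dvd_formE[OF F_forms A(2) _ False] by blast
      then show ?thesis using A(1) by (intro image_eqI[of _ _ H]) (simp_all add: ac_simps)
    qed
  qed
  then have "mp.dim (?U \<inter> ?W) \<le> mp.dim ?V"
    by (intro mp.dim_subspace_le[OF fV] mp.subspace_Int) (simp_all add: mp.findim_subspace fU fW mp.subspace_inter)
  moreover have "mp.dim ?V = mp.dim (forms (m - d - 3) :: (3, 'k) mpoly set)"
    by (rule dim_forms_shift[OF _ findim_forms]) (simp add: F_nonzero G0)
  moreover have "mp.dim ?U = mp.dim (forms (m - d) :: (3, 'k) mpoly set)"
    by (rule dim_forms_shift[OF G0 findim_forms])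
  moreover have "mp.dim ?W = mp.dim (forms (m - 3) :: (3, 'k) mpoly set)"
    by (rule dim_forms_shift[OF F_nonzero findim_forms])
  moreover have "mp.dim (span_with G d m) + mp.dim (?U \<inter> ?W) = mp.dim ?U + mp.dim ?W"
    unfolding span_with_def by (rule mp.dim_sum_Int[OF fU fW])
  ultimately show ?thesis by linarith
qed

end

context point_conditions
begin

lemma F_mult_in: "A \<in> forms e \<Longrightarrow> F * A \<in> Y (3 + e)"
  using F_mult_tangent_forms[of X T A e] X(2) T(2) by blast

lemma F_image_subset: "m \<ge> 3 \<Longrightarrow> (*) F ` forms (m - 3) \<subseteq> Y m"
  using F_mult_in[of _ "m - 3"] by auto

lemma span_with_subset:
  assumes "G \<in> Y d" "m \<ge> d + 3" shows "span_with G d m \<subseteq> Y m"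
proof
  fix x assume "x \<in> span_with G d m"
  then obtain A B where x: "x = G * A + F * B" "A \<in> forms (m - d)" "B \<in> forms (m - 3)"
    unfolding span_with_def by blast
  have "A * G \<in> Y (m - d + d)" by (rule tangent_forms_mult[OF assms(1) x(2)])
  moreover have "F * B \<in> Y (3 + (m - 3))" by (rule F_mult_in[OF x(3)])
  ultimately show "x \<in> Y m"
    using assms(2) mp.subspace_add[OF subspace_tangent_forms] by (simp add: x(1) mult.commute)
qed

text \<open>In a large degree \<open>m\<close> the ideal of \<open>F\<close> and \<open>G\<close>
  has codimension at most \<open>3 * d\<close> in \<open>forms m\<close>. It lies in
  \<open>Y m\<close>, whose codimension there is exactly \<open>\<nu>\<close>.\<close>

lemma bezout:
  assumes "G \<in> Y d" "\<not> F dvd G" shows "\<nu> \<le> 3 * d"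
proof -
  define m where "m = 2 * card (X \<union> T) + d + 4"
  have m: "m \<ge> d + 3" "m \<ge> 2 * card (X \<union> T)" "m \<ge> 3" "m - d \<ge> 3" by (simp_all add: m_def)
  have G: "G \<in> forms d" using assms(1) by (simp add: tangent_forms_iff)
  have "mp.dim (span_with G d m) \<le> mp.dim (Y m)"
    by (rule mp.dim_subspace_le[OF findim_tangent_forms subspace_span_with span_with_subset[OF assms(1) m(1)]])
  with dim_span_with[OF G assms(2) m(1)] dim_tangent_forms_large[OF m(2)]
    dim_forms_diff[OF m(3), where 'k = 'a] dim_forms_diff[OF m(4), where 'k = 'a]
  show ?thesis using m(1) by linarith
qed

end

context cubic_curve
begin

text \<open>Imposing \<open>3 * d + 1\<close> of the zeros as simple conditions would contradict
  Bezout.\<close>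

lemma finite_zeros_on_curve:
  assumes "G \<in> forms d" "\<not> F dvd G"
  shows "finite {p \<in> curve F. eval_mpoly G (pt p) = 0}"
proof (rule ccontr)
  assume inf: "infinite {p \<in> curve F. eval_mpoly G (pt p) = 0}"
  obtain S where S: "S \<subseteq> {p \<in> curve F. eval_mpoly G (pt p) = 0}" "finite S" "card S = 3 * d + 1"
    using infinite_arbitrarily_large[OF inf] by blast
  interpret point_conditions F "{}" S
    by unfold_locales (use S in auto)
  have "G \<in> tangent_forms F {} S d"
    unfolding tangent_forms_iff using S(1) assms(1) by blast
  from bezout[OF this assms(2)] S(3) show False by simp
qed

end

section \<open>Residual degree one\<close>

context point_conditions
begin

lemma power_linform_regular:
  fixes G :: "(3, 'a) mpoly"
  assumes u: "u \<noteq> zero3" and G: "G \<in> forms d"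
    and nz: "\<And>v. v \<noteq> zero3 \<Longrightarrow> dot3 u v = 0 \<Longrightarrow> eval_mpoly F v = 0 \<Longrightarrow> eval_mpoly G v \<noteq> 0"
  shows "E \<in> forms e \<Longrightarrow> linform u ^ n * E = F * B + G * C \<Longrightarrow>
    \<exists>B' C'. C' \<in> forms (e - d) \<and> E = F * B' + G * C'"
proof (induction n arbitrary: E e B C)
  case 0
  then show ?case using form_combination[OF _ F_forms G] by simp
next
  case (Suc n)
  have "linform u * E \<in> forms (1 + e)" by (rule forms_mult[OF linform_forms Suc.prems(1)])
  moreover have "linform u ^ n * (linform u * E) = F * B + G * C"
    using Suc.prems(2) by (simp add: ac_simps)
  ultimately have "\<exists>B' C'. C' \<in> forms (1 + e - d) \<and> linform u * E = F * B' + G * C'" by (rule Suc.IH)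
  then obtain B' C' where C': "C' \<in> forms (1 + e - d)" "linform u * E = F * B' + G * C'" by blast
  have "\<not> F dvd linform u" using u by (intro not_dvd_small[OF linform_forms]) simp_all
  from linform_regular_mod_two_forms[OF prime_F F_forms this u G C'(1) nz C'(2)]
  obtain B'' C'' where "E = F * B'' + G * C''" by blast
  then show ?case by (rule form_combination[OF Suc.prems(1) F_forms G])
qed

text \<open>This is the arithmetic genus being one. In a large degree \<open>m\<close> the ideal of
  \<open>F\<close> and \<open>G\<close> has codimension at most one in \<open>Y m\<close>, so a
  space of linear forms of dimension two multiplies \<open>H\<close>, up to a power of
  \<open>linform u\<close>, into that ideal. Cancelling the power gives
  \<open>H * linform u1\<close> and \<open>H * linform u2\<close> as multiples \<open>G * M1\<close>
  and \<open>G * M2\<close> modulo \<open>F\<close>, and comparing the two makes \<open>F\<close>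
  divide the quadric \<open>?D\<close>.\<close>

lemma residual_degree_one:
  assumes \<nu>: "\<nu> + 1 = 3 * d" and G: "G \<in> Y d" and H: "H \<in> Y d"
  shows "\<exists>a b. (a \<noteq> 0 \<or> b \<noteq> 0) \<and> F dvd const a * G + const b * H"
proof (cases "F dvd G")
  case True
  then show ?thesis by (intro exI[of _ 1] exI[of _ 0]) simp
next
  case FG: False
  have Gd: "G \<in> forms d" and Hd: "H \<in> forms d" using G H by (simp_all add: tangent_forms_iff)
  have "finite {p \<in> curve F. eval_mpoly G (pt p) = 0}" by (rule finite_zeros_on_curve[OF Gd FG])
  \<comment> \<open>The line avoids the common zeros of \<open>F\<close> and \<open>G\<close>, so
    that \<open>linform u\<close> can be cancelled modulo both.\<close>
  from ex_line_avoiding[OF this] obtain u where u: "u \<noteq> zero3"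
    "\<forall>p\<in>{p \<in> curve F. eval_mpoly G (pt p) = 0}. dot3 u (pt p) \<noteq> 0" by blast
  have nz: "eval_mpoly G v \<noteq> 0" if v: "v \<noteq> zero3" "dot3 u v = 0" "eval_mpoly F v = 0" for v
  proof
    assume "eval_mpoly G v = 0"
    with v have "proj v \<in> {p \<in> curve F. eval_mpoly G (pt p) = 0}"
      by (simp add: curve_iff eval_proj_iff[OF F_forms] eval_proj_iff[OF Gd])
    with u(2) have "dot3 u (pt (proj v)) \<noteq> 0" by (rule bspec)
    moreover obtain c where "pt (proj v) = (\<lambda>j. c * v j)" using v(1) by (rule pt_proj)
    ultimately show False using v(2) by simp
  qed
  define n where "n = 2 * card (X \<union> T) + 3"
  \<comment> \<open>The products \<open>linform u ^ n * H * L\<close> then have degree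
    \<open>m\<close>, and \<open>n\<close> makes \<open>m\<close> large enough for the conditions to
    be independent.\<close>
  define m where "m = d + (n + 1)"
  have m: "m \<ge> d + 3" "m \<ge> 2 * card (X \<union> T)" "m \<ge> 3" "m - d \<ge> 3" by (simp_all add: m_def n_def)
  let ?N = "span_with G d m"
  have "mp.dim (Y m) \<le> mp.dim ?N + 1"
    using dim_span_with[OF Gd FG m(1)] dim_tangent_forms_large[OF m(2)] \<nu> m(1)
      dim_forms_diff[OF m(3), where 'k = 'a] dim_forms_diff[OF m(4), where 'k = 'a] by linarith
  moreover have "(\<lambda>L. linform u ^ n * H * L) ` forms 1 \<subseteq> Y m"
  proof (rule image_subsetI)
    fix L :: "(3, 'a) mpoly" assume L: "L \<in> forms 1"
    have "linform u ^ n * L \<in> forms (n + 1)"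
      using forms_power[OF linform_forms, of u n] by (intro forms_mult[OF _ L]) simp
    from tangent_forms_mult[OF H this] show "linform u ^ n * H * L \<in> Y m"
      by (simp add: m_def ac_simps)
  qed
  moreover have "Vector_Spaces.linear (\<lambda>c (G :: (3, 'a) mpoly). const c * G) (\<lambda>c (G :: (3, 'a) mpoly). const c * G)
      (\<lambda>L. linform u ^ n * H * L)" by (rule linear_mult)
  ultimately have "mp.dim (forms 1 :: (3, 'a) mpoly set) \<le>
      mp.dim {L \<in> forms 1. linform u ^ n * H * L \<in> ?N} + 1"
    by (intro mp.dim_preimage_codim_one[OF findim_tangent_forms subspace_span_with
          span_with_subset[OF G m(1)] _ findim_forms])
  moreover have "mp.dim (forms 1 :: (3, 'a) mpoly set) = 3" using dim_forms[of 1, where 'k = 'a] by simp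
  ultimately have K2: "mp.dim {L \<in> forms 1. linform u ^ n * H * L \<in> ?N} \<ge> 2" by simp
  have "mp.subspace {L \<in> forms 1. linform u ^ n * H * L \<in> ?N}"
    using subspace_span_with[of G d m] unfolding mp.subspace_def
    by (auto simp: distrib_left mult.left_commute[of _ "const _"])
  from ex_two_independent_linforms[OF this _ K2]
  obtain u1 u2 where u12: "cross u1 u2 \<noteq> zero3" "linform u ^ n * H * linform u1 \<in> ?N"
    "linform u ^ n * H * linform u2 \<in> ?N" by blast
  have LH: "\<exists>B M. M \<in> forms 1 \<and> H * linform w = F * B + G * M"
    if "linform u ^ n * H * linform w \<in> ?N" for w
  proof -
    from that obtain A B where "linform u ^ n * H * linform w = G * A + F * B"
      unfolding span_with_def by blast
    then have "linform u ^ n * (H * linform w) = F * B + G * A" by (simp add: ac_simps)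
    from power_linform_regular[OF u(1) Gd nz forms_mult[OF Hd linform_forms] this]
    show ?thesis unfolding add_diff_cancel_left' .
  qed
  from LH[OF u12(2)] obtain B1 M1 where M1: "M1 \<in> forms 1" "H * linform u1 = F * B1 + G * M1" by blast
  from LH[OF u12(3)] obtain B2 M2 where M2: "M2 \<in> forms 1" "H * linform u2 = F * B2 + G * M2" by blast
  let ?D = "linform u1 * M2 - linform u2 * M1"
  have "G * ?D = linform u1 * (G * M2) - linform u2 * (G * M1)" by (simp add: right_diff_distrib ac_simps)
  also have "\<dots> = linform u1 * (H * linform u2 - F * B2) - linform u2 * (H * linform u1 - F * B1)"
    by (simp add: M1(2) M2(2))
  also have "\<dots> = F * (linform u2 * B1 - linform u1 * B2)" by (simp add: right_diff_distrib ac_simps)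
  finally have "F dvd G * ?D" by simp
  then have "F dvd ?D" using FG by (rule dvd_mult_cancel)
  moreover have "?D \<in> forms 2"
    using M1(1) M2(1) by (intro forms_diff forms_mult'[OF linform_forms]) simp_all
  \<comment> \<open>A form of degree two divisible by the cubic is zero; here the degree of the
    curve is decisive.\<close>
  ultimately have D0: "?D = 0" using not_dvd_small[of ?D 2] by auto
  have u1: "u1 \<noteq> zero3" using u12(1) by (auto simp: cross_def fun3_eq_iff)
  have "linform u1 dvd linform u2 * M1" by (rule dvdI[of _ _ M2]) (use D0 in simp)
  then have "linform u1 dvd linform u2 \<or> linform u1 dvd M1" by (rule prime_linform[OF u1])
  moreover have "\<not> linform u1 dvd linform u2"
  proof
    assume "linform u1 dvd linform u2"
    then have dv: "\<forall>v. dot3 u1 v = 0 \<longrightarrow> dot3 u2 v = 0" using linform_dvd_iff[OF u1, of "linform u2"] by simp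
    obtain s where s: "dot3 s (cross u1 u2) = 1" using u12(1) by (rule ex_third_vector)
    have "dot3 u2 (cross s u1) = 0" using dv by simp
    with s show False by (simp add: dot3_cross_rotate[of u2 s u1])
  qed
  ultimately have "linform u1 dvd M1" by blast
  \<comment> \<open>Both forms have degree one, so the quotient is a constant, and it is the factor
    relating \<open>H\<close> to \<open>G\<close> modulo \<open>F\<close>.\<close>
  have "\<exists>c. M1 = linform u1 * const c"
  proof (cases "M1 = 0")
    case True
    then show ?thesis by (intro exI[of _ 0]) simp
  next
    case False
    obtain A where A: "M1 = linform u1 * A" "A \<in> forms (1 - 1)"
      using form_dvd_formE[OF linform_forms M1(1) \<open>linform u1 dvd M1\<close> False] by blast
    then obtain c where "A = const c" using forms_0E[of A] by auto
    with A(1) show ?thesis by blast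
  qed
  then obtain c where c: "M1 = linform u1 * const c" by blast
  have "linform u1 * (const (- c) * G + const 1 * H) = H * linform u1 - G * M1"
    unfolding c by (simp add: right_diff_distrib ac_simps)
  also have "\<dots> = F * B1" by (simp add: M1(2))
  finally have "F dvd linform u1 * (const (- c) * G + const 1 * H)" by simp
  then have "F dvd const (- c) * G + const 1 * H"
    by (rule dvd_mult_cancel) (use u1 in \<open>intro not_dvd_small[OF linform_forms], simp_all\<close>)
  then show ?thesis by (intro exI[of _ "- c"] exI[of _ 1]) simp
qed

lemma tangent_forms_eq_multiples:
  assumes "\<And>G. G \<in> Y d \<Longrightarrow> F dvd G" "d \<ge> 3"
  shows "Y d = (*) F ` forms (d - 3)"
proof
  show "Y d \<subseteq> (*) F ` forms (d - 3)"
  proof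
    fix G assume G: "G \<in> Y d"
    then have Gd: "G \<in> forms d" by (simp add: tangent_forms_iff)
    show "G \<in> (*) F ` forms (d - 3)"
    proof (cases "G = 0")
      case False
      then obtain H where "G = F * H" "H \<in> forms (d - 3)"
        using form_dvd_formE[OF F_forms Gd assms(1)[OF G]] by blast
      then show ?thesis by blast
    qed (auto intro: image_eqI[of _ _ 0])
  qed
qed (rule F_image_subset[OF assms(2)])

lemma tangent_forms_negative_degree:
  assumes "3 * d < \<nu>" "d \<ge> 3"
  shows "Y d = (*) F ` forms (d - 3)"
proof (rule tangent_forms_eq_multiples[OF _ assms(2)])
  fix G assume "G \<in> Y d"
  with bezout[of G d] assms(1) show "F dvd G" by (auto simp: not_le[symmetric])
qed

lemma dim_multiples: "mp.dim ((*) F ` forms e) = mp.dim (forms e :: (3, 'a) mpoly set)"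
  by (rule dim_forms_shift[OF F_nonzero findim_forms])

text \<open>If some \<open>G\<close> in \<open>Y d\<close> is not a multiple of \<open>F\<close>,
  proportionality modulo \<open>F\<close> shows that \<open>G\<close> and the multiples of
  \<open>F\<close> span \<open>Y d\<close>.\<close>

lemma dim_residual_degree_one:
  assumes \<nu>: "\<nu> + 1 = 3 * d" and d: "d \<ge> 3"
  shows "mp.dim (Y d) \<le> mp.dim (forms (d - 3) :: (3, 'a) mpoly set) + 1"
proof (cases "\<forall>G\<in>Y d. F dvd G")
  case True
  then show ?thesis using tangent_forms_eq_multiples[OF _ d] dim_multiples by simp
next
  case False
  then obtain G where G: "G \<in> Y d" "\<not> F dvd G" by blast
  let ?W = "(*) F ` forms (d - 3)" and ?U = "mp.span {G}"
  have fW: "mp.findim ?W" by (intro findim_mult_image findim_forms)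
  have fU: "mp.findim ?U" unfolding mp.findim_def by auto
  have "Y d \<subseteq> {x + y |x y. x \<in> ?U \<and> y \<in> ?W}"
  proof
    fix H assume H: "H \<in> Y d"
    obtain a b where ab: "a \<noteq> 0 \<or> b \<noteq> 0" "F dvd const a * G + const b * H"
      using residual_degree_one[OF \<nu> G(1) H] by blast
    have inY: "const x * G + const y * H \<in> Y d" for x y
      using G(1) H subspace_tangent_forms[of F X T d] by (auto intro!: mp.subspace_add mp.subspace_scale)
    have "b \<noteq> 0"
    proof
      assume "b = 0"
      with ab have "a \<noteq> 0" "F dvd const a * G" by simp_all
      from this(2) have "F dvd const (1 / a) * (const a * G)" by (rule dvd_mult)
      then have "F dvd G" unfolding const_inverse_mult[OF \<open>a \<noteq> 0\<close>] .
      with G(2) show False by contradiction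
    qed
    have "F dvd const (1 / b) * (const a * G + const b * H)" using ab(2) by (rule dvd_mult)
    then have *: "F dvd const (a / b) * G + H"
      using \<open>b \<noteq> 0\<close> by (simp add: distrib_left const_divide_mult)
    have f: "const (a / b) * G + H \<in> forms d" using inY[of "a / b" 1] by (simp add: tangent_forms_iff)
    have "const (a / b) * G + H \<in> ?W"
    proof (cases "const (a / b) * G + H = 0")
      case True
      then show ?thesis by (intro image_eqI[of _ _ 0]) simp_all
    next
      case False
      with form_dvd_formE[OF F_forms f *] show ?thesis by blast
    qed
    moreover have "const (- (a / b)) * G \<in> ?U" by (intro mp.span_scale mp.span_base) simp
    moreover have "H = const (- (a / b)) * G + (const (a / b) * G + H)" by simp
    ultimately show "H \<in> {x + y |x y. x \<in> ?U \<and> y \<in> ?W}" by blast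
  qed
  then have "mp.dim (Y d) \<le> mp.dim {x + y |x y. x \<in> ?U \<and> y \<in> ?W}"
    by (rule mp.dim_subspace_le[OF mp.findim_sum[OF fU fW] subspace_tangent_forms])
  also have "\<dots> \<le> mp.dim ?U + mp.dim ?W" using mp.dim_sum_Int[OF fU fW] by linarith
  also have "mp.dim ?U \<le> 1" using mp.dim_le_card[of ?U "{G}"] by simp
  finally show ?thesis using dim_multiples by simp
qed

end

context cubic_curve
begin

lemma dim_tangent_forms_add_points:
  assumes "finite T"
  shows "mp.dim (tangent_forms F X {} d) \<le> mp.dim (tangent_forms F X T d) + card T"
proof -
  have "tangent_forms F X T d = mp.common_kernel (tangent_forms F X {} d) (\<lambda>q G. eval_mpoly G (pt q)) T"
    by (auto simp: tangent_forms_iff mp.common_kernel_def)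
  then show ?thesis
    using mp.dim_common_kernel_ge[OF findim_tangent_forms assms functional_eval, of F X "{}" d pt] by simp
qed

end

section \<open>Residual degree zero and positive residual degree\<close>

locale double_points = point_conditions F X "{}" for F :: "(3, 'k::alg_closed_field) mpoly" and X
begin

lemma with_extra_points:
  obtains T where "point_conditions F X T" "card T = k"
proof -
  obtain T where T: "T \<subseteq> curve F - X" "finite T" "card T = k"
    using ex_points_on_curve[OF X(1)] by blast
  have "point_conditions F X T" by unfold_locales (use X T in auto)
  with T(3) that show ?thesis by blast
qed

text \<open>One extra point makes the residual degree negative and lowers the dimension by at most
  one.\<close>

lemma dim_tangent_forms_zero_degree:
  assumes "2 * card X = 3 * d" "d \<ge> 3"
  shows "mp.dim (Y d) \<le> mp.dim (forms (d - 3) :: (3, 'k) mpoly set) + 1"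
proof -
  obtain T where T: "point_conditions F X T" "card T = 1" by (rule with_extra_points)
  interpret T: point_conditions F X T by (rule T(1))
  have "T.Y d = (*) F ` forms (d - 3)"
    using T.tangent_forms_negative_degree[of d] assms T(2) by simp
  then show ?thesis using dim_tangent_forms_add_points[OF T.T(1), of X d] T(2) dim_multiples by simp
qed

text \<open>Counting conditions bounds the dimension from below. For the upper bound,
  \<open>k\<close> extra simple points lower the residual degree to one, so \<open>k\<close> is the
  residual degree minus one.\<close>

lemma dim_tangent_forms_positive_degree:
  assumes "2 * card X < 3 * d" "d \<ge> 3"
  shows "mp.dim (Y d) + 2 * card X = mp.dim (forms d :: (3, 'k) mpoly set)"
proof -
  define k where "k = 3 * d - 2 * card X - 1"
  obtain T where T: "point_conditions F X T" "card T = k" by (rule with_extra_points)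
  interpret T: point_conditions F X T by (rule T(1))
  have "mp.dim (T.Y d) \<le> mp.dim (forms (d - 3) :: (3, 'k) mpoly set) + 1"
    by (rule T.dim_residual_degree_one) (use assms T(2) in \<open>simp_all add: k_def\<close>)
  moreover have "mp.dim (Y d) \<le> mp.dim (T.Y d) + k"
    using dim_tangent_forms_add_points[OF T.T(1), of X d] T(2) by simp
  ultimately show ?thesis
    using dim_tangent_forms_ge[of d] dim_forms_diff[OF assms(2), where 'k = 'k] assms(1) by (simp add: k_def)
qed

end

section \<open>Hilbert functions of double points on a cubic\<close>

text \<open>Both gradients annihilate \<open>v\<close> and \<open>w\<close>, hence are multiples of
  \<open>cross v w\<close>; that of \<open>F\<close> is a nonzero multiple.\<close>

lemma gradient_parallel:
  fixes F G :: "(3, 'k::field) mpoly"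
  assumes vw: "cross v w \<noteq> zero3" and F: "dir_deriv F v v = 0" "dir_deriv F v w = 0" "gradient F v \<noteq> zero3"
    and G: "dir_deriv G v v = 0" "dir_deriv G v w = 0"
  shows "\<exists>c. \<forall>x. dir_deriv G v x = c * dir_deriv F v x"
proof -
  have "dot3 (gradient F v) v = 0" "dot3 (gradient F v) w = 0" using F(1,2) by (simp_all add: dir_deriv_gradient)
  then obtain b where b: "gradient F v = (\<lambda>i. b * cross v w i)" by (rule annihilator_parallel[OF vw])
  have "dot3 (gradient G v) v = 0" "dot3 (gradient G v) w = 0" using G by (simp_all add: dir_deriv_gradient)
  then obtain a where a: "gradient G v = (\<lambda>i. a * cross v w i)" by (rule annihilator_parallel[OF vw])
  have "b \<noteq> 0" using F(3) b by auto
  have *: "dir_deriv F v x = b * dot3 x (cross v w)" "dir_deriv G v x = a * dot3 x (cross v w)" for x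
    unfolding dir_deriv_gradient a b dot3_commute[of _ x] by simp_all
  show ?thesis by (intro exI[of _ "a / b"] allI) (simp add: * \<open>b \<noteq> 0\<close>)
qed

context double_points
begin

abbreviation "simple_vanishing d \<equiv> forms d \<inter> ideal_of_points X"
abbreviation "double_vanishing d \<equiv> forms d \<inter> ideal_of_double_points X"

lemma subspace_simple: "mp.subspace (simple_vanishing d)"
  by (rule mp.subspace_inter[OF subspace_forms subspace_ideal_of_points])

lemma subspace_double: "mp.subspace (double_vanishing d)"
  by (rule mp.subspace_inter[OF subspace_forms subspace_ideal_of_double_points])

lemma findim_simple: "mp.findim (simple_vanishing d)"
  by (rule mp.findim_mono[OF findim_forms subspace_simple]) blast

lemma findim_double: "mp.findim (double_vanishing d)"
  by (rule mp.findim_mono[OF findim_forms subspace_double]) blast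

lemma hilbert_simple:
  "hilbert_function (ideal_of_points X) d + mp.dim (simple_vanishing d) = mp.dim (forms d :: (3, 'k) mpoly set)"
  using hilbert_function_eq[OF subspace_ideal_of_points[of X], of d]
    mp.dim_subspace_le[OF findim_forms subspace_simple, of d d] by simp

lemma hilbert_double:
  "hilbert_function (ideal_of_double_points X) d + mp.dim (double_vanishing d) = mp.dim (forms d :: (3, 'k) mpoly set)"
  using hilbert_function_eq[OF subspace_ideal_of_double_points[of X], of d]
    mp.dim_subspace_le[OF findim_forms subspace_double, of d d] by simp

lemma simple_vanishing_iff:
  "G \<in> simple_vanishing d \<longleftrightarrow> G \<in> forms d \<and> (\<forall>p\<in>X. eval_mpoly G (pt p) = 0)"
  unfolding forms_Int_ideal_of_points by simp

lemma double_vanishing_iff: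
  "G \<in> double_vanishing d \<longleftrightarrow>
     G \<in> forms d \<and> (\<forall>p\<in>X. eval_mpoly G (pt p) = 0 \<and> (\<forall>w. dir_deriv G (pt p) w = 0))"
  unfolding forms_Int_ideal_of_double_points by simp

lemma double_subset_tangent: "double_vanishing d \<subseteq> Y d"
proof
  fix G assume "G \<in> double_vanishing d"
  then show "G \<in> Y d" unfolding double_vanishing_iff tangent_forms_iff by simp
qed

lemma X_curve: "p \<in> X \<Longrightarrow> eval_mpoly F (pt p) = 0"
  using X(2) by (simp add: curve_iff)

lemma X_gradient: "p \<in> X \<Longrightarrow> gradient F (pt p) \<noteq> zero3"
  using X(2)[of p] X_curve[of p] by (simp add: singular_point_iff[OF F_forms])

text \<open>At a point of the curve the gradient of \<open>F * H\<close> is the value of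
  \<open>H\<close> times the gradient of \<open>F\<close>, which is nonzero at the points of
  \<open>X\<close>.\<close>

lemma F_mult_double_iff:
  assumes "H \<in> forms e"
  shows "F * H \<in> double_vanishing (3 + e) \<longleftrightarrow> H \<in> simple_vanishing e"
proof -
  have FH: "F * H \<in> forms (3 + e)" by (rule forms_mult[OF F_forms assms])
  have "(\<forall>w. dir_deriv F (pt p) w * eval_mpoly H (pt p) = 0) \<longleftrightarrow> eval_mpoly H (pt p) = 0" if p: "p \<in> X" for p
  proof
    obtain w where w: "dot3 w (gradient F (pt p)) = 1" using X_gradient[OF p] by (rule ex_dot3_eq_1)
    assume "\<forall>w. dir_deriv F (pt p) w * eval_mpoly H (pt p) = 0"
    then have "dir_deriv F (pt p) w * eval_mpoly H (pt p) = 0" by (rule spec)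
    with w show "eval_mpoly H (pt p) = 0" by (simp add: dir_deriv_gradient dot3_commute[of _ w])
  qed simp
  with FH assms show ?thesis
    unfolding double_vanishing_iff simple_vanishing_iff by (simp add: X_curve)
qed

lemma double_Int_multiples:
  assumes "d \<ge> 3"
  shows "double_vanishing d \<inter> (*) F ` forms (d - 3) = (*) F ` simple_vanishing (d - 3)"
proof (intro equalityI subsetI)
  fix x assume x: "x \<in> double_vanishing d \<inter> (*) F ` forms (d - 3)"
  then obtain H where H: "x = F * H" "H \<in> forms (d - 3)" by blast
  with x F_mult_double_iff[OF H(2)] assms have "H \<in> simple_vanishing (d - 3)" by simp
  with H(1) show "x \<in> (*) F ` simple_vanishing (d - 3)" by (rule image_eqI)
next
  fix x assume "x \<in> (*) F ` simple_vanishing (d - 3)"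
  then obtain H where H: "x = F * H" "H \<in> simple_vanishing (d - 3)" by (rule imageE)
  then have Hf: "H \<in> forms (d - 3)" by simp
  have "F * H \<in> (*) F ` forms (d - 3)" using Hf by (rule imageI)
  with F_mult_double_iff[OF Hf] H assms show "x \<in> double_vanishing d \<inter> (*) F ` forms (d - 3)" by simp
qed

lemma dim_F_simple: "mp.dim ((*) F ` simple_vanishing e) = mp.dim (simple_vanishing e)"
  by (rule dim_forms_shift[OF F_nonzero findim_simple])

text \<open>Every form singular along \<open>X\<close> is \<open>F * H\<close> with \<open>H\<close>
  vanishing on \<open>X\<close>. The summand \<open>3 * d\<close> is the Hilbert function of the
  cubic, the other one that of the residual scheme \<open>X\<close>.\<close>

lemma hilbert_double_negative:
  assumes "d \<ge> 3" "3 * d < 2 * card X"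
  shows "hilbert_function (ideal_of_double_points X) d = 3 * d + hilbert_function (ideal_of_points X) (d - 3)"
proof -
  have "Y d = (*) F ` forms (d - 3)" using tangent_forms_negative_degree[of d] assms by simp
  then have "double_vanishing d \<inter> (*) F ` forms (d - 3) = double_vanishing d"
    using double_subset_tangent[of d] by blast
  then have "mp.dim (double_vanishing d) = mp.dim (simple_vanishing (d - 3))"
    using double_Int_multiples[OF assms(1)] dim_F_simple[of "d - 3"] by simp
  then show ?thesis
    using hilbert_double[of d] hilbert_simple[of "d - 3"] dim_forms_diff[OF assms(1), where 'k = 'k] by linarith
qed

lemma hilbert_double_small:
  assumes "d < 3" "3 * d < 2 * card X"
  shows "hilbert_function (ideal_of_double_points X) d = mp.dim (forms d :: (3, 'k) mpoly set)"
proof -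
  have "double_vanishing d = {0}"
  proof (intro equalityI subsetI)
    fix G assume G: "G \<in> double_vanishing d"
    then have "G \<in> Y d" using double_subset_tangent by blast
    then have "F dvd G" using bezout[of G d] assms(2) by (auto simp: not_le[symmetric])
    moreover have "G \<in> forms d" using G by simp
    ultimately show "G \<in> {0}" using not_dvd_small[of G d] assms(1) by blast
  qed (use mp.subspace_0[OF subspace_double] in simp)
  with hilbert_double[of d] show ?thesis by (simp add: dim_zero_subspace)
qed

lemma separating_forms:
  assumes "hilbert_function (ideal_of_points X) e = card X" "p \<in> X"
  shows "\<exists>H. H \<in> forms e \<and> eval_mpoly H (pt p) = 1 \<and> (\<forall>q\<in>X - {p}. eval_mpoly H (pt q) = 0)"
proof -
  have ck: "mp.common_kernel (forms e) (\<lambda>p G. eval_mpoly G (pt p)) X = simple_vanishing e"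
    unfolding mp.common_kernel_def forms_Int_ideal_of_points by simp
  have "mp.dim (forms e :: (3, 'k) mpoly set) =
      mp.dim (mp.common_kernel (forms e) (\<lambda>p G. eval_mpoly G (pt p)) X) + card X"
    unfolding ck using hilbert_simple[of e] assms(1) by simp
  then obtain H where "H \<in> forms e" "eval_mpoly H (pt p) = 1" "\<And>q. q \<in> X - {p} \<Longrightarrow> eval_mpoly H (pt q) = 0"
    by (rule mp.common_kernel_separating[OF findim_forms X(1) functional_eval _ assms(2)]) blast
  then show ?thesis by blast
qed

text \<open>Vanishing along the tangent makes the gradient of \<open>G\<close> at each point
  \<open>p\<close> a multiple \<open>c p\<close> of that of \<open>F\<close>. As \<open>X\<close>
  imposes independent conditions in degree \<open>e\<close>, some form \<open>K\<close> takes the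
  values \<open>c p\<close>, and \<open>G - F * K\<close> is singular along
  \<open>X\<close>.\<close>

lemma tangent_forms_lift:
  assumes "hilbert_function (ideal_of_points X) e = card X"
  shows "Y (3 + e) = {x + y |x y. x \<in> double_vanishing (3 + e) \<and> y \<in> (*) F ` forms e}"
proof (intro equalityI subsetI)
  fix G assume G: "G \<in> Y (3 + e)"
  have Gf: "G \<in> forms (3 + e)" and G0: "\<And>p. p \<in> X \<Longrightarrow> eval_mpoly G (pt p) = 0"
    and Gt: "\<And>p. p \<in> X \<Longrightarrow> dir_deriv G (pt p) (tangent F p) = 0"
    using G by (simp_all add: tangent_forms_iff)
  have "\<forall>p\<in>X. \<exists>H. H \<in> forms e \<and> eval_mpoly H (pt p) = 1 \<and> (\<forall>q\<in>X - {p}. eval_mpoly H (pt q) = 0)"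
    using separating_forms[OF assms] by (intro ballI)
  from bchoice[OF this] obtain H where
    H: "\<forall>p\<in>X. H p \<in> forms e \<and> eval_mpoly (H p) (pt p) = 1 \<and> (\<forall>q\<in>X - {p}. eval_mpoly (H p) (pt q) = 0)"
    by (rule exE)
  have "\<forall>p\<in>X. \<exists>c. \<forall>w. dir_deriv G (pt p) w = c * dir_deriv F (pt p) w"
  proof
    fix p assume p: "p \<in> X"
    note tp = simple_point_tangent[OF X(2)[OF p]]
    have "dir_deriv F (pt p) (pt p) = 0" "dir_deriv G (pt p) (pt p) = 0"
      using dir_deriv_euler[OF F_forms] dir_deriv_euler[OF Gf] X_curve[OF p] G0[OF p] by simp_all
    from gradient_parallel[OF tp(1) this(1) tp(2) X_gradient[OF p] this(2) Gt[OF p]]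
    show "\<exists>c. \<forall>w. dir_deriv G (pt p) w = c * dir_deriv F (pt p) w" .
  qed
  from bchoice[OF this] obtain c where c: "\<forall>p\<in>X. \<forall>w. dir_deriv G (pt p) w = c p * dir_deriv F (pt p) w"
    by (rule exE)
  define K where "K = (\<Sum>p\<in>X. const (c p) * H p)"
  have K: "K \<in> forms e" unfolding K_def using H by (intro forms_sum forms_const_mult) blast
  have Kp: "eval_mpoly K (pt p) = c p" if p: "p \<in> X" for p
  proof -
    have "eval_mpoly K (pt p) = (\<Sum>q\<in>X. c q * eval_mpoly (H q) (pt p))" by (simp add: K_def)
    also have "\<dots> = (\<Sum>q\<in>X. if q = p then c p else 0)"
    proof (rule sum.cong[OF refl])
      fix q assume q: "q \<in> X"
      show "c q * eval_mpoly (H q) (pt p) = (if q = p then c p else 0)"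
      proof (cases "q = p")
        case True
        then show ?thesis using H p by simp
      next
        case False
        then have "p \<in> X - {q}" using p by simp
        then have "eval_mpoly (H q) (pt p) = 0" using H q by blast
        with False show ?thesis by simp
      qed
    qed
    also have "\<dots> = c p" using p X(1) by simp
    finally show ?thesis .
  qed
  have "G - F * K \<in> double_vanishing (3 + e)"
    unfolding double_vanishing_iff
  proof (intro conjI ballI allI)
    show "G - F * K \<in> forms (3 + e)" by (rule forms_diff[OF Gf forms_mult[OF F_forms K]])
    fix p assume p: "p \<in> X"
    show "eval_mpoly (G - F * K) (pt p) = 0" using G0[OF p] X_curve[OF p] by simp
    fix w
    have "dir_deriv G (pt p) w = c p * dir_deriv F (pt p) w" using c p by blast
    then show "dir_deriv (G - F * K) (pt p) w = 0" using X_curve[OF p] Kp[OF p] by simp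
  qed
  moreover have "F * K \<in> (*) F ` forms e" using K by (rule imageI)
  moreover have "G = (G - F * K) + F * K" by simp
  ultimately show "G \<in> {x + y |x y. x \<in> double_vanishing (3 + e) \<and> y \<in> (*) F ` forms e}" by blast
next
  fix G assume "G \<in> {x + y |x y. x \<in> double_vanishing (3 + e) \<and> y \<in> (*) F ` forms e}"
  then obtain x y where xy: "G = x + y" "x \<in> double_vanishing (3 + e)" "y \<in> (*) F ` forms e" by blast
  have "x \<in> Y (3 + e)" using xy(2) double_subset_tangent by blast
  moreover have "y \<in> Y (3 + e)" using xy(3) F_image_subset[of "3 + e"] by auto
  ultimately show "G \<in> Y (3 + e)" unfolding xy(1) by (rule mp.subspace_add[OF subspace_tangent_forms])
qed

text \<open>Inclusion-exclusion for \<open>Y d\<close> as a sum of the forms singular along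
  \<open>X\<close> and the multiples of \<open>F\<close>, whose intersection is \<open>F\<close>
  times the forms vanishing on \<open>X\<close>.\<close>

lemma hilbert_double_lift:
  assumes "d \<ge> 3" "hilbert_function (ideal_of_points X) (d - 3) = card X"
  shows "hilbert_function (ideal_of_double_points X) d + mp.dim (Y d) =
    mp.dim (forms d :: (3, 'k) mpoly set) + card X"
proof -
  let ?W = "(*) F ` forms (d - 3)"
  have fW: "mp.findim ?W" by (intro findim_mult_image findim_forms)
  have "Y d = {x + y |x y. x \<in> double_vanishing d \<and> y \<in> ?W}"
    using tangent_forms_lift[OF assms(2)] assms(1) by simp
  then have "mp.dim (Y d) + mp.dim (double_vanishing d \<inter> ?W) = mp.dim (double_vanishing d) + mp.dim ?W"
    using mp.dim_sum_Int[OF findim_double fW, of d] by simp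
  then have "mp.dim (Y d) + mp.dim (simple_vanishing (d - 3)) =
      mp.dim (double_vanishing d) + mp.dim (forms (d - 3) :: (3, 'k) mpoly set)"
    unfolding double_Int_multiples[OF assms(1)] dim_F_simple dim_multiples .
  then show ?thesis using hilbert_double[of d] hilbert_simple[of "d - 3"] assms(2) by linarith
qed

lemma hilbert_double_positive:
  assumes "d \<ge> 3" "hilbert_function (ideal_of_points X) (d - 3) = card X" "2 * card X < 3 * d"
  shows "hilbert_function (ideal_of_double_points X) d = 3 * card X"
  using hilbert_double_lift[OF assms(1,2)] dim_tangent_forms_positive_degree[OF assms(3,1)] by linarith

lemma hilbert_double_zero_degree:
  assumes "d \<ge> 3" "hilbert_function (ideal_of_points X) (d - 3) = card X" "2 * card X = 3 * d"
  shows "hilbert_function (ideal_of_double_points X) d + (if Y d = (*) F ` forms (d - 3) then 0 else 1) = 3 * card X"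
proof -
  let ?W = "(*) F ` forms (d - 3)"
  have W: "?W \<subseteq> Y d" by (rule F_image_subset[OF assms(1)])
  have sW: "mp.subspace ?W" by (intro mp.findim_subspace findim_mult_image findim_forms)
  have "mp.dim (Y d) = mp.dim (forms (d - 3) :: (3, 'k) mpoly set) + (if Y d = ?W then 0 else 1)"
  proof (cases "Y d = ?W")
    case True
    then show ?thesis using dim_multiples by simp
  next
    case False
    then have "\<not> mp.dim (Y d) \<le> mp.dim ?W"
      using mp.subspace_eq_if_dim_ge[OF findim_tangent_forms sW W] by auto
    with False dim_tangent_forms_zero_degree[OF assms(3,1)] dim_multiples[of "d - 3"] show ?thesis by simp
  qed
  with hilbert_double_lift[OF assms(1,2)] dim_forms_diff[OF assms(1), where 'k = 'k] assms(3)
  show ?thesis by linarith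
qed

end

lemma first_difference_Suc: "first_difference h (Suc d) = int (h (Suc d)) - int (h d)"
  by (simp add: first_difference_def)

lemma configuration_double_points:
  assumes "cubic_configuration t \<delta> F X"
  shows "double_points F X"
proof -
  have F: "irreducible_cubic F" and X: "X \<subseteq> curve F" "finite X"
    "smooth_curve F \<or> (\<forall>p\<in>X. \<not> singular_point F p)"
    using assms by (simp_all add: cubic_configuration_def)
  show ?thesis
  proof unfold_locales
    show "irreducible_cubic F" "finite X" by fact+
    fix p assume "p \<in> X"
    with X show "p \<in> curve F \<and> \<not> singular_point F p" by (auto simp: smooth_curve_def)
  qed simp_all
qed

lemma configuration_hilbert:
  assumes "cubic_configuration t \<delta> F X" "t \<ge> 1"
  shows "hilbert_function (ideal_of_points X) 0 = 1"
    "1 \<le> i \<Longrightarrow> i \<le> t \<Longrightarrow> hilbert_function (ideal_of_points X) i = 3 * i"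
    "i \<ge> t + 1 \<Longrightarrow> hilbert_function (ideal_of_points X) i = 3 * t + \<delta>"
proof -
  let ?h = "hilbert_function (ideal_of_points X)"
  have d0: "first_difference ?h 0 = 1" and d1: "first_difference ?h 1 = 2"
    and di: "\<And>i. 2 \<le> i \<Longrightarrow> i \<le> t \<Longrightarrow> first_difference ?h i = 3"
    and dt: "first_difference ?h (t + 1) = int \<delta>" and dl: "\<And>i. i \<ge> t + 2 \<Longrightarrow> first_difference ?h i = 0"
    using assms by (simp_all add: cubic_configuration_def \<Delta>h_reduced_def)
  show h0: "?h 0 = 1" using d0 by (simp add: first_difference_def)
  have h1: "?h 1 = 3" using d1 h0 by (simp add: first_difference_def)
  have mid: "?h i = 3 * i" if "1 \<le> i" "i \<le> t" for i
    using that
  proof (induction i rule: dec_induct)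
    case base
    show ?case using h1 by simp
  next
    case (step i)
    then show ?case using di[of "Suc i"] by (simp add: first_difference_Suc)
  qed
  show "1 \<le> i \<Longrightarrow> i \<le> t \<Longrightarrow> ?h i = 3 * i" by (rule mid)
  have ht: "?h (t + 1) = 3 * t + \<delta>"
    using dt mid[of t] assms(2) by (simp add: first_difference_Suc)
  show "i \<ge> t + 1 \<Longrightarrow> ?h i = 3 * t + \<delta>"
  proof (induction i rule: dec_induct)
    case base
    show ?case by (rule ht)
  next
    case (step i)
    then show ?case using dl[of "Suc i"] by (simp add: first_difference_Suc)
  qed
qed

text \<open>The residual degree \<open>3 d - 2 (3 t + \<delta>)\<close> equals
  \<open>\<delta> - 3 < 0\<close> at \<open>d = 2 t + \<delta> - 1\<close> and
  \<open>\<delta>\<close> at \<open>d = 2 t + \<delta>\<close>. In the negative range the formula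
  changes at \<open>d = t + 4\<close>, where \<open>d - 3\<close> exceeds \<open>t\<close> and the
  Hilbert function of \<open>X\<close> has become constant.\<close>

lemma configuration_hilbert_double:
  fixes F :: "(3, 'k::alg_closed_field) mpoly"
  assumes c: "cubic_configuration t \<delta> F X" and \<delta>: "\<delta> \<le> 2" "t + \<delta> > 5"
  defines "h \<equiv> hilbert_function (ideal_of_double_points X)"
  shows "h 0 = 1" "h 1 = 3" "h 2 = 6" "h 3 = 10"
    "4 \<le> d \<Longrightarrow> d \<le> t + 3 \<Longrightarrow> h d = 6 * d - 9"
    "t + 4 \<le> d \<Longrightarrow> d \<le> 2 * t + \<delta> - 1 \<Longrightarrow> h d = 3 * d + (3 * t + \<delta>)"
    "2 * t + 1 \<le> d \<Longrightarrow> 2 * t + \<delta> \<le> d \<Longrightarrow> h d = 9 * t + 3 * \<delta>"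
    "\<delta> = 0 \<Longrightarrow> h (2 * t) + (if tangent_forms F X {} (2 * t) = (*) F ` forms (2 * t - 3) then 0 else 1) = 9 * t"
proof -
  interpret double_points F X by (rule configuration_double_points[OF c])
  have n: "card X = 3 * t + \<delta>" using c by (simp add: cubic_configuration_def)
  have t1: "t \<ge> 1" "t \<ge> 4" using \<delta> by simp_all
  note hX = configuration_hilbert[OF c t1(1)]
  have f: "mp.dim (forms 0 :: (3, 'k) mpoly set) = 1" "mp.dim (forms 1 :: (3, 'k) mpoly set) = 3"
    "mp.dim (forms 2 :: (3, 'k) mpoly set) = 6"
    using dim_forms[of 0, where 'k = 'k] dim_forms[of 1, where 'k = 'k] dim_forms[of 2, where 'k = 'k] by simp_all
  show "h 0 = 1" "h 1 = 3" "h 2 = 6"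
    unfolding h_def using hilbert_double_small[of 0] hilbert_double_small[of 1] hilbert_double_small[of 2] n t1 f
    by simp_all
  show "h 3 = 10" unfolding h_def using hilbert_double_negative[of 3] n t1 hX(1) by simp
  show "h d = 6 * d - 9" if "4 \<le> d" "d \<le> t + 3"
    unfolding h_def using hilbert_double_negative[of d] n that hX(2)[of "d - 3"] \<delta> by simp
  show "h d = 3 * d + (3 * t + \<delta>)" if "t + 4 \<le> d" "d \<le> 2 * t + \<delta> - 1"
    unfolding h_def using hilbert_double_negative[of d] n that hX(3)[of "d - 3"] \<delta> by simp
  show "h d = 9 * t + 3 * \<delta>" if "2 * t + 1 \<le> d" "2 * t + \<delta> \<le> d"
    unfolding h_def using hilbert_double_positive[of d] n that hX(3)[of "d - 3"] \<delta> by simp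
  show "h (2 * t) + (if tangent_forms F X {} (2 * t) = (*) F ` forms (2 * t - 3) then 0 else 1) = 9 * t" if "\<delta> = 0"
    unfolding h_def using hilbert_double_zero_degree[of "2 * t"] n that hX(3)[of "2 * t - 3"] \<delta> by simp
qed

lemma configuration_first_differences:
  fixes F :: "(3, 'k::alg_closed_field) mpoly"
  assumes c: "cubic_configuration t \<delta> F X" and \<delta>: "\<delta> \<le> 2" "t + \<delta> > 5"
  shows "i \<le> 5 \<Longrightarrow> \<Delta>h_double X i = int i + 1"
    "5 \<le> i \<Longrightarrow> i \<le> t + 3 \<Longrightarrow> \<Delta>h_double X i = 6"
    "\<Delta>h_double X (t + 4) = 3 + int \<delta>"
    "t + 5 \<le> i \<Longrightarrow> i \<le> 2 * t + \<delta> - 1 \<Longrightarrow> \<Delta>h_double X i = 3"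
    "\<delta> = 1 \<or> \<delta> = 2 \<Longrightarrow> \<Delta>h_double X (2 * t + \<delta>) = 3 - int \<delta>"
    "i > 2 * t + \<delta> \<Longrightarrow> \<delta> = 1 \<or> \<delta> = 2 \<or> i \<ge> 2 * t + 2 \<Longrightarrow> \<Delta>h_double X i = 0"
    "\<delta> = 0 \<Longrightarrow> \<Delta>h_double X (2 * t) =
       (if tangent_forms F X {} (2 * t) = (*) F ` forms (2 * t - 3) then 3 else 2)"
    "\<delta> = 0 \<Longrightarrow> \<Delta>h_double X (2 * t + 1) =
       (if tangent_forms F X {} (2 * t) = (*) F ` forms (2 * t - 3) then 0 else 1)"
proof -
  let ?h = "hilbert_function (ideal_of_double_points X)"
  note h = configuration_hilbert_double[OF c \<delta>]
  have D: "\<Delta>h_double X j = int (?h j) - int (?h (j - 1))" if "j > 0" for j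
    using that by (simp add: \<Delta>h_double_def first_difference_def)
  have h4: "?h 4 = 15" "?h 5 = 21" using h(5)[of 4] h(5)[of 5] \<delta> by simp_all
  show "\<Delta>h_double X i = int i + 1" if "i \<le> 5"
  proof -
    have "i = 0 \<or> i = 1 \<or> i = 2 \<or> i = 3 \<or> i = 4 \<or> i = 5" using that by arith
    then show ?thesis
      by (elim disjE) (use D h(1-4) h4 in \<open>simp_all add: \<Delta>h_double_def first_difference_def numeral_eq_Suc\<close>)
  qed
  show "\<Delta>h_double X i = 6" if "5 \<le> i" "i \<le> t + 3"
    using D[of i] h(5)[of i] h(5)[of "i - 1"] that by simp
  have "?h (t + 4) = 3 * (t + 4) + (3 * t + \<delta>)" "?h (t + 3) = 6 * (t + 3) - 9" "t + 4 - 1 = t + 3"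
    using h(6)[of "t + 4"] h(5)[of "t + 3"] \<delta> by simp_all
  with D[of "t + 4"] show "\<Delta>h_double X (t + 4) = 3 + int \<delta>" by (simp only:) simp
  show "\<Delta>h_double X i = 3" if "t + 5 \<le> i" "i \<le> 2 * t + \<delta> - 1"
    using D[of i] h(6)[of i] h(6)[of "i - 1"] that by simp
  show "\<Delta>h_double X (2 * t + \<delta>) = 3 - int \<delta>" if "\<delta> = 1 \<or> \<delta> = 2"
    using D[of "2 * t + \<delta>"] h(7)[of "2 * t + \<delta>"] h(6)[of "2 * t + \<delta> - 1"] that \<delta> by auto
  show "\<Delta>h_double X i = 0" if "i > 2 * t + \<delta>" "\<delta> = 1 \<or> \<delta> = 2 \<or> i \<ge> 2 * t + 2"
    using D[of i] h(7)[of i] h(7)[of "i - 1"] that by auto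
  show "\<Delta>h_double X (2 * t) = (if tangent_forms F X {} (2 * t) = (*) F ` forms (2 * t - 3) then 3 else 2)" if "\<delta> = 0"
    using D[of "2 * t"] h(8) h(6)[of "2 * t - 1"] that \<delta> by (auto split: if_splits)
  show "\<Delta>h_double X (2 * t + 1) = (if tangent_forms F X {} (2 * t) = (*) F ` forms (2 * t - 3) then 0 else 1)" if "\<delta> = 0"
    using D[of "2 * t + 1"] h(8) h(7)[of "2 * t + 1"] that \<delta> by (auto split: if_splits)
qed

section \<open>A criterion for configurations of complete-intersection size\<close>

context cubic_curve
begin

lemma dim_tangent_forms_add_simple_points:
  assumes "finite S"
  shows "mp.dim (tangent_forms F X T d) \<le> mp.dim (tangent_forms F X (T \<union> S) d) + card S"
proof -
  have "tangent_forms F X (T \<union> S) d = mp.common_kernel (tangent_forms F X T d) (\<lambda>q G. eval_mpoly G (pt q)) S"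
    by (auto simp: tangent_forms_iff mp.common_kernel_def)
  then show ?thesis
    using mp.dim_common_kernel_ge[OF findim_tangent_forms assms functional_eval, of F X T d pt] by simp
qed

text \<open>The points are imposed as simple conditions. Only multiples of \<open>F\<close> vanish
  on \<open>X\<close> in degrees below \<open>t\<close> by Bezout, and in degree \<open>t\<close> by
  hypothesis; above \<open>t\<close> the residual degree is positive and \<open>X\<close> imposes
  independent conditions.\<close>

lemma configuration_if_not_complete_intersection:
  assumes X: "finite X" "\<And>p. p \<in> X \<Longrightarrow> simple_point p" "card X = 3 * t" and t: "t \<ge> 3"
    and ci: "\<And>G. G \<in> forms t \<Longrightarrow> \<forall>p\<in>X. eval_mpoly G (pt p) = 0 \<Longrightarrow> F dvd G"
  shows "cubic_configuration t 0 F X"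
proof -
  interpret D: double_points F X by unfold_locales (use X in auto)
  interpret P: point_conditions F "{}" X by unfold_locales (use X in auto)
  let ?h = "hilbert_function (ideal_of_points X)"
  have sv: "D.simple_vanishing d = P.Y d" for d
    unfolding forms_Int_ideal_of_points by (auto simp: tangent_forms_iff)
  have h: "?h d + mp.dim (P.Y d) = mp.dim (forms d :: (3, 'k) mpoly set)" for d
    using D.hilbert_simple[of d] unfolding sv .
  have mult: "?h d = 3 * d" if "P.Y d = (*) F ` forms (d - 3)" "d \<ge> 3" for d
    using h[of d] that dim_forms_diff[OF that(2), where 'k = 'k] P.dim_multiples[of "d - 3"] by simp
  have small: "?h d = mp.dim (forms d :: (3, 'k) mpoly set)" if d: "d < 3" for d
  proof -
    have "P.Y d = {0}"
    proof (intro equalityI subsetI)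
      fix G assume G: "G \<in> P.Y d"
      have "F dvd G" using P.bezout[OF G] X(3) t d by (auto simp: not_le[symmetric])
      moreover have "G \<in> forms d" using G by (simp add: tangent_forms_iff)
      ultimately show "G \<in> {0}" using not_dvd_small[of G d] d by blast
    qed (use mp.subspace_0[OF subspace_tangent_forms] in simp)
    with h[of d] show ?thesis by (simp add: dim_zero_subspace)
  qed
  have h012: "?h 0 = 1" "?h 1 = 3" "?h 2 = 6"
    using small[of 0] small[of 1] small[of 2] dim_forms[of 0, where 'k = 'k] dim_forms[of 1, where 'k = 'k]
      dim_forms[of 2, where 'k = 'k] by simp_all
  have mid: "?h d = 3 * d" if "1 \<le> d" "d \<le> t" for d
  proof -
    have "d = 1 \<or> d = 2 \<or> 3 \<le> d \<and> d < t \<or> 3 \<le> d \<and> d = t" using that by arith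
    then consider "d = 1" | "d = 2" | "3 \<le> d" "d < t" | "3 \<le> d" "d = t" by blast
    then show ?thesis
    proof cases
      case 3
      then show ?thesis using P.tangent_forms_negative_degree[of d] X(3) by (intro mult) simp_all
    next
      case 4
      have "P.Y d = (*) F ` forms (d - 3)"
        by (rule P.tangent_forms_eq_multiples[OF _ 4(1)]) (use ci 4(2) in \<open>simp add: tangent_forms_iff\<close>)
      then show ?thesis using 4(1) by (rule mult)
    qed (use h012 in simp_all)
  qed
  have large: "?h d = 3 * t" if d: "d \<ge> t + 1" for d
  proof -
    have d3: "d \<ge> 3" using d t by simp
    \<comment> \<open>With these extra points the residual degree in degree \<open>d\<close> is
      one.\<close>
    obtain S where S: "S \<subseteq> curve F - X" "finite S" "card S = 3 * d - 3 * t - 1"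
      using ex_points_on_curve[OF X(1)] by blast
    interpret S: point_conditions F "{}" "X \<union> S" by unfold_locales (use X S in auto)
    have "card (X \<union> S) = 3 * t + (3 * d - 3 * t - 1)"
      using S X by (subst card_Un_disjoint) auto
    then have "mp.dim (S.Y d) \<le> mp.dim (forms (d - 3) :: (3, 'k) mpoly set) + 1"
      using d d3 by (intro S.dim_residual_degree_one) simp_all
    with dim_tangent_forms_add_simple_points[OF S(2), of "{}" X d] S(3) h[of d]
      P.dim_tangent_forms_ge[of d] dim_forms_diff[OF d3, where 'k = 'k] X(3) d
    show ?thesis by simp
  qed
  have "\<Delta>h_reduced X 0 = 1" "\<Delta>h_reduced X 1 = 2"
    using h012 by (simp_all add: \<Delta>h_reduced_def first_difference_def)
  moreover have "\<Delta>h_reduced X i = 3" if "2 \<le> i" "i \<le> t" for i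
    using mid[of i] mid[of "i - 1"] that by (simp add: \<Delta>h_reduced_def first_difference_def)
  moreover have "\<Delta>h_reduced X (t + 1) = 0"
    using mid[of t] large[of "t + 1"] t by (simp add: \<Delta>h_reduced_def first_difference_def)
  moreover have "\<Delta>h_reduced X i = 0" if "t + 2 \<le> i" for i
    using large[of i] large[of "i - 1"] that by (simp add: \<Delta>h_reduced_def first_difference_def)
  moreover have "X \<subseteq> curve F" "\<forall>p\<in>X. \<not> singular_point F p" using X(2) by auto
  ultimately show ?thesis using cubic X by (simp add: cubic_configuration_def)
qed

end

section \<open>Rational cubics with a node or a cusp\<close>

text \<open>The curve is parametrized by \<open>s \<mapsto> (s\<^sup>2 + \<epsilon>s, s\<^sup>3 + \<epsilon>s\<^sup>2, 1)\<close>; the parameters \<open>0\<close> and \<open>-\<epsilon>\<close> both give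
  the singular point, a node if \<open>\<epsilon> \<noteq> 0\<close> and a cusp if \<open>\<epsilon> = 0\<close>.\<close>

definition singular_cubic :: "'k::field \<Rightarrow> (3, 'k) mpoly" where
  "singular_cubic \<epsilon> = Var 2 * Var 2 * Var 3 + const \<epsilon> * (Var 1 * Var 2 * Var 3) - Var 1 * Var 1 * Var 1"

definition param :: "'k::field \<Rightarrow> 'k \<Rightarrow> 3 \<Rightarrow> 'k" where
  "param \<epsilon> s = vec3 (s * s + \<epsilon> * s) (s * (s * s + \<epsilon> * s)) 1"

definition param_deriv :: "'k::field \<Rightarrow> 'k \<Rightarrow> 3 \<Rightarrow> 'k" where
  "param_deriv \<epsilon> s = vec3 (2 * s + \<epsilon>) (3 * s * s + 2 * \<epsilon> * s) 0"

definition pullback :: "'k::field \<Rightarrow> (3, 'k) mpoly \<Rightarrow> 'k poly" where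
  "pullback \<epsilon> = mhom (\<lambda>a. [:a:]) (vec3 [:0, \<epsilon>, 1:] [:0, 0, \<epsilon>, 1:] 1)"

lemma singular_cubic_forms: "singular_cubic \<epsilon> \<in> forms 3"
  unfolding singular_cubic_def
  by (intro forms_add forms_diff forms_const_mult forms_mult'[OF forms_mult[OF forms_Var forms_Var] forms_Var]) simp_all

lemma to_poly3_Var:
  "to_poly3 (Var 1) = [:[:[:0, 1:]:]:]" "to_poly3 (Var 2) = [:[:0, 1:]:]" "to_poly3 (Var 3) = [:0, 1:]"
  "to_poly3 (const a) = [:[:[:a:]:]:]"
  unfolding to_poly3_def
  by (simp_all add: mhom_Var[OF comm_ring_hom_pCons3] mhom_const[OF comm_ring_hom_pCons3])

lemma to_poly3_singular_cubic:
  "to_poly3 (singular_cubic \<epsilon>) = [:[:- [:0, 0, 0, 1:]:], [:0, [:0, \<epsilon>:], 1:]:]"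
  unfolding singular_cubic_def to_poly3.hom_add to_poly3.hom_mult to_poly3.hom_minus to_poly3_Var by simp

lemma one_eq_const_mult:
  fixes a b :: "'r::comm_ring_1" assumes "1 = a * b" shows "1 = [:a:] * [:b:]"
proof -
  have "[:a:] * [:b:] = [:a * b:]" by simp
  also have "\<dots> = [:1:]" by (simp only: assms[symmetric])
  also have "\<dots> = 1" by (rule one_pCons[symmetric])
  finally show ?thesis by (rule sym)
qed

text \<open>A factor free of the outermost variable divides both coefficients. Dividing the cube of
  the first variable, it involves no second variable; dividing a polynomial monic in the second
  variable, it is a unit.\<close>

lemma linear_poly_factor_unit:
  fixes a :: "'k::field poly poly"
  assumes "[:[:- [:0, 0, 0, 1:]:], [:0, [:0, \<epsilon>:], 1:]:] = [:a:] * q"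
  shows "a dvd 1"
proof -
  have q: "[:- [:0, 0, 0, 1:]:] = a * coeff q 0" "[:0, [:0, \<epsilon>:], 1:] = a * coeff q 1"
    using arg_cong[OF assms, of "\<lambda>p. coeff p 0"] arg_cong[OF assms, of "\<lambda>p. coeff p 1"] by simp_all
  have "a * coeff q 0 \<noteq> 0" unfolding q(1)[symmetric] by simp
  then have "degree a + degree (coeff q 0) = degree (a * coeff q 0)" by (simp add: degree_mult_eq)
  also have "\<dots> = 0" unfolding q(1)[symmetric] by simp
  finally have "degree a = 0" by simp
  then obtain b where b: "a = [:b:]" by (rule degree_eq_zeroE)
  have "1 = b * coeff (coeff q 1) 2"
    using arg_cong[OF q(2), of "\<lambda>p. coeff p 2"] by (simp add: b numeral_2_eq_2)
  then have "b dvd 1" by (rule dvdI)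
  then obtain c where "1 = b * c" by (rule dvdE)
  then have "1 = a * [:c:]" unfolding b by (rule one_eq_const_mult)
  then show ?thesis by (rule dvdI)
qed

text \<open>The cubic is linear in its third variable, so one of two factors does not involve that
  variable.\<close>

lemma irreducible_singular_cubic: "irreducible_cubic (singular_cubic \<epsilon>)"
  unfolding irreducible_cubic_def
proof (intro conjI singular_cubic_forms irreducibleI)
  let ?F = "singular_cubic \<epsilon>" and ?P = "[:[:- [:0, 0, 0, 1:]:], [:0, [:0, \<epsilon>:], 1:]:]"
  have u: "to_poly3 G dvd 1 \<longleftrightarrow> G dvd 1" for G :: "(3, 'a) mpoly"
    using to_poly3_dvd[of G 1] by (simp add: to_poly3.hom_one)
  show "?F \<noteq> 0" using to_poly3_singular_cubic[of \<epsilon>] by (auto simp: to_poly3.hom_zero)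
  show "\<not> ?F dvd 1"
  proof
    assume "?F dvd 1"
    then have "?P dvd 1" using u[of ?F] to_poly3_singular_cubic[of \<epsilon>] by simp
    then have "degree ?P \<le> degree (1 :: 'a poly poly poly)" by (rule dvd_imp_degree_le) simp
    then show False by simp
  qed
  fix A B assume AB: "?F = A * B"
  have P: "?P = to_poly3 A * to_poly3 B" using to_poly3_singular_cubic[of \<epsilon>] by (simp add: AB to_poly3.hom_mult)
  have ne: "to_poly3 A \<noteq> 0" "to_poly3 B \<noteq> 0" using P by auto
  have "degree (to_poly3 A) + degree (to_poly3 B) = degree ?P"
    unfolding P using ne by (simp add: degree_mult_eq)
  then have "degree (to_poly3 A) = 0 \<or> degree (to_poly3 B) = 0" by auto
  then show "A dvd 1 \<or> B dvd 1"
  proof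
    assume "degree (to_poly3 A) = 0"
    then obtain a where a: "to_poly3 A = [:a:]" by (rule degree_eq_zeroE)
    then have "a dvd 1" using P by (intro linear_poly_factor_unit[of \<epsilon> a "to_poly3 B"]) simp
    then obtain b where "1 = a * b" by (rule dvdE)
    then have "1 = to_poly3 A * [:b:]" unfolding a by (rule one_eq_const_mult)
    then have "to_poly3 A dvd 1" by (rule dvdI)
    then show ?thesis by (simp add: u)
  next
    assume "degree (to_poly3 B) = 0"
    then obtain a where a: "to_poly3 B = [:a:]" by (rule degree_eq_zeroE)
    then have "a dvd 1" using P by (intro linear_poly_factor_unit[of \<epsilon> a "to_poly3 A"]) (simp add: mult.commute)
    then obtain b where "1 = a * b" by (rule dvdE)
    then have "1 = to_poly3 B * [:b:]" unfolding a by (rule one_eq_const_mult)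
    then have "to_poly3 B dvd 1" by (rule dvdI)
    then show ?thesis by (simp add: u)
  qed
qed

lemma pullback_simps [simp]:
  "pullback \<epsilon> (A + B) = pullback \<epsilon> A + pullback \<epsilon> B" "pullback \<epsilon> (A * B) = pullback \<epsilon> A * pullback \<epsilon> B"
  "pullback \<epsilon> (const a) = [:a:]" "pullback \<epsilon> (Var i) = vec3 [:0, \<epsilon>, 1:] [:0, 0, \<epsilon>, 1:] 1 i"
  "pullback \<epsilon> 0 = 0"
  unfolding pullback_def
  by (simp_all add: mhom_add[OF comm_ring_hom_pCons] mhom_mult[OF comm_ring_hom_pCons]
      mhom_const[OF comm_ring_hom_pCons] mhom_Var[OF comm_ring_hom_pCons] mhom_0[OF comm_ring_hom_pCons])

lemma pullback_power [simp]: "pullback \<epsilon> (A ^ n) = pullback \<epsilon> A ^ n"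
proof (induction n)
  case 0
  show ?case using pullback_simps(3)[of \<epsilon> 1] by simp
qed simp

lemma poly_pullback: "poly (pullback \<epsilon> G) s = eval_mpoly G (param \<epsilon> s)"
proof (induction G rule: mpoly_generated)
  case (Var i)
  show ?case using cases_3[of i] by (auto simp: param_def algebra_simps)
qed simp_all

lemma pderiv_pullback: "poly (pderiv (pullback \<epsilon> G)) s = dir_deriv G (param \<epsilon> s) (param_deriv \<epsilon> s)"
proof (induction G rule: mpoly_generated)
  case (Var i)
  show ?case using cases_3[of i] by (auto simp: param_deriv_def pderiv_pCons algebra_simps)
qed (simp_all add: pderiv_add pderiv_mult pderiv_pCons poly_pullback algebra_simps)

lemma degree_pullback_Var: "degree (pullback \<epsilon> (Var i)) \<le> 3"
  using cases_3[of i] by (auto simp: numeral_3_eq_3)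

lemma degree_pullback:
  assumes "G \<in> forms d" shows "degree (pullback \<epsilon> G) \<le> 3 * d"
  using assms
proof (induction d arbitrary: G)
  case 0
  then obtain c where "G = const c" using forms_0E by blast
  then show ?case by simp
next
  case (Suc d)
  obtain H where H: "\<And>j. H j \<in> forms d" "G = (\<Sum>j\<in>UNIV. Var j * H j)"
    using forms_Suc_decomp[OF Suc.prems] by blast
  have "degree (pullback \<epsilon> (Var j * H j)) \<le> 3 * Suc d" for j
  proof -
    have "degree (pullback \<epsilon> (Var j * H j)) \<le> degree (pullback \<epsilon> (Var j)) + degree (pullback \<epsilon> (H j))"
      unfolding pullback_simps(2) by (rule degree_mult_le)
    also have "\<dots> \<le> 3 + 3 * d" by (rule add_mono[OF degree_pullback_Var Suc.IH[OF H(1)]])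
    finally show ?thesis by simp
  qed
  then show ?case unfolding H(2) sum_UNIV_3 pullback_simps(1) by (intro degree_add_le)
qed

abbreviation singular_modulus :: "'k::field \<Rightarrow> 'k poly" where
  "singular_modulus \<epsilon> \<equiv> [:0, \<epsilon>, 1:]"

text \<open>These polynomials are the functions on the parameter line that descend to the curve.\<close>

definition descends :: "'k::field \<Rightarrow> 'k poly \<Rightarrow> bool" where
  "descends \<epsilon> p \<longleftrightarrow> (\<exists>c q. p = [:c:] + singular_modulus \<epsilon> * q)"

lemma descends_add: "descends \<epsilon> p \<Longrightarrow> descends \<epsilon> q \<Longrightarrow> descends \<epsilon> (p + q)"
proof -
  assume "descends \<epsilon> p" "descends \<epsilon> q"
  then obtain a p' b q' where *: "p = [:a:] + singular_modulus \<epsilon> * p'" "q = [:b:] + singular_modulus \<epsilon> * q'"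
    unfolding descends_def by blast
  have "p + q = ([:a:] + [:b:]) + singular_modulus \<epsilon> * (p' + q')"
    unfolding * by (simp only: distrib_left distrib_right ac_simps)
  also have "[:a:] + [:b:] = [:a + b:]" by simp
  finally have "p + q = [:a + b:] + singular_modulus \<epsilon> * (p' + q')" .
  then show ?thesis unfolding descends_def by blast
qed

lemma descends_const: "descends \<epsilon> [:c:]"
  unfolding descends_def by (intro exI[of _ c] exI[of _ 0]) simp

lemma descends_multiple: "descends \<epsilon> (singular_modulus \<epsilon> * q)"
  unfolding descends_def by (intro exI[of _ 0] exI[of _ q]) simp

lemma descends_mult: "descends \<epsilon> p \<Longrightarrow> descends \<epsilon> q \<Longrightarrow> descends \<epsilon> (p * q)"
proof -
  assume "descends \<epsilon> p" "descends \<epsilon> q"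
  then obtain a p' b q' where *: "p = [:a:] + singular_modulus \<epsilon> * p'" "q = [:b:] + singular_modulus \<epsilon> * q'"
    unfolding descends_def by blast
  have "p * q = [:a:] * [:b:] + singular_modulus \<epsilon> * (p' * [:b:] + [:a:] * q' + p' * (singular_modulus \<epsilon> * q'))"
    unfolding * by (simp only: distrib_left distrib_right ac_simps)
  also have "[:a:] * [:b:] = [:a * b:]" by simp
  finally have "p * q = [:a * b:] + singular_modulus \<epsilon> * (p' * [:b:] + [:a:] * q' + p' * (singular_modulus \<epsilon> * q'))" .
  then show ?thesis unfolding descends_def by blast
qed

lemma descends_smult: "descends \<epsilon> p \<Longrightarrow> descends \<epsilon> (smult c p)"
  using descends_mult[OF descends_const, of \<epsilon> p c] by simp

lemma descends_pullback: "descends \<epsilon> (pullback \<epsilon> G)"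
proof (induction G rule: mpoly_generated)
  case (Var i)
  have "descends \<epsilon> 1" using descends_const[of \<epsilon> 1] by simp
  moreover have "descends \<epsilon> [:0, \<epsilon>, 1:]" using descends_multiple[of \<epsilon> 1] by simp
  moreover have "descends \<epsilon> [:0, 0, \<epsilon>, 1:]" using descends_multiple[of \<epsilon> "[:0, 1:]"] by simp
  ultimately show ?case using cases_3[of i] by auto
qed (simp_all add: descends_add descends_mult descends_const)

text \<open>The pullbacks of the first two variables have degrees \<open>2\<close> and
  \<open>3\<close>. These generate all positive degrees except \<open>1\<close>, which is never the
  degree of a polynomial that descends.\<close>

lemma ex_two_three_sum:
  fixes m d :: nat
  assumes "m \<ge> 2" "m \<le> 3 * d"
  shows "\<exists>a b. 2 * a + 3 * b = m \<and> a + b \<le> d"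
proof -
  have m: "m = 3 * (m div 3) + m mod 3" by simp
  have "m mod 3 < 3" by simp
  then have "m mod 3 = 0 \<or> m mod 3 = 1 \<or> m mod 3 = 2" by arith
  then show ?thesis
  proof (elim disjE)
    assume "m mod 3 = 0"
    with m assms show ?thesis by (intro exI[of _ 0] exI[of _ "m div 3"]) linarith
  next
    assume "m mod 3 = 1"
    with m assms show ?thesis by (intro exI[of _ 2] exI[of _ "m div 3 - 1"]) linarith
  next
    assume "m mod 3 = 2"
    with m assms show ?thesis by (intro exI[of _ 1] exI[of _ "m div 3"]) linarith
  qed
qed

text \<open>Leading terms are removed one at a time by the monomials \<open>?M\<close>, whose
  pullbacks are monic of degree \<open>2 * a + 3 * b\<close> and themselves descend.\<close>

lemma pullback_surj:
  assumes "descends \<epsilon> p" "degree p \<le> 3 * d"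
  shows "\<exists>G\<in>forms d. pullback \<epsilon> G = p"
  using assms
proof (induction "degree p" arbitrary: p rule: less_induct)
  case less
  show ?case
  proof (cases "degree p = 0")
    case True
    then obtain c where c: "p = [:c:]" by (rule degree_eq_zeroE)
    have "const c * Var 3 ^ d \<in> forms d" using forms_power[OF forms_Var, of 3 d] by (intro forms_const_mult) simp
    then show ?thesis by (intro bexI[of _ "const c * Var 3 ^ d"]) (simp_all add: c)
  next
    case False
    obtain c q where cq: "p = [:c:] + singular_modulus \<epsilon> * q" using less.prems(1) unfolding descends_def by blast
    have "degree p \<noteq> 1"
    proof
      assume d1: "degree p = 1"
      have "q \<noteq> 0" using cq False by auto
      then have "degree (singular_modulus \<epsilon> * q) = 2 + degree q" by (subst degree_mult_eq) (auto simp: numeral_2_eq_2)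
      then have "degree p = 2 + degree q" unfolding cq by (subst degree_add_eq_right) auto
      with d1 show False by simp
    qed
    with False have m: "degree p \<ge> 2" by simp
    obtain a b where ab: "2 * a + 3 * b = degree p" "a + b \<le> d"
      using ex_two_three_sum[OF m less.prems(2)] by blast
    let ?M = "Var 1 ^ a * Var 2 ^ b * Var 3 ^ (d - a - b) :: (3, 'a) mpoly"
    have M: "?M \<in> forms d"
      using forms_mult[OF forms_mult[OF forms_power[OF forms_Var, of 1 a] forms_power[OF forms_Var, of 2 b]]
        forms_power[OF forms_Var, of 3 "d - a - b"]] ab(2) by simp
    have pM: "pullback \<epsilon> ?M = [:0, \<epsilon>, 1:] ^ a * [:0, 0, \<epsilon>, 1:] ^ b" by simp
    have dM: "degree (pullback \<epsilon> ?M) = degree p"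
      unfolding pM by (subst degree_mult_eq) (simp_all add: degree_power_eq ab(1)[symmetric])
    have lM: "lead_coeff (pullback \<epsilon> ?M) = 1"
      unfolding pM by (simp add: lead_coeff_mult lead_coeff_power)
    let ?p = "p + smult (- lead_coeff p) (pullback \<epsilon> ?M)"
    have "coeff ?p (degree p) = 0" using lM dM by simp
    moreover have "degree ?p \<le> degree p"
      by (rule degree_add_le) (use dM in \<open>auto intro: order.trans[OF degree_smult_le]\<close>)
    ultimately have deg: "degree ?p < degree p"
      using m by (metis degree_0 leading_coeff_0_iff le_neq_implies_less not_numeral_le_zero)
    have "descends \<epsilon> ?p" by (intro descends_add descends_smult less.prems(1) descends_pullback)
    from less.hyps[OF deg this] deg less.prems(2) obtain G where G: "G \<in> forms d" "pullback \<epsilon> G = ?p" by auto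
    show ?thesis
    proof (rule bexI)
      show "G + const (lead_coeff p) * ?M \<in> forms d" using G(1) M by (intro forms_add forms_const_mult)
      show "pullback \<epsilon> (G + const (lead_coeff p) * ?M) = p" using G(2) by simp
    qed
  qed
qed

section \<open>Configurations on rational cubics\<close>

lemma prod_linear_dvd:
  fixes p :: "'k::field poly"
  assumes "finite A" "\<And>s. s \<in> A \<Longrightarrow> poly p s = 0"
  shows "(\<Prod>s\<in>A. [:- s, 1:]) dvd p"
  using assms
proof (induction A arbitrary: p rule: finite_induct)
  case (insert a A)
  then obtain q where q: "p = [:- a, 1:] * q" using poly_eq_0_iff_dvd[of p a] by (auto elim: dvdE)
  have "poly q s = 0" if "s \<in> A" for s
  proof -
    have "(s - a) * poly q s = 0" using insert.prems[of s] that by (simp add: q algebra_simps)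
    moreover have "s \<noteq> a" using insert.hyps that by auto
    ultimately show ?thesis by simp
  qed
  then have "(\<Prod>s\<in>A. [:- s, 1:]) dvd q" by (rule insert.IH)
  then show ?case unfolding q using insert.hyps by (simp add: mult_dvd_mono del: mult_pCons_left)
qed simp

lemma prod_linear_square_dvd:
  fixes p :: "'k::field poly"
  assumes "finite A" "\<And>s. s \<in> A \<Longrightarrow> poly p s = 0 \<and> poly (pderiv p) s = 0"
  shows "(\<Prod>s\<in>A. [:- s, 1:]) * (\<Prod>s\<in>A. [:- s, 1:]) dvd p"
  using assms
proof (induction A arbitrary: p rule: finite_induct)
  case (insert a A)
  then obtain r where r: "p = [:- a, 1:] * r" using poly_eq_0_iff_dvd[of p a] by (auto elim: dvdE)
  have pd: "poly (pderiv ([:- b, 1:] * r)) s = (s - b) * poly (pderiv r) s + poly r s" for b s :: 'k and r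
  proof -
    have "pderiv [:- b, 1:] = 1" by (simp add: pderiv_pCons)
    then show ?thesis by (simp only: pderiv_mult poly_add poly_mult poly_1) simp
  qed
  have "poly r a = 0" using insert.prems[of a] pd[of a r a] by (simp add: r del: mult_pCons_left)
  then obtain q where q: "r = [:- a, 1:] * q" using poly_eq_0_iff_dvd[of r a] by (auto elim: dvdE)
  have "poly q s = 0 \<and> poly (pderiv q) s = 0" if s: "s \<in> A" for s
  proof -
    have ne: "s - a \<noteq> 0" using insert.hyps s by auto
    have ps: "poly p s = (s - a) * ((s - a) * poly q s)" by (simp add: r q algebra_simps)
    with insert.prems[of s] s ne have q0: "poly q s = 0" by simp
    have "poly (pderiv p) s = (s - a) * ((s - a) * poly (pderiv q) s + poly q s) + (s - a) * poly q s"
      unfolding r pd unfolding q pd by (simp add: algebra_simps)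
    with insert.prems[of s] s ne q0 show ?thesis by simp
  qed
  then have "(\<Prod>s\<in>A. [:- s, 1:]) * (\<Prod>s\<in>A. [:- s, 1:]) dvd q" by (rule insert.IH)
  then have "[:- a, 1:] * ([:- a, 1:] * ((\<Prod>s\<in>A. [:- s, 1:]) * (\<Prod>s\<in>A. [:- s, 1:]))) dvd p"
    unfolding r q by (intro mult_dvd_mono dvd_refl)
  then show ?case using insert.hyps by (simp add: ac_simps del: mult_pCons_left mult_pCons_right)
qed simp

text \<open>The condition on \<open>A\<close> excludes the parameters of the singular point.\<close>

locale rational_configuration =
  fixes \<epsilon> :: "'k::alg_closed_field" and A :: "'k set" and t :: nat
  assumes A: "finite A" "card A = 3 * t" "\<And>s. s \<in> A \<Longrightarrow> s * s + \<epsilon> * s \<noteq> 0" and t: "t \<ge> 6"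
begin

definition "P = (\<Prod>s\<in>A. [:- s, 1:])"
definition "pnt s = proj (param \<epsilon> s)"
definition "X = pnt ` A"

sublocale cubic_curve "singular_cubic \<epsilon>"
  by unfold_locales (rule irreducible_singular_cubic)

abbreviation "F \<equiv> singular_cubic \<epsilon>"

lemma degree_P: "degree P = 3 * t" and P_nonzero: "P \<noteq> 0"
proof -
  have "degree P = (\<Sum>s\<in>A. degree [:- s, 1:])" unfolding P_def by (rule degree_prod_eq_sum_degree) simp
  then show "degree P = 3 * t" using A by simp
  show "P \<noteq> 0" unfolding P_def using A(1) by (simp add: prod_zero_iff)
qed

lemma param_nonzero: "param \<epsilon> s \<noteq> zero3"
proof
  assume "param \<epsilon> s = zero3"
  from fun_cong[OF this, of 3] show False by (simp add: param_def)
qed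

lemma pullback_F: "pullback \<epsilon> F = 0"
proof (rule poly_eq_0_if_vanishes)
  fix s show "poly (pullback \<epsilon> F) s = 0"
    unfolding poly_pullback by (simp add: singular_cubic_def param_def algebra_simps)
qed

lemma eval_pnt: "G \<in> forms d \<Longrightarrow> eval_mpoly G (pt (pnt s)) = 0 \<longleftrightarrow> poly (pullback \<epsilon> G) s = 0"
  unfolding pnt_def poly_pullback by (rule eval_proj_iff[OF _ param_nonzero])

lemma dir_deriv_pnt:
  assumes "G \<in> forms d"
  shows "dir_deriv G (pt (pnt s)) w = 0 \<longleftrightarrow> dir_deriv G (param \<epsilon> s) w = 0"
proof -
  obtain c where c: "c \<noteq> 0" "pt (pnt s) = (\<lambda>j. c * param \<epsilon> s j)"
    unfolding pnt_def by (rule pt_proj[OF param_nonzero])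
  have "c * dir_deriv G (pt (pnt s)) w = c ^ d * dir_deriv G (param \<epsilon> s) w"
    unfolding c(2) by (rule dir_deriv_homogeneous[OF assms])
  with c(1) show ?thesis by (metis mult_eq_0_iff power_eq_0_iff)
qed

lemma simple_pnt:
  assumes "s \<in> A" shows "simple_point (pnt s)"
proof
  have "poly (pullback \<epsilon> F) s = 0" by (simp add: pullback_F)
  then show "pnt s \<in> curve F" by (simp add: curve_iff eval_pnt[OF F_forms])
  \<comment> \<open>At a parametrized point this derivative is the cube of the first
    coordinate.\<close>
  have "dir_deriv F (param \<epsilon> s) (vec3 0 0 1) = (s * s + \<epsilon> * s) * ((s * s + \<epsilon> * s) * (s * s + \<epsilon> * s))"
    by (simp add: singular_cubic_def param_def algebra_simps)
  then have "dir_deriv F (param \<epsilon> s) (vec3 0 0 1) \<noteq> 0" using A(3)[OF assms] by simp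
  then have "dir_deriv F (pt (pnt s)) (vec3 0 0 1) \<noteq> 0" by (simp add: dir_deriv_pnt[OF F_forms])
  then have "gradient F (pt (pnt s)) \<noteq> zero3" by (auto simp: dir_deriv_gradient)
  then show "\<not> singular_point F (pnt s)" by (simp add: singular_point_iff[OF F_forms])
qed

lemma inj_pnt: "inj_on pnt A"
proof (rule inj_onI)
  fix s s' assume s: "s \<in> A" "s' \<in> A" "pnt s = pnt s'"
  then have "represents (\<chi> j. param \<epsilon> s' j) (pnt s)" unfolding pnt_def by (simp only: represents_proj[OF param_nonzero])
  with represents_proj[OF param_nonzero] have "\<exists>c. param \<epsilon> s' = (\<lambda>j. c * param \<epsilon> s j)"
    unfolding pnt_def by (rule represents_unique_fun)
  then obtain c where c: "param \<epsilon> s' = (\<lambda>j. c * param \<epsilon> s j)" by (rule exE)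
  from fun_cong[OF c, of 3] have "c = 1" by (simp add: param_def)
  with fun_cong[OF c, of 1] fun_cong[OF c, of 2]
  have "s' * s' + \<epsilon> * s' = s * s + \<epsilon> * s" "s' * (s' * s' + \<epsilon> * s') = s * (s * s + \<epsilon> * s)" by (simp_all add: param_def)
  with A(3)[OF s(1)] show "s = s'" by simp
qed

lemma X_properties: "finite X" "card X = 3 * t" "p \<in> X \<Longrightarrow> simple_point p"
  unfolding X_def using A simple_pnt card_image[OF inj_pnt] by auto

text \<open>Away from the singular point the parameter is the ratio of the first two coordinates, so
  \<open>G\<close> has infinitely many zeros on the curve.\<close>

lemma dvd_if_pullback_0:
  assumes "G \<in> forms d" "pullback \<epsilon> G = 0" shows "F dvd G"
proof (rule ccontr)
  assume "\<not> F dvd G"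
  then have fin: "finite {p \<in> curve F. eval_mpoly G (pt p) = 0}" by (rule finite_zeros_on_curve[OF assms(1)])
  let ?S = "{s. s * s + \<epsilon> * s \<noteq> 0}"
  have "inj_on pnt ?S"
  proof (rule inj_onI)
    fix s s' assume s: "s \<in> ?S" "s' \<in> ?S" "pnt s = pnt s'"
    then have "represents (\<chi> j. param \<epsilon> s' j) (pnt s)" unfolding pnt_def by (simp only: represents_proj[OF param_nonzero])
    with represents_proj[OF param_nonzero] have "\<exists>c. param \<epsilon> s' = (\<lambda>j. c * param \<epsilon> s j)"
      unfolding pnt_def by (rule represents_unique_fun)
    then obtain c where c: "param \<epsilon> s' = (\<lambda>j. c * param \<epsilon> s j)" by (rule exE)
    from fun_cong[OF c, of 3] have "c = 1" by (simp add: param_def)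
    with fun_cong[OF c, of 1] fun_cong[OF c, of 2]
    have "s' * s' + \<epsilon> * s' = s * s + \<epsilon> * s" "s' * (s' * s' + \<epsilon> * s') = s * (s * s + \<epsilon> * s)" by (simp_all add: param_def)
    with s(1) show "s = s'" by simp
  qed
  moreover have "pnt ` ?S \<subseteq> {p \<in> curve F. eval_mpoly G (pt p) = 0}"
    using assms(2) by (auto simp: curve_iff eval_pnt[OF F_forms] eval_pnt[OF assms(1)] pullback_F)
  then have "finite (pnt ` ?S)" using fin by (rule finite_subset)
  ultimately have "finite ?S" by (simp add: finite_image_iff)
  moreover have "finite {s. s * s + \<epsilon> * s = 0}"
  proof -
    have "{s. s * s + \<epsilon> * s = 0} \<subseteq> {0, - \<epsilon>}" by (auto simp: distrib_right[symmetric] add_eq_0_iff2)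
    then show ?thesis by (rule finite_subset) simp
  qed
  ultimately have "finite (?S \<union> {s. s * s + \<epsilon> * s = 0})" by simp
  moreover have "?S \<union> {s. s * s + \<epsilon> * s = 0} = UNIV" by auto
  ultimately show False using infinite_UNIV_alg_closed[where 'k = 'k] by simp
qed

text \<open>By degrees \<open>p\<close> is a constant multiple of \<open>Q\<close>, and a nonzero
  constant does not affect descending.\<close>

lemma scalar_multiple:
  assumes "Q dvd p" "degree p \<le> degree Q" "\<not> descends \<epsilon> Q" "descends \<epsilon> p"
  shows "p = 0"
proof (rule ccontr)
  assume "p \<noteq> 0"
  obtain r where r: "p = Q * r" using assms(1) by (rule dvdE)
  with \<open>p \<noteq> 0\<close> have "Q \<noteq> 0" "r \<noteq> 0" by auto
  then have "degree r = 0" using assms(2) by (simp add: r degree_mult_eq)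
  then obtain c where c: "r = [:c:]" by (rule degree_eq_zeroE)
  with \<open>r \<noteq> 0\<close> have "c \<noteq> 0" by simp
  have "descends \<epsilon> (smult (1 / c) p)" using assms(4) by (rule descends_smult)
  moreover have "smult (1 / c) p = Q" using \<open>c \<noteq> 0\<close> by (simp add: r c)
  ultimately show False using assms(3) by simp
qed

lemma configuration:
  assumes "\<not> descends \<epsilon> P" shows "cubic_configuration t 0 F X"
proof (rule configuration_if_not_complete_intersection)
  show "finite X" "card X = 3 * t" "t \<ge> 3" "p \<in> X \<Longrightarrow> simple_point p" for p using X_properties t by auto
  fix G assume G: "G \<in> forms t" "\<forall>p\<in>X. eval_mpoly G (pt p) = 0"
  have "P dvd pullback \<epsilon> G"
    unfolding P_def by (rule prod_linear_dvd[OF A(1)]) (use G(2) eval_pnt[OF G(1)] in \<open>simp add: X_def\<close>)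
  then have "pullback \<epsilon> G = 0"
    using degree_pullback[OF G(1), of \<epsilon>] degree_P assms by (intro scalar_multiple descends_pullback) simp_all
  then show "F dvd G" by (rule dvd_if_pullback_0[OF G(1)])
qed

sublocale double_points F X
  by unfold_locales (use X_properties in auto)

text \<open>Together with the point, \<open>param_deriv\<close> spans the same tangent plane as the
  chosen \<open>tangent\<close>, in every characteristic.\<close>

lemma tangent_forms_pnt_iff:
  assumes G: "G \<in> forms d" and s: "s \<in> A"
  shows "eval_mpoly G (pt (pnt s)) = 0 \<and> dir_deriv G (pt (pnt s)) (tangent F (pnt s)) = 0 \<longleftrightarrow>
    poly (pullback \<epsilon> G) s = 0 \<and> poly (pderiv (pullback \<epsilon> G)) s = 0"
proof (cases "eval_mpoly G (pt (pnt s)) = 0")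
  case False
  then show ?thesis using eval_pnt[OF G] by simp
next
  case True
  let ?v = "param \<epsilon> s" and ?w = "param_deriv \<epsilon> s" and ?p = "pt (pnt s)" and ?\<tau> = "tangent F (pnt s)"
  have p: "pnt s \<in> X" using s by (simp add: X_def)
  note tp = simple_point_tangent[OF simple_pnt[OF s]]
  have cr: "cross ?v ?w \<noteq> zero3"
  proof
    assume c: "cross ?v ?w = zero3"
    have e: "cross ?v ?w 1 = - (3 * s * s + 2 * \<epsilon> * s)" "cross ?v ?w 2 = 2 * s + \<epsilon>"
      by (simp_all add: cross_def param_def param_deriv_def)
    have "- (3 * s * s + 2 * \<epsilon> * s) = 0" "2 * s + \<epsilon> = 0" unfolding e[symmetric] c by (rule refl)+
    \<comment> \<open>This combination of the two vanishing coordinates works in characteristics two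
      and three as well.\<close>
    moreover have "s * s = 2 * s * (2 * s + \<epsilon>) + - (3 * s * s + 2 * \<epsilon> * s)" by (simp add: algebra_simps)
    ultimately have "s * s = 0" by (simp only: mult_zero_right add_0)
    then show False using A(3)[OF s] by simp
  qed
  have Fe: "dir_deriv F ?p ?p = 0" "dir_deriv G ?p ?p = 0"
    using dir_deriv_euler[OF F_forms] dir_deriv_euler[OF G] X_curve[OF p] True by simp_all
  have Fv: "dir_deriv F ?v ?w = 0" using pderiv_pullback[of \<epsilon> F s] by (simp add: pullback_F)
  have Fw: "dir_deriv F ?p ?w = 0" using dir_deriv_pnt[OF F_forms] Fv by simp
  have pv: "\<exists>c. c \<noteq> 0 \<and> ?p = (\<lambda>j. c * ?v j)" unfolding pnt_def using pt_proj[OF param_nonzero] by metis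
  then obtain c where c: "c \<noteq> 0" "?p = (\<lambda>j. c * ?v j)" by blast
  have crp: "cross ?p ?w \<noteq> zero3"
  proof
    assume 0: "cross ?p ?w = zero3"
    have "cross ?p ?w = (\<lambda>i. c * cross ?v ?w i)" unfolding c(2) by (simp add: fun3_eq_iff cross_def algebra_simps)
    with 0 have "(\<lambda>i. c * cross ?v ?w i) = zero3" by simp
    then have "c * cross ?v ?w i = 0" for i by (rule fun_cong)
    with c(1) have "cross ?v ?w = zero3" by (intro ext) simp
    with cr show False by contradiction
  qed
  have "dir_deriv G ?p ?\<tau> = 0 \<longleftrightarrow> dir_deriv G ?p ?w = 0"
  proof
    assume "dir_deriv G ?p ?\<tau> = 0"
    from gradient_parallel[OF tp(1) Fe(1) tp(2) X_gradient[OF p] Fe(2) this] Fw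
    show "dir_deriv G ?p ?w = 0" by auto
  next
    assume "dir_deriv G ?p ?w = 0"
    from gradient_parallel[OF crp Fe(1) Fw X_gradient[OF p] Fe(2) this] tp(2)
    show "dir_deriv G ?p ?\<tau> = 0" by auto
  qed
  then show ?thesis using True eval_pnt[OF G] dir_deriv_pnt[OF G] by (simp add: pderiv_pullback)
qed

lemma in_tangent_forms_iff:
  "G \<in> Y d \<longleftrightarrow> G \<in> forms d \<and> (\<forall>s\<in>A. poly (pullback \<epsilon> G) s = 0 \<and> poly (pderiv (pullback \<epsilon> G)) s = 0)"
  unfolding tangent_forms_iff X_def by (simp add: tangent_forms_pnt_iff cong: ball_cong conj_cong)

lemma tangent_forms_generic:
  assumes "\<not> descends \<epsilon> (P * P)" shows "Y (2 * t) = (*) F ` forms (2 * t - 3)"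
proof (rule tangent_forms_eq_multiples)
  fix G assume G: "G \<in> Y (2 * t)"
  then have Gf: "G \<in> forms (2 * t)" by (simp add: tangent_forms_iff)
  have "P * P dvd pullback \<epsilon> G"
    unfolding P_def by (rule prod_linear_square_dvd[OF A(1)]) (use G in \<open>simp add: in_tangent_forms_iff\<close>)
  moreover have "degree (P * P) = 6 * t" using degree_P P_nonzero by (simp add: degree_mult_eq)
  ultimately have "pullback \<epsilon> G = 0"
    using degree_pullback[OF Gf, of \<epsilon>] assms by (intro scalar_multiple descends_pullback) simp_all
  then show "F dvd G" by (rule dvd_if_pullback_0[OF Gf])
qed (use t in simp)

lemma tangent_forms_special:
  assumes "descends \<epsilon> (P * P)" shows "Y (2 * t) \<noteq> (*) F ` forms (2 * t - 3)"
proof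
  assume Y: "Y (2 * t) = (*) F ` forms (2 * t - 3)"
  have "degree (P * P) = 6 * t" using degree_P P_nonzero by (simp add: degree_mult_eq)
  then obtain G where G: "G \<in> forms (2 * t)" "pullback \<epsilon> G = P * P"
    using pullback_surj[OF assms, of "2 * t"] by auto
  have P0: "poly P s = 0" if "s \<in> A" for s
    unfolding P_def poly_prod using that A(1) by (intro prod_zero) auto
  have "G \<in> Y (2 * t)"
    unfolding in_tangent_forms_iff using G P0 by (simp add: pderiv_mult)
  then obtain H where "G = F * H" using Y by blast
  then have "pullback \<epsilon> G = 0" by (simp add: pullback_F)
  with G(2) P_nonzero show False by simp
qed

end

section \<open>Choice of parameters on nodal and cuspidal cubics\<close>

lemma ex_finite_subset_avoiding:
  fixes S :: "'k::alg_closed_field set"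
  assumes "finite S" obtains B where "B \<inter> S = {}" "finite B" "card B = n"
proof -
  have "infinite (UNIV - S)" by (rule Diff_infinite_finite[OF assms infinite_UNIV_alg_closed])
  then obtain B where "B \<subseteq> UNIV - S" "finite B" "card B = n"
    using infinite_arbitrarily_large by blast
  with that[of B] show ?thesis by blast
qed

text \<open>All but two elements are free. The last two are \<open>w\<close> and
  \<open>c / w\<close>, with \<open>w\<close> outside the finitely many values that would cause a
  coincidence.\<close>

lemma ex_set_with_product:
  fixes u :: "'k::alg_closed_field"
  assumes "n \<ge> 2" "u \<noteq> 0"
  obtains B where "finite B" "card B = n" "0 \<notin> B" "1 \<notin> B" "(\<Prod>w\<in>B. w) = u"
proof -
  obtain B where B: "B \<inter> {0, 1 :: 'k} = {}" "finite B" "card B = n - 2"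
    by (rule ex_finite_subset_avoiding[of "{0, 1}"]) simp_all
  define c where "c = u / (\<Prod>w\<in>B. w)"
  have "(\<Prod>w\<in>B. w) \<noteq> 0" using B(1,2) by (auto simp: prod_zero_iff)
  then have c: "c \<noteq> 0" "c * (\<Prod>w\<in>B. w) = u" using assms(2) by (simp_all add: c_def)
  have "{w. w * w = c} = {w. poly [:- c, 0, 1:] w = 0}" by (auto simp: algebra_simps)
  then have "finite {w. w * w = c}" using poly_roots_finite[of "[:- c, 0, 1:]"] by simp
  then have "finite (insert 0 (insert 1 B) \<union> (\<lambda>x. c / x) ` (insert 1 B) \<union> {w. w * w = c})"
    using B(2) by simp
  from ex_new_if_finite[OF infinite_UNIV_alg_closed this]
  obtain w where "w \<notin> insert 0 (insert 1 B) \<union> (\<lambda>x. c / x) ` (insert 1 B) \<union> {w. w * w = c}"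
    by (rule exE)
  then have w: "w \<noteq> 0" "w \<noteq> 1" "w \<notin> B" "w \<notin> (\<lambda>x. c / x) ` (insert 1 B)" "w * w \<noteq> c"
    by (simp_all only: Un_iff insert_iff mem_Collect_eq de_Morgan_disj simp_thms)
  define v where "v = c / w"
  have v: "v \<noteq> 0" "v \<noteq> w" "w * v = c" using c w by (simp_all add: v_def divide_eq_eq)
  have vB: "v \<notin> insert 1 B"
  proof
    assume "v \<in> insert 1 B"
    moreover have "w = c / v" using v by (simp add: eq_divide_eq)
    ultimately have "w \<in> (\<lambda>x. c / x) ` (insert 1 B)" by (intro image_eqI)
    with w(4) show False by contradiction
  qed
  show ?thesis
  proof (rule that[of "insert w (insert v B)"])
    show "card (insert w (insert v B)) = n" using B vB v(2) w(3) assms(1) by simp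
    show "(\<Prod>w\<in>insert w (insert v B). w) = u" using B vB v w(3) c(2) by (simp add: mult.assoc[symmetric])
    show "finite (insert w (insert v B))" using B(2) by simp
    show "0 \<notin> insert w (insert v B)" "1 \<notin> insert w (insert v B)" using B(1) v(1) vB w(1,2) by auto
  qed
qed

text \<open>
  The map \<open>w \<mapsto> 1 / (w - 1)\<close> turns the parameters of the simple points of the nodal cubic into the
  elements of the multiplicative group. The points lie on a curve of degree \<open>t\<close> not containing the
  cubic iff their product \<open>u\<close> is \<open>1\<close>; for their doubles and degree \<open>2 t\<close> the condition is \<open>u\<^sup>2 = 1\<close>.
\<close>

lemma ex_node_parameters:
  fixes u :: "'k::alg_closed_field"
  assumes "t \<ge> 6" "u \<noteq> 0"
  obtains A :: "'k set" where "rational_configuration 1 A t"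
    "poly (\<Prod>s\<in>A. [:- s, 1:]) (- 1) = u * poly (\<Prod>s\<in>A. [:- s, 1:]) 0" "poly (\<Prod>s\<in>A. [:- s, 1:]) 0 \<noteq> 0"
proof -
  have n: "3 * t \<ge> 2" using assms(1) by simp
  obtain B where B: "finite B" "card B = 3 * t" "0 \<notin> B" "1 \<notin> B" "(\<Prod>w\<in>B. w) = u"
    by (rule ex_set_with_product[OF n assms(2)])
  let ?s = "\<lambda>w :: 'k. inverse (w - 1)"
  have ne: "w - 1 \<noteq> 0" "w \<noteq> 0" if "w \<in> B" for w using B that by auto
  have inj: "inj_on ?s B" by (rule inj_onI) simp
  have s1: "?s w + 1 = w * ?s w" if "w \<in> B" for w
  proof -
    have "w * ?s w = (w - 1) * ?s w + ?s w" by (simp add: left_diff_distrib)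
    then show ?thesis using ne(1)[OF that] by (simp add: add.commute)
  qed
  have "rational_configuration 1 (?s ` B) t"
  proof
    show "finite (?s ` B)" "card (?s ` B) = 3 * t" "t \<ge> 6" using B card_image[OF inj] assms by simp_all
    fix s assume "s \<in> ?s ` B"
    then obtain w where w: "w \<in> B" "s = ?s w" by blast
    have "s * s + 1 * s = s * (?s w + 1)" by (simp add: w(2) distrib_left)
    also have "\<dots> = s * (w * ?s w)" by (simp only: s1[OF w(1)])
    finally have "s * s + 1 * s = s * (w * s)" by (simp only: w(2))
    then show "s * s + 1 * s \<noteq> 0" using ne[OF w(1)] by (simp add: w(2))
  qed
  moreover have "poly (\<Prod>s\<in>?s ` B. [:- s, 1:]) x = (\<Prod>w\<in>B. x - ?s w)" for x
    by (simp add: poly_prod prod.reindex[OF inj])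
  \<comment> \<open>For \<open>s = 1 / (w - 1)\<close> the ratio of \<open>- 1 - s\<close> to
    \<open>0 - s\<close> is \<open>w\<close>, so the values of the product at the two parameters of
    the node differ by the factor \<open>u\<close>.\<close>
  moreover have "(\<Prod>w\<in>B. - 1 - ?s w) = u * (\<Prod>w\<in>B. 0 - ?s w)"
  proof -
    have "(\<Prod>w\<in>B. - 1 - ?s w) = (\<Prod>w\<in>B. w * (0 - ?s w))"
    proof (rule prod.cong[OF refl])
      fix w assume w: "w \<in> B"
      have "- 1 - ?s w = - (?s w + 1)" by simp
      also have "\<dots> = w * (0 - ?s w)" by (simp only: s1[OF w]) simp
      finally show "- 1 - ?s w = w * (0 - ?s w)" .
    qed
    then show ?thesis by (simp only: prod.distrib B(5))
  qed
  moreover have "(\<Prod>w\<in>B. 0 - ?s w) \<noteq> 0" using B(1) ne by (simp add: prod_zero_iff)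
  ultimately show ?thesis by (intro that[of "?s ` B"]) simp_all
qed

lemma descends_node_iff:
  fixes p :: "'k::field poly"
  shows "descends 1 p \<longleftrightarrow> poly p 0 = poly p (- 1)"
proof
  assume "descends 1 p"
  then obtain c q where "p = [:c:] + [:0, 1, 1:] * q" unfolding descends_def by blast
  then show "poly p 0 = poly p (- 1)" by simp
next
  assume p: "poly p 0 = poly p (- 1)"
  have "(\<Prod>s\<in>{0, - 1}. [:- s, 1:]) dvd p - [:poly p 0:]"
    by (rule prod_linear_dvd) (use p in auto)
  moreover have "(\<Prod>s\<in>{0, - 1 :: 'k}. [:- s, 1:]) = [:0, 1, 1:]"
  proof -
    have "(\<Prod>s\<in>{0, - 1 :: 'k}. [:- s, 1:]) = [:0, 1:] * [:1, 1:]" by (simp del: mult_pCons_left mult_pCons_right)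
    also have "\<dots> = [:0, 1, 1:]" unfolding mult_pCons_left by simp
    finally show ?thesis .
  qed
  ultimately obtain q where "p - [:poly p 0:] = [:0, 1, 1:] * q" by (auto elim: dvdE)
  then have "p = [:poly p 0:] + [:0, 1, 1:] * q" by (simp only: diff_eq_eq add.commute)
  then show "descends 1 p" unfolding descends_def by blast
qed

lemma descends_cusp_iff:
  fixes p :: "'k::field poly"
  shows "descends 0 p \<longleftrightarrow> poly (pderiv p) 0 = 0"
proof
  assume "descends 0 p"
  then obtain c q where "p = [:c:] + [:0, 0, 1:] * q" unfolding descends_def by blast
  then show "poly (pderiv p) 0 = 0" by (simp add: pderiv_add pderiv_mult pderiv_pCons)
next
  assume p: "poly (pderiv p) 0 = 0"
  have "(\<Prod>s\<in>{0}. [:- s, 1:]) * (\<Prod>s\<in>{0}. [:- s, 1:]) dvd p - [:poly p 0:]"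
    by (rule prod_linear_square_dvd) (use p in \<open>auto simp: pderiv_diff pderiv_pCons\<close>)
  moreover have "(\<Prod>s\<in>{0 :: 'k}. [:- s, 1:]) * (\<Prod>s\<in>{0}. [:- s, 1:]) = [:0, 0, 1:]" by simp
  ultimately obtain q where "p - [:poly p 0:] = [:0, 0, 1:] * q" by (auto elim: dvdE)
  then have "p = [:poly p 0:] + [:0, 0, 1:] * q" by (simp only: diff_eq_eq add.commute)
  then show "descends 0 p" unfolding descends_def by blast
qed

text \<open>The derivative at zero is affine in the last root \<open>a\<close> with nonzero constant
  term, so it vanishes for at most one \<open>a\<close>.\<close>

lemma ex_cusp_parameters:
  assumes "t \<ge> 6"
  obtains A :: "'k::alg_closed_field set" where "rational_configuration 0 A t"
    "poly (pderiv (\<Prod>s\<in>A. [:- s, 1:])) 0 \<noteq> 0"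
proof -
  obtain B where B: "B \<inter> {0 :: 'k} = {}" "finite B" "card B = 3 * t - 1"
    by (rule ex_finite_subset_avoiding[of "{0}"]) simp_all
  let ?P = "\<Prod>s\<in>B. [:- s, 1:]"
  have P0: "poly ?P 0 \<noteq> 0" using B(1,2) by (auto simp: poly_prod prod_zero_iff)
  \<comment> \<open>If the denominator is zero, the quotient is zero by convention, and zero is
    excluded anyway.\<close>
  have "finite (insert 0 (insert (poly ?P 0 / poly (pderiv ?P) 0) B))" using B(2) by simp
  from ex_new_if_finite[OF infinite_UNIV_alg_closed this]
  obtain a where a: "a \<notin> insert 0 (insert (poly ?P 0 / poly (pderiv ?P) 0) B)" by (rule exE)
  have "pderiv [:- a, 1:] = 1" by (simp add: pderiv_pCons)
  then have "poly (pderiv ([:- a, 1:] * ?P)) 0 = poly ?P 0 - a * poly (pderiv ?P) 0"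
    by (simp only: pderiv_mult poly_add poly_mult) simp
  also have "\<dots> \<noteq> 0"
  proof
    assume 0: "poly ?P 0 - a * poly (pderiv ?P) 0 = 0"
    with P0 have "poly (pderiv ?P) 0 \<noteq> 0" by auto
    with 0 have "a = poly ?P 0 / poly (pderiv ?P) 0" by (simp add: eq_divide_eq)
    with a show False by simp
  qed
  finally have "poly (pderiv (\<Prod>s\<in>insert a B. [:- s, 1:])) 0 \<noteq> 0" using a B(2) by simp
  moreover have "rational_configuration 0 (insert a B) t"
    by unfold_locales (use a B assms in auto)
  ultimately show ?thesis using that by blast
qed

lemma (in rational_configuration) generic_first_differences:
  assumes "\<not> descends \<epsilon> P" "\<not> descends \<epsilon> (P * P)"
  shows "cubic_configuration t 0 F X" "\<Delta>h_double X (2 * t) = 3" "\<forall>i>2 * t. \<Delta>h_double X i = 0"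
proof -
  show c: "cubic_configuration t 0 F X" by (rule configuration[OF assms(1)])
  have t5: "0 \<le> (2::nat)" "t + 0 > 5" using t by simp_all
  note d = configuration_first_differences[OF c t5]
  have Y: "Y (2 * t) = (*) F ` forms (2 * t - 3)" by (rule tangent_forms_generic[OF assms(2)])
  show "\<Delta>h_double X (2 * t) = 3" using d(7) Y by simp
  show "\<forall>i>2 * t. \<Delta>h_double X i = 0"
  proof (intro allI impI)
    fix i assume "i > 2 * t"
    then have "i = 2 * t + 1 \<or> i \<ge> 2 * t + 2" by arith
    then show "\<Delta>h_double X i = 0" using d(8) d(6)[of i] Y by auto
  qed
qed

lemma (in rational_configuration) special_first_differences:
  assumes "\<not> descends \<epsilon> P" "descends \<epsilon> (P * P)"
  shows "cubic_configuration t 0 F X" "\<Delta>h_double X (2 * t) = 2" "\<Delta>h_double X (2 * t + 1) = 1"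
    "\<forall>i\<ge>2 * t + 2. \<Delta>h_double X i = 0"
proof -
  show c: "cubic_configuration t 0 F X" by (rule configuration[OF assms(1)])
  have t5: "0 \<le> (2::nat)" "t + 0 > 5" using t by simp_all
  note d = configuration_first_differences[OF c t5]
  have Y: "Y (2 * t) \<noteq> (*) F ` forms (2 * t - 3)" by (rule tangent_forms_special[OF assms(2)])
  show "\<Delta>h_double X (2 * t) = 2" "\<Delta>h_double X (2 * t + 1) = 1" using d(7,8) Y by simp_all
  show "\<forall>i\<ge>2 * t + 2. \<Delta>h_double X i = 0" using d(6) by simp
qed

lemma ex_generic_configuration:
  assumes "t \<ge> 6"
  shows "\<exists>(F :: (3, 'k::alg_closed_field) mpoly) X. cubic_configuration t 0 F X \<and>
    \<Delta>h_double X (2 * t) = 3 \<and> (\<forall>i>2 * t. \<Delta>h_double X i = 0)"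
proof -
  \<comment> \<open>Excluding \<open>1\<close> and \<open>- 1\<close> ensures that neither
    \<open>u\<close> nor its square is one.\<close>
  obtain u :: 'k where u: "u \<notin> {0, 1, - 1}"
    using ex_new_if_finite[OF infinite_UNIV_alg_closed, of "{0, 1, - 1}"] by auto
  then have "u \<noteq> 0" by simp
  then obtain S where S: "rational_configuration 1 S t"
    "poly (\<Prod>s\<in>S. [:- s, 1:]) (- 1) = u * poly (\<Prod>s\<in>S. [:- s, 1:]) 0" "poly (\<Prod>s\<in>S. [:- s, 1:]) 0 \<noteq> 0"
    by (rule ex_node_parameters[OF assms])
  interpret rational_configuration 1 S t by (rule S(1))
  have "\<not> descends 1 P"
  proof
    assume "descends 1 P"
    then have "1 * poly P 0 = u * poly P 0" unfolding descends_node_iff P_def S(2) mult_1_left .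
    then have "1 = u" by (rule iffD1[OF mult_right_cancel[OF S(3)[folded P_def]]])
    with u show False by simp
  qed
  moreover have "\<not> descends 1 (P * P)"
  proof
    assume "descends 1 (P * P)"
    then have "poly P 0 * poly P 0 = (u * poly P 0) * (u * poly P 0)"
      unfolding descends_node_iff P_def poly_mult S(2) .
    also have "\<dots> = (u * u) * (poly P 0 * poly P 0)" by (simp only: ac_simps)
    finally have sq: "1 * (poly P 0 * poly P 0) = (u * u) * (poly P 0 * poly P 0)" unfolding mult_1_left .
    have ne: "poly P 0 * poly P 0 \<noteq> 0" using S(3) unfolding P_def by simp
    have "u * u = 1" by (rule iffD1[OF mult_right_cancel[OF ne] sq, symmetric])
    with u show False by (simp add: square_eq_1_iff)
  qed
  ultimately have "cubic_configuration t 0 F X" "\<Delta>h_double X (2 * t) = 3" "\<forall>i>2 * t. \<Delta>h_double X i = 0"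
    by (rule generic_first_differences)+
  then show ?thesis by blast
qed

text \<open>
  In characteristic two, \<open>u\<^sup>2 = 1\<close> forces \<open>u = 1\<close>, which rules out the nodal cubic. On the
  cuspidal cubic the group is additive and the condition on the doubles is always satisfied.
\<close>

lemma ex_special_configuration:
  assumes "t \<ge> 6"
  shows "\<exists>(F :: (3, 'k::alg_closed_field) mpoly) X. cubic_configuration t 0 F X \<and>
    \<Delta>h_double X (2 * t) = 2 \<and> \<Delta>h_double X (2 * t + 1) = 1 \<and> (\<forall>i\<ge>2 * t + 2. \<Delta>h_double X i = 0)"
proof (cases "(2 :: 'k) = 0")
  case True
  obtain S :: "'k set" where S: "rational_configuration 0 S t" "poly (pderiv (\<Prod>s\<in>S. [:- s, 1:])) 0 \<noteq> 0"
    by (rule ex_cusp_parameters[OF assms])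
  interpret rational_configuration 0 S t by (rule S(1))
  have "\<not> descends 0 P" unfolding descends_cusp_iff P_def using S(2) .
  moreover have "descends 0 (P * P)"
  proof -
    have "poly (pderiv (P * P)) 0 = 2 * (poly P 0 * poly (pderiv P) 0)" by (simp add: pderiv_mult)
    then show ?thesis unfolding descends_cusp_iff True by simp
  qed
  ultimately have "cubic_configuration t 0 F X" "\<Delta>h_double X (2 * t) = 2" "\<Delta>h_double X (2 * t + 1) = 1"
    "\<forall>i\<ge>2 * t + 2. \<Delta>h_double X i = 0" by (rule special_first_differences)+
  then show ?thesis by blast
next
  case False
  have "(- 1 :: 'k) \<noteq> 0" by simp
  then obtain S where S: "rational_configuration 1 S t"
    "poly (\<Prod>s\<in>S. [:- s, 1:]) (- 1) = (- 1 :: 'k) * poly (\<Prod>s\<in>S. [:- s, 1:]) 0" "poly (\<Prod>s\<in>S. [:- s, 1:]) 0 \<noteq> 0"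
    by (rule ex_node_parameters[OF assms])
  interpret rational_configuration 1 S t by (rule S(1))
  have "\<not> descends 1 P"
  proof
    assume "descends 1 P"
    then have "poly P 0 = - 1 * poly P 0" unfolding descends_node_iff P_def S(2) .
    then have "poly P 0 + poly P 0 = 0" by (simp only: mult_minus1 eq_neg_iff_add_eq_0)
    then have "2 * poly P 0 = 0" by (simp only: mult_2)
    then have "poly P 0 = 0" using False by (simp only: mult_eq_0_iff simp_thms)
    with S(3) show False unfolding P_def by contradiction
  qed
  moreover have "descends 1 (P * P)" unfolding descends_node_iff P_def poly_mult S(2) by simp
  ultimately have "cubic_configuration t 0 F X" "\<Delta>h_double X (2 * t) = 2" "\<Delta>h_double X (2 * t + 1) = 1"
    "\<forall>i\<ge>2 * t + 2. \<Delta>h_double X i = 0" by (rule special_first_differences)+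
  then show ?thesis by blast
qed

section \<open>Smooth cubics\<close>

definition polar_form :: "(3, 'k::field) mpoly \<Rightarrow> (3 \<Rightarrow> 'k) \<Rightarrow> (3, 'k) mpoly" where
  "polar_form F w = (\<Sum>j\<in>UNIV. const (w j) * partial_deriv j F)"

lemma eval_polar_form [simp]: "eval_mpoly (polar_form F w) v = dir_deriv F v w"
  by (simp add: polar_form_def dir_deriv_partial)

lemma polar_form_forms: "F \<in> forms d \<Longrightarrow> polar_form F w \<in> forms (d - 1)"
  unfolding polar_form_def by (intro forms_sum forms_const_mult partial_deriv_forms)

lemma poly_eq_if_agree_nonzero:
  fixes p q :: "'k::alg_closed_field poly"
  assumes "\<And>x. x \<noteq> 0 \<Longrightarrow> poly p x = poly q x" shows "p = q"
proof (rule ccontr)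
  assume "p \<noteq> q"
  then have "finite {x. poly (p - q) x = 0}" by (intro poly_roots_finite) simp
  then have "finite (insert 0 {x. poly (p - q) x = 0})" by simp
  moreover have "insert 0 {x. poly (p - q) x = 0} = UNIV" using assms by auto
  ultimately show False using infinite_UNIV_alg_closed[where 'k = 'k] by metis
qed

lemma poly_degree_3:
  fixes p :: "'k::comm_ring_1 poly"
  assumes "degree p \<le> 3"
  shows "p = [:coeff p 0, coeff p 1, coeff p 2, coeff p 3:]"
proof (rule poly_eqI)
  fix n :: nat
  have "n = 0 \<or> n = 1 \<or> n = 2 \<or> n = 3 \<or> n > 3" by arith
  then show "coeff p n = coeff [:coeff p 0, coeff p 1, coeff p 2, coeff p 3:] n"
    using coeff_eq_0[of p n] assms
    by (elim disjE) (simp_all add: coeff_pCons eval_nat_numeral split: nat.split)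
qed

locale smooth_cubic = cubic_curve F for F :: "(3, 'k::alg_closed_field) mpoly" +
  assumes smooth: "smooth_curve F"
begin

lemma gradient_nonzero:
  assumes "v \<noteq> zero3" "eval_mpoly F v = 0" shows "gradient F v \<noteq> zero3"
proof
  assume 0: "gradient F v = zero3"
  have "eval_mpoly F (pt (proj v)) = 0" using eval_proj_iff[OF F_forms assms(1)] assms(2) by simp
  moreover have "eval_mpoly (partial_deriv j F) (pt (proj v)) = 0" for j
    using eval_proj_iff[OF partial_deriv_forms[OF F_forms] assms(1)] fun_cong[OF 0, of j]
    by (simp add: gradient_def)
  then have "gradient F (pt (proj v)) = zero3" by (simp add: gradient_def)
  ultimately have "singular_point F (proj v)" using singular_point_iff[OF F_forms] by simp
  with smooth show False by (simp add: smooth_curve_def)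
qed

text \<open>
  A smooth cubic is not strange. If all tangent lines passed through \<open>r\<close>, then
  \<open>F (v + x r) = F v + x\<^sup>2 \<lambda> v\<close> with \<open>\<lambda>\<close> the derivative of \<open>F\<close> at \<open>r\<close>, and this forces
  characteristic two. There, translating by a suitable multiple of \<open>r\<close> kills the
  remaining partial derivative, and Euler's formula gives a singular point.
\<close>

lemma strange_point_formula:
  assumes r: "eval_mpoly F r = 0" and strange: "\<And>v. dir_deriv F v r = 0"
  shows "eval_mpoly F (\<lambda>i. v i + x * r i) = eval_mpoly F v + x * x * dir_deriv F r v"
proof -
  let ?f = "line_poly F v r" and ?g = "line_poly F r v"
  have f: "?f = [:eval_mpoly F v, 0, coeff ?f 2:]"
    using poly_degree_3[OF line_poly_form(1)[OF F_forms, of v r]]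
      line_poly_form(2)[OF F_forms, of v r] strange[of v] r
    by (simp add: coeff_0_line_poly dir_deriv_def)
  have g: "?g = [:0, dir_deriv F r v, coeff ?g 2, coeff ?g 3:]"
    using poly_degree_3[OF line_poly_form(1)[OF F_forms, of r v]] r
    by (simp add: coeff_0_line_poly dir_deriv_def del: One_nat_def)
  \<comment> \<open>Homogeneity reads the line from its other end: the coefficients of
    \<open>F\<close> along \<open>v + x r\<close> are those along \<open>r + x v\<close> in reverse
    order.\<close>
  have "?f = [:coeff ?g 3, coeff ?g 2, dir_deriv F r v:]"
  proof (rule poly_eq_if_agree_nonzero)
    fix x :: 'k assume x: "x \<noteq> 0"
    have "eval_mpoly F (\<lambda>i. x * (r i + 1 / x * v i)) = x ^ 3 * eval_mpoly F (\<lambda>i. r i + 1 / x * v i)"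
      by (rule eval_homogeneous[OF F_forms])
    moreover have "(\<lambda>i. x * (r i + 1 / x * v i)) = (\<lambda>i. v i + x * r i)"
      using x by (simp add: distrib_left add.commute)
    ultimately have "poly ?f x = x ^ 3 * poly ?g (1 / x)" by (simp add: poly_line_poly)
    also have "\<dots> = poly [:coeff ?g 3, coeff ?g 2, dir_deriv F r v:] x"
      by (subst g) (use x in \<open>simp add: field_simps power3_eq_cube\<close>)
    finally show "poly ?f x = poly [:coeff ?g 3, coeff ?g 2, dir_deriv F r v:] x" .
  qed
  with f have "coeff ?f 2 = dir_deriv F r v"
    by (metis pCons_eq_iff)
  with f have "?f = [:eval_mpoly F v, 0, dir_deriv F r v:]" by simp
  then have "poly ?f x = poly [:eval_mpoly F v, 0, dir_deriv F r v:] x" by simp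
  then show ?thesis by (simp add: poly_line_poly algebra_simps)
qed

text \<open>The formula for translation by \<open>z r\<close> is differentiated along
  \<open>w\<close>; its second term is linear in \<open>v\<close>.\<close>

lemma strange_point_dir_deriv:
  assumes r: "eval_mpoly F r = 0" and strange: "\<And>v. dir_deriv F v r = 0"
  shows "dir_deriv F (\<lambda>i. v i + z * r i) w = dir_deriv F v w + z * z * dir_deriv F r w"
proof -
  have "line_poly F (\<lambda>i. v i + z * r i) w =
      line_poly F v w + [:z * z * dir_deriv F r v, z * z * dir_deriv F r w:]"
  proof (rule poly_eq_if_agree_nonzero)
    fix x :: 'k
    have "eval_mpoly F (\<lambda>i. (v i + x * w i) + z * r i) =
        eval_mpoly F (\<lambda>i. v i + x * w i) + z * z * dir_deriv F r (\<lambda>i. v i + x * w i)"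
      by (rule strange_point_formula[OF assms])
    moreover have "(\<lambda>i. (v i + x * w i) + z * r i) = (\<lambda>i. (v i + z * r i) + x * w i)"
      by (simp add: algebra_simps)
    ultimately show "poly (line_poly F (\<lambda>i. v i + z * r i) w) x =
        poly (line_poly F v w + [:z * z * dir_deriv F r v, z * z * dir_deriv F r w:]) x"
      by (simp add: poly_line_poly dir_deriv_add_right dir_deriv_scale_right algebra_simps)
  qed
  then show ?thesis by (simp add: dir_deriv_def)
qed

lemma not_strange:
  assumes r: "r \<noteq> zero3" "eval_mpoly F r = 0"
  shows "\<exists>v. dir_deriv F v r \<noteq> 0"
proof (rule ccontr)
  assume "\<not> ?thesis"
  then have strange: "\<And>v. dir_deriv F v r = 0" by simp
  note formula = strange_point_formula[OF r(2) strange]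
  let ?g = "gradient F r"
  have g: "?g \<noteq> zero3" using gradient_nonzero[OF r] .
  obtain b where b: "dot3 b ?g = 1" using ex_dot3_eq_1[OF g] .
  then have b': "dir_deriv F r b = 1" by (simp add: dir_deriv_gradient dot3_commute)
  \<comment> \<open>Translating twice by \<open>r\<close> and once by \<open>2 r\<close> must agree;
    starting at \<open>b\<close>, where the second term is normalized to one, this reads
    \<open>2 = 4\<close>.\<close>
  have "(2 :: 'k) = 0"
  proof -
    have "eval_mpoly F (\<lambda>i. (b i + 1 * r i) + 1 * r i) =
        eval_mpoly F (\<lambda>i. b i + 1 * r i) + 1 * 1 * dir_deriv F r (\<lambda>i. b i + 1 * r i)"
      by (rule formula)
    moreover have "(\<lambda>i. (b i + 1 * r i) + 1 * r i) = (\<lambda>i. b i + 2 * r i)" by (simp add: algebra_simps)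
    ultimately have "eval_mpoly F b + 2 * 2 * 1 = eval_mpoly F b + 1 * 1 * 1 + (1 + 0)"
      using formula[of b 2] formula[of b 1] strange[of r] b'
      by (simp add: dir_deriv_add_right)
    then have "(4 :: 'k) - 2 = 0" by simp
    then show ?thesis by simp
  qed
  moreover have "(3 :: 'k) = 2 + 1" by simp
  ultimately have three: "(3 :: 'k) = 1" by (simp only: add_0)
  obtain e where e: "dot3 e r = 1" using ex_dot3_eq_1[OF r(1)] .
  \<comment> \<open>The vectors \<open>r\<close> and \<open>a\<close> span the plane annihilated by
    the gradient at \<open>r\<close>, and \<open>b\<close> completes them to a basis.\<close>
  define a where "a = cross ?g e"
  have ra: "cross r a = ?g"
    using e strange[of r] by (simp add: a_def cross_cross dir_deriv_gradient dot3_commute)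
  have a: "dir_deriv F r a = 0" by (simp add: a_def dir_deriv_gradient)
  \<comment> \<open>A zero of the polar conic of \<open>a\<close> makes the derivative in direction
    \<open>a\<close> vanish. Translating by \<open>z r\<close> leaves it unchanged, and the square
    root \<open>z\<close> is chosen to remove the derivative in direction \<open>b\<close>.\<close>
  from form_zero_on_line[OF polar_form_forms[OF F_forms, of a], of a b]
  obtain x y where xy: "x \<noteq> 0 \<or> y \<noteq> 0" "dir_deriv F (\<lambda>i. x * a i + y * b i) a = 0" by auto
  define v where "v = (\<lambda>i. x * a i + y * b i)"
  obtain z where z: "z ^ 2 = - dir_deriv F v b"
    using nth_root_exists[of 2 "- dir_deriv F v b"] by auto
  define u where "u = (\<lambda>i. v i + z * r i)"
  have deriv: "dir_deriv F u w = dir_deriv F v w + z * z * dir_deriv F r w" for w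
    unfolding u_def by (rule strange_point_dir_deriv[OF r(2) strange])
  have u: "dot3 (gradient F u) r = 0" "dot3 (gradient F u) a = 0" "dot3 (gradient F u) b = 0"
    using strange[of u] deriv[of a] deriv[of b] a b' xy(2) z
    by (simp_all add: dir_deriv_gradient v_def power2_eq_square)
  obtain c where c: "gradient F u = (\<lambda>i. c * ?g i)"
    using annihilator_parallel[of r a "gradient F u"] ra g u(1,2) by auto
  with u(3) b have "c = 0" by (simp add: dot3_commute[of _ b])
  with c have zero: "gradient F u = zero3" by simp
  then have "dir_deriv F u u = 0" by (simp add: dir_deriv_gradient)
  \<comment> \<open>In characteristic two the factor \<open>3\<close> of Euler's formula is
    \<open>1\<close>, so the vanishing gradient puts \<open>u\<close> on the curve.\<close>
  then have "eval_mpoly F u = 0" using dir_deriv_euler[OF F_forms, of u] three by simp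
  moreover have "u \<noteq> zero3"
  proof
    assume 0: "u = zero3"
    have "dot3 ?g u = y" using b a b' strange[of r]
      by (simp add: u_def v_def dir_deriv_gradient)
    with 0 have y: "y = 0" by simp
    with xy have x: "x \<noteq> 0" by simp
    have "x * a i + z * r i = 0" for i using fun_cong[OF 0, of i] y by (simp add: u_def v_def)
    then have "a = (\<lambda>i. - (z / x) * r i)" using x by (simp add: fun_eq_iff field_simps eq_neg_iff_add_eq_0)
    then have "cross r a = zero3" by (simp add: cross_def fun3_eq_iff)
    with ra g show False by simp
  qed
  ultimately show False using gradient_nonzero zero by blast
qed

end

section \<open>Point sets on a smooth cubic that admit only multiples of the equation\<close>

context smooth_cubic
begin

lemma simple: "p \<in> curve F \<Longrightarrow> simple_point p"
  using smooth by (simp add: smooth_curve_def)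

lemma gradient_pt_nonzero: "p \<in> curve F \<Longrightarrow> gradient F (pt p) \<noteq> zero3"
  by (rule gradient_nonzero) (simp_all add: curve_iff)

lemma point_conditions_finite:
  assumes "finite X" "X \<subseteq> curve F" shows "point_conditions F X {}"
proof unfold_locales
  show "\<And>p. p \<in> X \<Longrightarrow> simple_point p" using simple assms(2) by blast
qed (use assms in auto)

lemma not_dvd_linform: "u \<noteq> zero3 \<Longrightarrow> \<not> F dvd linform u"
  using not_dvd_small[OF linform_forms, of u] by simp

text \<open>The gradient at \<open>q\<close> gives the equation of the tangent line, whose
  restriction to the cubic vanishes doubly at \<open>q\<close>.\<close>

lemma tangent_line_mult:
  assumes "q \<in> curve F" "G \<in> tangent_forms F X {} d"
  shows "linform (gradient F (pt q)) * G \<in> tangent_forms F (insert q X) {} (1 + d)"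
proof -
  have "linform (gradient F (pt q)) * G \<in> tangent_forms F X {} (1 + d)"
    by (rule tangent_forms_mult[OF assms(2) linform_forms])
  moreover have "dot3 (gradient F (pt q)) (pt q) = 0"
    using dir_deriv_euler[OF F_forms, of "pt q"] assms(1) by (simp add: curve_iff dir_deriv_gradient)
  moreover have "dot3 (gradient F (pt q)) (tangent F q) = 0"
    using simple_point_tangent(2)[OF simple[OF assms(1)]] by (simp add: dir_deriv_gradient)
  ultimately show ?thesis unfolding tangent_forms_iff by simp
qed

text \<open>
  Suppose a form \<open>G\<^sub>p\<close> of degree \<open>2 t\<close> cuts the double of \<open>Z\<close> and \<open>p\<close> on the cubic, and
  \<open>G\<^sub>q\<close> the double of \<open>Z\<close> and \<open>q\<close>. Together with the tangent lines at \<open>q\<close> and \<open>p\<close> they lie in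
  a linear system of residual degree one, hence are proportional modulo \<open>F\<close>. If the tangent line
  at \<open>p\<close> avoids the zeros of the tangent line at \<open>q\<close>, then the latter divides \<open>G\<^sub>q\<close> modulo \<open>F\<close>,
  and the quotient contradicts the theorem of Bezout.
\<close>

lemma residual_exchange:
  assumes p: "p \<in> curve F" and q: "q \<in> curve F" and pq: "p \<noteq> q"
    and Z: "Z \<subseteq> curve F" "finite Z" "p \<notin> Z" "q \<notin> Z" and card: "card Z + 1 = 3 * t" "t \<ge> 2"
    and Tp: "\<And>s. s \<in> curve F \<Longrightarrow> dot3 (gradient F (pt q)) (pt s) = 0 \<Longrightarrow>
      dot3 (gradient F (pt p)) (pt s) \<noteq> 0"
    and TZ: "\<And>s. s \<in> Z \<Longrightarrow> dot3 (gradient F (pt q)) (pt s) \<noteq> 0"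
    and Gp: "Gp \<in> tangent_forms F (insert p Z) {} (2 * t)" "\<not> F dvd Gp"
    and Gq: "Gq \<in> tangent_forms F (insert q Z) {} (2 * t)"
  shows "F dvd Gq"
proof -
  let ?u = "gradient F (pt q)" and ?w = "gradient F (pt p)"
  have u: "?u \<noteq> zero3" by (rule gradient_pt_nonzero[OF q])
  have Gq_forms: "Gq \<in> forms (2 * t)" using Gq by (simp add: tangent_forms_iff)
  interpret all: point_conditions F "insert q (insert p Z)" "{}"
    by (rule point_conditions_finite) (use p q Z in auto)
  interpret Z: point_conditions F Z "{}" by (rule point_conditions_finite) (use Z in auto)
  have "card (insert q (insert p Z)) = 3 * t + 1" using pq Z card(1) by simp
  \<comment> \<open>The residual degree is \<open>3 (2 t + 1) - 2 (3 t + 1) = 1\<close>.\<close>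
  then have nu: "2 * card (insert q (insert p Z)) + card ({} :: 'k proj_plane set) + 1 = 3 * (1 + 2 * t)"
    by simp
  have H1: "linform ?u * Gp \<in> tangent_forms F (insert q (insert p Z)) {} (1 + 2 * t)"
    by (rule tangent_line_mult[OF q Gp(1)])
  have H2: "linform ?w * Gq \<in> tangent_forms F (insert q (insert p Z)) {} (1 + 2 * t)"
    using tangent_line_mult[OF p Gq] by (simp only: insert_commute)
  from all.residual_degree_one[OF nu H1 H2]
  obtain a b where ab: "a \<noteq> 0 \<or> b \<noteq> 0"
    "F dvd const a * (linform ?u * Gp) + const b * (linform ?w * Gq)"
    by (elim exE conjE)
  have b: "b \<noteq> 0"
  proof
    assume "b = 0"
    with ab have a: "a \<noteq> 0" "F dvd const a * (linform ?u * Gp)" by simp_all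
    have "\<not> F dvd const a" by (rule not_dvd_small[OF forms_const]) (use a in simp_all)
    from dvd_mult_cancel[OF a(2) this] have "F dvd linform ?u * Gp" .
    from dvd_mult_cancel[OF this not_dvd_linform[OF u]] Gp(2) show False by contradiction
  qed
  from ab(2) obtain K where K: "const a * (linform ?u * Gp) + const b * (linform ?w * Gq) = F * K"
    by (rule dvdE)
  have eq: "linform (\<lambda>i. b * ?w i) * Gq = linform ?u * (- const a * Gp) + F * K"
    unfolding K[symmetric] linform_scale by (simp add: algebra_simps)
  have nz: "eval_mpoly (linform (\<lambda>i. b * ?w i)) v \<noteq> 0"
    if v: "v \<noteq> zero3" "dot3 ?u v = 0" "eval_mpoly F v = 0" for v
  proof -
    have "proj v \<in> curve F" using eval_proj_iff[OF F_forms v(1)] v(3) by (simp add: curve_iff)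
    moreover have "dot3 ?u (pt (proj v)) = 0"
      using eval_proj_iff[OF linform_forms[of ?u] v(1)] v(2) by simp
    ultimately have "dot3 ?w (pt (proj v)) \<noteq> 0" by (rule Tp)
    then have "dot3 ?w v \<noteq> 0" using eval_proj_iff[OF linform_forms[of ?w] v(1)] by simp
    with b show ?thesis by (simp add: linform_scale)
  qed
  have "\<exists>A B. Gq = linform ?u * A + F * B"
    by (rule coprime_on_line[OF u F_forms linform_forms Gq_forms _ eq]) (rule nz)
  then obtain A B where "Gq = linform ?u * A + F * B" by (elim exE)
  then have "Gq = F * B + linform ?u * A" by (simp add: add.commute)
  from form_combination[OF Gq_forms F_forms linform_forms this]
  obtain B C where C: "C \<in> forms (2 * t - 1)" "Gq = F * B + linform ?u * C" by (elim exE conjE)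
  \<comment> \<open>The tangent line at \<open>q\<close> misses \<open>Z\<close>, so dividing by it
    preserves both conditions at every point of \<open>Z\<close>.\<close>
  have "C \<in> tangent_forms F Z {} (2 * t - 1)"
    unfolding tangent_forms_iff
  proof (intro conjI ballI)
    fix s assume s: "s \<in> Z"
    then have sF: "s \<in> curve F" using Z by blast
    have F0: "eval_mpoly F (pt s) = 0" using sF by (simp add: curve_iff)
    have F1: "dir_deriv F (pt s) (tangent F s) = 0" by (rule simple_point_tangent(2)[OF simple[OF sF]])
    have G: "eval_mpoly Gq (pt s) = 0" "dir_deriv Gq (pt s) (tangent F s) = 0"
      using Gq s by (auto simp: tangent_forms_iff)
    show C0: "eval_mpoly C (pt s) = 0"
      using G(1) TZ[OF s] F0 unfolding C(2) by simp
    show "dir_deriv C (pt s) (tangent F s) = 0"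
      using G(2) TZ[OF s] F0 F1 C0 unfolding C(2) by simp
  qed (use C in simp_all)
  from Z.bezout[OF this] have "\<not> F dvd C \<Longrightarrow> 2 * card Z + card ({} :: 'k proj_plane set) \<le> 3 * (2 * t - 1)" .
  \<comment> \<open>Bezout fails by one: \<open>2 (3 t - 1)\<close> exceeds
    \<open>3 (2 t - 1)\<close>.\<close>
  moreover have "\<not> 2 * card Z + card ({} :: 'k proj_plane set) \<le> 3 * (2 * t - 1)" using card by simp
  ultimately have "F dvd C" by argo
  then show ?thesis unfolding C(2) by simp
qed

text \<open>For a fixed \<open>q\<close> the tangent line meets the curve in finitely many points
  \<open>s\<close>. The points whose tangent line passes through \<open>s\<close> lie on the polar
  conic of \<open>s\<close>, which is nonzero because the cubic is not strange, and so cuts the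
  curve in finitely many points.\<close>

lemma ex_point_pair:
  "\<exists>p q. p \<in> curve F \<and> q \<in> curve F \<and> p \<noteq> q \<and>
    (\<forall>s\<in>curve F. dot3 (gradient F (pt q)) (pt s) = 0 \<longrightarrow> dot3 (gradient F (pt p)) (pt s) \<noteq> 0)"
proof -
  have "curve F \<noteq> {}" using infinite_curve by (rule infinite_imp_nonempty)
  then obtain q where q: "q \<in> curve F" by blast
  let ?u = "gradient F (pt q)"
  let ?S = "{s \<in> curve F. dot3 ?u (pt s) = 0}"
  let ?P = "\<lambda>s. {p \<in> curve F. dir_deriv F (pt p) (pt s) = 0}"
  have S: "finite ?S"
    using finite_zeros_on_curve[OF linform_forms not_dvd_linform[OF gradient_pt_nonzero[OF q]]] by simp
  have "finite (?P s)" if s: "s \<in> ?S" for s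
  proof -
    have Q: "polar_form F (pt s) \<in> forms 2" using polar_form_forms[OF F_forms, of "pt s"] by simp
    have "polar_form F (pt s) \<noteq> 0"
    proof
      assume 0: "polar_form F (pt s) = 0"
      have "dir_deriv F v (pt s) = 0" for v using eval_polar_form[of F "pt s" v] unfolding 0 by simp
      then show False using not_strange[of "pt s"] s by (simp add: curve_iff)
    qed
    then have "\<not> F dvd polar_form F (pt s)" by (intro not_dvd_small[OF Q]) simp_all
    from finite_zeros_on_curve[OF Q this] show ?thesis by simp
  qed
  with S have fin: "finite (insert q (\<Union>s\<in>?S. ?P s))" by (intro finite.insertI finite_UN_I)
  have "infinite (curve F - insert q (\<Union>s\<in>?S. ?P s))"
    by (rule Diff_infinite_finite[OF fin infinite_curve])
  then have "curve F - insert q (\<Union>s\<in>?S. ?P s) \<noteq> {}" by (rule infinite_imp_nonempty)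
  then obtain p where "p \<in> curve F - insert q (\<Union>s\<in>?S. ?P s)" by blast
  then have p: "p \<in> curve F" "p \<noteq> q" "\<And>s. s \<in> ?S \<Longrightarrow> dir_deriv F (pt p) (pt s) \<noteq> 0" by auto
  show ?thesis
  proof (rule exI[of _ p], rule exI[of _ q], intro conjI ballI impI)
    fix s assume "s \<in> curve F" "dot3 ?u (pt s) = 0"
    then show "dot3 (gradient F (pt p)) (pt s) \<noteq> 0"
      using p(3)[of s] unfolding dir_deriv_gradient by simp
  qed (fact p q)+
qed

text \<open>To \<open>3 t - 1\<close> suitable points \<open>Z\<close> one adds \<open>p\<close> or
  \<open>q\<close>: if \<open>p\<close> fails, the exchange argument shows that \<open>q\<close>
  works.\<close>

lemma ex_rigid_points:
  assumes t: "t \<ge> 2"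
  shows "\<exists>X. X \<subseteq> curve F \<and> finite X \<and> card X = 3 * t \<and>
    tangent_forms F X {} (2 * t) = (*) F ` forms (2 * t - 3)"
proof -
  from ex_point_pair obtain p q where pq: "p \<in> curve F" "q \<in> curve F" "p \<noteq> q"
    and Tp: "\<forall>s\<in>curve F. dot3 (gradient F (pt q)) (pt s) = 0 \<longrightarrow> dot3 (gradient F (pt p)) (pt s) \<noteq> 0"
    by (elim exE conjE)
  let ?S = "{s \<in> curve F. dot3 (gradient F (pt q)) (pt s) = 0}"
  have "finite ?S"
    using finite_zeros_on_curve[OF linform_forms not_dvd_linform[OF gradient_pt_nonzero[OF pq(2)]]] by simp
  then have "finite (insert p (insert q ?S))" by simp
  from ex_points_on_curve[OF this] obtain Z
    where Z0: "Z \<subseteq> curve F - insert p (insert q ?S)" "finite Z" "card Z = 3 * t - 1" .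
  have Z: "Z \<subseteq> curve F" "p \<notin> Z" "q \<notin> Z" "\<And>s. s \<in> Z \<Longrightarrow> dot3 (gradient F (pt q)) (pt s) \<noteq> 0"
    using Z0(1) by auto
  have card: "card Z + 1 = 3 * t" using Z0(3) t by simp
  have rigid: ?thesis if s: "s \<in> curve F" "s \<notin> Z"
      "\<And>G. G \<in> tangent_forms F (insert s Z) {} (2 * t) \<Longrightarrow> F dvd G" for s
  proof -
    interpret point_conditions F "insert s Z" "{}"
      by (rule point_conditions_finite) (use s Z Z0 in auto)
    have "tangent_forms F (insert s Z) {} (2 * t) = (*) F ` forms (2 * t - 3)"
      by (rule tangent_forms_eq_multiples[OF s(3)]) (use t in simp_all)
    then show ?thesis using s Z Z0 card by (intro exI[of _ "insert s Z"]) auto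
  qed
  show ?thesis
  proof (cases "\<forall>G \<in> tangent_forms F (insert p Z) {} (2 * t). F dvd G")
    case True
    then show ?thesis using rigid[of p] pq Z by blast
  next
    case False
    then obtain Gp where Gp: "Gp \<in> tangent_forms F (insert p Z) {} (2 * t)" "\<not> F dvd Gp" by blast
    show ?thesis
      by (rule rigid[of q], fact, fact, rule residual_exchange[OF pq Z(1) Z0(2) Z(2,3) card t _ Z(4) Gp])
         (use Tp in blast)+
  qed
qed

end

section \<open>Openness of the generic case\<close>

definition multidegree :: "(nat \<Rightarrow> nat) \<Rightarrow> (nat \<times> 3, 'k::field) mpoly \<Rightarrow> bool" where
  "multidegree d G \<longleftrightarrow> (\<forall>m\<in>keys G. \<forall>i. (\<Sum>j\<in>UNIV. lookup m (i, j)) = d i)"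

lemma multidegree_add: "multidegree d F \<Longrightarrow> multidegree d G \<Longrightarrow> multidegree d (F + G)"
  unfolding multidegree_def using Poly_Mapping.keys_add[of F G] by blast

lemma multidegree_sum: "(\<And>i. i \<in> S \<Longrightarrow> multidegree d (f i)) \<Longrightarrow> multidegree d (\<Sum>i\<in>S. f i)"
  by (induction S rule: infinite_finite_induct) (simp_all add: multidegree_add, simp_all add: multidegree_def)

lemma multidegree_mult:
  assumes "multidegree d F" "multidegree e G"
  shows "multidegree (\<lambda>i. d i + e i) (F * G)"
  unfolding multidegree_def
proof (intro ballI allI)
  fix m i assume "m \<in> keys (F * G)"
  then obtain a b where "m = a + b" "a \<in> keys F" "b \<in> keys G" using keys_mult[of F G] by blast
  then show "(\<Sum>j\<in>UNIV. lookup m (i, j)) = d i + e i"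
    using assms by (simp add: multidegree_def lookup_add sum.distrib)
qed

lemma multidegree_const: "multidegree (\<lambda>i. 0) (const c)"
  by (auto simp: multidegree_def const_def)

lemma multidegree_1: "multidegree (\<lambda>i. 0) 1"
  using multidegree_const[of 1] by simp

lemma multidegree_prod:
  "(\<And>r. r \<in> S \<Longrightarrow> multidegree (d r) (f r)) \<Longrightarrow> multidegree (\<lambda>i. \<Sum>r\<in>S. d r i) (\<Prod>r\<in>S. f r)"
proof (induction S rule: infinite_finite_induct)
  case (insert r S)
  then show ?case using multidegree_mult[of "d r" "f r"] by simp
qed (simp_all add: multidegree_1)

lemma multidegree_power: "multidegree d F \<Longrightarrow> multidegree (\<lambda>i. n * d i) (F ^ n)"
proof (induction n)
  case (Suc n)
  then show ?case using multidegree_mult[of d F] by simp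
qed (simp add: multidegree_1)

lemma multidegree_Var: "multidegree (\<lambda>i'. if i' = i then 1 else 0) (Var (i, j))"
proof -
  have "(\<Sum>j'\<in>UNIV. lookup (Poly_Mapping.single (i, j) (1 :: nat)) (i', j')) = (if i' = i then 1 else 0)"
    for i' by (simp add: lookup_single when_def)
  then show ?thesis by (auto simp: multidegree_def Var_def)
qed

lemma comm_ring_hom_eval: "comm_ring_hom (\<lambda>F. eval_mpoly F x)"
  unfolding eval_mpoly_mhom by (rule comm_ring_hom_mhom[OF comm_ring_hom_id])

definition at_point :: "nat \<Rightarrow> (3, 'k::field) mpoly \<Rightarrow> (nat \<times> 3, 'k) mpoly" where
  "at_point i = mhom const (\<lambda>j. Var (i, j))"

lemma eval_at_point [simp]: "eval_mpoly (at_point i G) x = eval_mpoly G (\<lambda>j. x (i, j))"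
proof -
  have "eval_mpoly (at_point i G) x =
      mhom (\<lambda>a. eval_mpoly (const a) x) (\<lambda>j. eval_mpoly (Var (i, j)) x) G"
    unfolding at_point_def by (rule hom_mhom[OF comm_ring_hom_const comm_ring_hom_eval])
  then show ?thesis by (simp only: eval_simps eval_mpoly_mhom[of G])
qed

lemma multidegree_at_point:
  assumes "G \<in> forms d"
  shows "multidegree (\<lambda>i'. if i' = i then d else 0) (at_point i G)"
  unfolding at_point_def mhom_def
proof (rule multidegree_sum)
  fix m assume m: "m \<in> keys G"
  let ?e = "\<lambda>i'. (0 :: nat) + (\<Sum>j\<in>UNIV. lookup m j * (if i' = i then 1 else 0))"
  have "multidegree ?e (const (lookup G m) * monomial_at (\<lambda>j. Var (i, j)) m)"
    unfolding monomial_at_superset[of UNIV m, simplified]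
    by (intro multidegree_mult multidegree_const multidegree_prod multidegree_power multidegree_Var)
  moreover have "?e = (\<lambda>i'. if i' = i then d else 0)"
    using m assms by (auto simp: forms_def)
  ultimately show "multidegree (\<lambda>i'. if i' = i then d else 0)
      (const (lookup G m) * monomial_at (\<lambda>j. Var (i, j)) m)" by simp
qed

text \<open>The multidegree of an entry depends only on its row, so all products in the Leibniz
  expansion share one multidegree.\<close>

lemma multidegree_det:
  assumes "\<And>r k. r < n \<Longrightarrow> k < n \<Longrightarrow> multidegree (d r) (E r k)"
  shows "multidegree (\<lambda>i. \<Sum>r<n. d r i) (det (mat n n (\<lambda>(r, k). E r k)))"
proof -
  let ?A = "mat n n (\<lambda>(r, k). E r k)"
  have "multidegree (\<lambda>i. \<Sum>r<n. d r i) (signof \<pi> * (\<Prod>r = 0..<n. ?A $$ (r, \<pi> r)))"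
    if \<pi>: "\<pi> permutes {0..<n}" for \<pi>
  proof -
    have "multidegree (\<lambda>i. \<Sum>r = 0..<n. d r i) (\<Prod>r = 0..<n. ?A $$ (r, \<pi> r))"
    proof (rule multidegree_prod)
      fix r assume r: "r \<in> {0..<n}"
      then have "\<pi> r < n" using permutes_in_image[OF \<pi>, of r] by simp
      with r show "multidegree (d r) (?A $$ (r, \<pi> r))" using assms by simp
    qed
    moreover have "(signof \<pi> :: (nat \<times> 3, 'a) mpoly) = const (signof \<pi>)" by (cases \<pi> rule: sign_cases) simp_all
    ultimately show ?thesis
      using multidegree_mult[OF multidegree_const[of "signof \<pi>"]] by (simp add: atLeast0LessThan)
  qed
  then show ?thesis unfolding det_def'[OF mat_carrier] by (intro multidegree_sum) simp
qed

lemma eval_det: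
  "eval_mpoly (det (mat n n (\<lambda>(r, k). E r k))) x = det (mat n n (\<lambda>(r, k). eval_mpoly (E r k) x))"
proof -
  interpret ev: comm_ring_hom "\<lambda>F. eval_mpoly F x" by (rule comm_ring_hom_eval)
  have "map_mat (\<lambda>F. eval_mpoly F x) (mat n n (\<lambda>(r, k). E r k)) = mat n n (\<lambda>(r, k). eval_mpoly (E r k) x)"
    by (intro eq_matI) simp_all
  then show ?thesis by (metis ev.hom_det)
qed

lemma det_eq_0_iff_kernel:
  fixes a :: "nat \<Rightarrow> nat \<Rightarrow> 'k::field"
  shows "det (mat n n (\<lambda>(r, k). a r k)) = 0 \<longleftrightarrow>
    (\<exists>c. (\<exists>k<n. c k \<noteq> 0) \<and> (\<forall>r<n. (\<Sum>k<n. a r k * c k) = 0))"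
proof -
  let ?A = "mat n n (\<lambda>(r, k). a r k)"
  have "(\<exists>v. v \<in> carrier_vec n \<and> v \<noteq> 0\<^sub>v n \<and> ?A *\<^sub>v v = 0\<^sub>v n) \<longleftrightarrow>
    (\<exists>c. (\<exists>k<n. c k \<noteq> 0) \<and> (\<forall>r<n. (\<Sum>k<n. a r k * c k) = 0))" (is "?L \<longleftrightarrow> ?R")
  proof
    assume ?L
    then obtain v where v: "v \<in> carrier_vec n" "v \<noteq> 0\<^sub>v n" "?A *\<^sub>v v = 0\<^sub>v n" by (elim exE conjE)
    let ?c = "\<lambda>k. Matrix.vec_index v k"
    have "\<exists>k<n. ?c k \<noteq> 0"
    proof (rule ccontr)
      assume "\<not> ?thesis"
      then have "v = 0\<^sub>v n" using v(1) by (intro eq_vecI) auto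
      with v(2) show False by contradiction
    qed
    moreover have "(\<Sum>k<n. a r k * ?c k) = 0" if "r < n" for r
    proof -
      have "Matrix.vec_index (?A *\<^sub>v v) r = 0" using v(3) that by simp
      then show ?thesis using v(1) that by (simp add: scalar_prod_def atLeast0LessThan)
    qed
    ultimately show ?R by (intro exI[of _ ?c]) simp
  next
    assume ?R
    then obtain c where c: "\<exists>k<n. c k \<noteq> 0" "\<And>r. r < n \<Longrightarrow> (\<Sum>k<n. a r k * c k) = 0" by blast
    from c(1) obtain k where k: "k < n" "c k \<noteq> 0" by blast
    have "Matrix.vec n c \<noteq> 0\<^sub>v n"
    proof
      assume "Matrix.vec n c = 0\<^sub>v n"
      then have "Matrix.vec_index (Matrix.vec n c) k = Matrix.vec_index (0\<^sub>v n) k" by simp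
      with k show False by simp
    qed
    moreover have "?A *\<^sub>v Matrix.vec n c = 0\<^sub>v n"
      by (intro eq_vecI) (simp_all add: scalar_prod_def atLeast0LessThan c(2))
    ultimately show ?L by (intro exI[of _ "Matrix.vec n c"]) simp
  qed
  then show ?thesis by (simp only: det_0_iff_vec_prod_zero[OF mat_carrier])
qed

text \<open>The family is indexed by \<open>k < n\<close> so that coordinates modulo
  \<open>W\<close> can label the columns of a matrix.\<close>

lemma (in kspace) ex_complement_basis:
  assumes V: "findim V" and W: "subspace W" "W \<subseteq> V" and dim: "dim V = dim W + n"
  shows "\<exists>g. (\<forall>k<n. g k \<in> V) \<and> (\<forall>x\<in>V. \<exists>c. x - (\<Sum>k<n. scale (c k) (g k)) \<in> W) \<and>
    (\<forall>c. (\<Sum>k<n. scale (c k) (g k)) \<in> W \<longrightarrow> (\<forall>k<n. c k = 0))"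
proof -
  obtain B where B: "B \<subseteq> W" "finite B" "independent B" "span B = W" "card B = dim W"
    using findim_basis[OF findim_mono[OF V W]] .
  obtain C where C: "B \<subseteq> C" "C \<subseteq> V" "finite C" "independent C" "span C = V" "card C = dim V"
    using findim_basis_extend[OF V B(3)] B(1) W(2) by (metis order_trans)
  have "card (C - B) = n" using C B(2,5) dim by (simp add: card_Diff_subset)
  then obtain g where g: "bij_betw g {..<n} (C - B)"
    using ex_bij_betw_nat_finite[of "C - B"] C(3) by (auto simp: atLeast0LessThan)
  have gC: "g k \<in> C - B" if "k < n" for k using bij_betwE[OF g] that by simp
  show ?thesis
  proof (rule exI[of _ g], intro conjI allI impI ballI)
    show "g k \<in> V" if "k < n" for k using gC[OF that] C(2) by blast
  next
    fix x assume "x \<in> V"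
    then have "x \<in> span (B \<union> (C - B))" using C by (simp add: Un_absorb1)
    then obtain y z where yz: "x = y + z" "y \<in> W" "z \<in> span (C - B)"
      unfolding span_Un B(4) by blast
    then obtain u where "z = (\<Sum>v\<in>C - B. scale (u v) v)"
      using span_finite[of "C - B"] C(3) by auto
    also have "\<dots> = (\<Sum>k<n. scale (u (g k)) (g k))" by (rule sum.reindex_bij_betw[OF g, symmetric])
    finally show "\<exists>c. x - (\<Sum>k<n. scale (c k) (g k)) \<in> W"
      using yz by (intro exI[of _ "\<lambda>k. u (g k)"]) simp
  next
    fix c k assume c: "(\<Sum>k<n. scale (c k) (g k)) \<in> W" and k: "k < n"
    define u where "u v = c (the_inv_into {..<n} g v)" for v
    have u: "u (g k) = c k" if "k < n" for k
      using the_inv_into_f_f[OF bij_betw_imp_inj_on[OF g]] that by (simp add: u_def)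
    have eq: "(\<Sum>v\<in>C - B. scale (u v) v) = (\<Sum>k<n. scale (c k) (g k))"
      using sum.reindex_bij_betw[OF g, of "\<lambda>v. scale (u v) v"] by (simp add: u)
    have "(\<Sum>v\<in>C - B. scale (u v) v) \<in> span (C - B)"
      by (intro span_sum span_scale span_base)
    moreover have "(\<Sum>v\<in>C - B. scale (u v) v) \<in> span B" using c by (simp add: eq B(4))
    ultimately have zero: "(\<Sum>v\<in>C - B. scale (u v) v) = 0" using span_Int_independent[OF C(4,1)] by blast
    have "independent (C - B)" by (rule independent_mono[OF C(4)]) blast
    from independentD[OF this _ subset_refl zero gC[OF k]] C(3) show "c k = 0" by (simp add: u[OF k])
  qed
qed

text \<open>The Jacobian determinant of \<open>G\<close>, \<open>F\<close> and
  \<open>linform u\<close>.\<close>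

definition tangent_deriv :: "(3, 'k::field) mpoly \<Rightarrow> (3 \<Rightarrow> 'k) \<Rightarrow> (3, 'k) mpoly \<Rightarrow> (3, 'k) mpoly" where
  "tangent_deriv F u G =
     partial_deriv 1 G * (const (u 3) * partial_deriv 2 F - const (u 2) * partial_deriv 3 F) +
     partial_deriv 2 G * (const (u 1) * partial_deriv 3 F - const (u 3) * partial_deriv 1 F) +
     partial_deriv 3 G * (const (u 2) * partial_deriv 1 F - const (u 1) * partial_deriv 2 F)"

lemma eval_tangent_deriv: "eval_mpoly (tangent_deriv F u G) v = dir_deriv G v (cross (gradient F v) u)"
  by (simp add: tangent_deriv_def dir_deriv_gradient dot3_def cross_def gradient_def algebra_simps)

lemma tangent_deriv_forms:
  assumes "G \<in> forms d" "F \<in> forms e" shows "tangent_deriv F u G \<in> forms ((d - 1) + (e - 1))"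
  unfolding tangent_deriv_def
  by (intro forms_add forms_mult forms_diff forms_const_mult partial_deriv_forms assms)

lemma openin_tuple_nonvanishing:
  assumes "multihomogeneous n G"
  shows "openin (zariski_curve_power n F) (tuple_nonvanishing n G \<inter> ({..<n} \<rightarrow>\<^sub>E curve F))"
  unfolding zariski_curve_power_def openin_subtopology zariski_tuples_def
  using assms by (intro exI[of _ "tuple_nonvanishing n G"] conjI topology_generated_by_Basis) auto


text \<open>If \<open>u\<close> is not orthogonal to \<open>v\<close>, then \<open>v\<close> and
  \<open>cross (gradient F v) u\<close> span the tangent plane, so this single direction controls
  all tangential derivatives.\<close>

lemma (in cubic_curve) tangent_derivative_zero:
  assumes v: "eval_mpoly F v = 0" "gradient F v \<noteq> zero3"
    and u: "dot3 v u \<noteq> 0" and G: "G \<in> forms d" "eval_mpoly G v = 0"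
      "dir_deriv G v (cross (gradient F v) u) = 0"
    and w: "dir_deriv F v w = 0"
  shows "dir_deriv G v w = 0"
proof -
  have F0: "dir_deriv F v v = 0" using dir_deriv_euler[OF F_forms] v(1) by simp
  have G0: "dir_deriv G v v = 0" using dir_deriv_euler[OF G(1)] G(2) by simp
  have "cross v (cross (gradient F v) u) = (\<lambda>i. dot3 v u * gradient F v i)"
    using F0 by (simp add: cross_cross dir_deriv_gradient dot3_commute)
  then have "cross v (cross (gradient F v) u) \<noteq> zero3" using u v(2) by (auto simp: fun_eq_iff)
  from gradient_parallel[OF this F0 _ v(2) G0 G(3)] w
  show ?thesis by (auto simp: dir_deriv_gradient)
qed

context smooth_cubic
begin

text \<open>
  In terms of a basis of a complement of the multiples of \<open>F\<close> in the forms of degree \<open>2 t\<close>, the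
  conditions at \<open>3 t\<close> points form a square matrix. The row for a tangential derivative uses
  the tangent vector obtained from the gradient and a constant vector by the cross product,
  so that it is polynomial in the coordinates of the point.
\<close>

lemma ex_open_rigid:
  assumes t: "t \<ge> 2"
  shows "\<exists>U. openin (zariski_curve_power (3 * t) F) U \<and> U \<noteq> {} \<and>
    (\<forall>p\<in>U. tangent_forms F (p ` {..<3 * t}) {} (2 * t) = (*) F ` forms (2 * t - 3))"
proof -
  define N d n where "N = 3 * t" and "d = 2 * t" and "n = 2 * N"
  let ?V = "forms d :: (3, 'k) mpoly set"
  let ?W = "(*) F ` (forms (d - 3) :: (3, 'k) mpoly set)"
  have "3 \<le> d" using t by (simp add: d_def)
  then have FW: "F * A \<in> ?V" if "A \<in> forms (d - 3)" for A
    using forms_mult'[OF F_forms that, of d] by simp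
  have W: "mp.subspace ?W" by (rule mp.findim_subspace[OF findim_mult_image[OF findim_forms]])
  have WV: "?W \<subseteq> ?V" using FW by blast
  have "mp.dim ?V = mp.dim ?W + n"
    using dim_forms_diff[OF \<open>3 \<le> d\<close>, where 'k = 'k] dim_forms_shift[OF F_nonzero findim_forms, of "d - 3"]
    by (simp add: n_def N_def d_def)
  from mp.ex_complement_basis[OF findim_forms W WV this] obtain g where
    g0: "\<forall>k<n. g k \<in> ?V" "\<forall>x\<in>?V. \<exists>c. x - (\<Sum>k<n. const (c k) * g k) \<in> ?W"
      "\<forall>c. (\<Sum>k<n. const (c k) * g k) \<in> ?W \<longrightarrow> (\<forall>k<n. c k = 0)"
    by (elim exE conjE)
  note g = g0(1)[rule_format] g0(2) g0(3)[rule_format]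
  from ex_rigid_points[OF t] obtain X where
    X: "X \<subseteq> curve F" "finite X" "card X = N" "tangent_forms F X {} d = ?W"
    unfolding N_def d_def by (elim exE conjE)
  obtain p0 where p0: "bij_betw p0 {..<N} X"
    using ex_bij_betw_nat_finite[OF X(2)] X(3) by (auto simp: atLeast0LessThan)
  define p1 where "p1 = restrict p0 {..<N}"
  have p1: "p1 ` {..<N} = X" "p1 \<in> {..<N} \<rightarrow>\<^sub>E curve F"
    using p0 X(1) by (auto simp: p1_def bij_betw_def)
  \<comment> \<open>The vectors \<open>u i\<close> are fitted to the tuple \<open>p1\<close>, where
    vanishing rows must imply the tangency conditions. For other tuples only the converse is needed,
    and it holds whatever \<open>u i\<close> is.\<close>
  have "\<exists>w. dot3 (pt (p1 i)) w = 1" for i using ex_dot3_eq_1[OF pt_nonzero[of "p1 i"]] dot3_commute by metis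
  then obtain u where u: "\<And>i. dot3 (pt (p1 i)) (u i) = 1" by metis
  \<comment> \<open>Rows \<open>2 * i\<close> and \<open>2 * i + 1\<close> hold the value and the
    derivative condition at the point number \<open>i\<close>.\<close>
  define E where "E r k = (if even r then g k else tangent_deriv F (u (r div 2)) (g k))" for r k
  define D where "D = det (mat n n (\<lambda>(r, k). at_point (r div 2) (E r k)))"
  have evalD: "eval_mpoly D x = det (mat n n (\<lambda>(r, k). eval_mpoly (E r k) (\<lambda>j. x (r div 2, j))))" for x
    unfolding D_def eval_det by simp
  have row: "(\<Sum>k<n. eval_mpoly (E r k) v * c k) =
      (if even r then eval_mpoly (\<Sum>k<n. const (c k) * g k) v
       else dir_deriv (\<Sum>k<n. const (c k) * g k) v (cross (gradient F v) (u (r div 2))))" for r v c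
    by (simp add: E_def eval_tangent_deriv mult.commute)
  have multi: "multihomogeneous N D"
  proof -
    let ?e = "\<lambda>i. \<Sum>r<n. if i = r div 2 then (if even r then d else (d - 1) + (3 - 1)) else 0"
    have "E r k \<in> forms (if even r then d else (d - 1) + (3 - 1))" if "k < n" for r k
      using g(1)[OF that] tangent_deriv_forms[OF g(1)[OF that] F_forms] by (simp add: E_def)
    then have "multidegree ?e D"
      unfolding D_def by (intro multidegree_det multidegree_at_point)
    moreover have "?e i = 0" if "i \<ge> N" for i
      using that by (intro sum.neutral) (auto simp: n_def)
    ultimately show ?thesis unfolding multihomogeneous_def multidegree_def
      by (intro exI[of _ ?e]) simp
  qed
  define U where "U = tuple_nonvanishing N D \<inter> ({..<N} \<rightarrow>\<^sub>E curve F)"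
  have rigid: "tangent_forms F (p ` {..<N}) {} d = ?W" if p: "p \<in> U" for p
  proof -
    interpret point_conditions F "p ` {..<N}" "{}"
      by (rule point_conditions_finite) (use p in \<open>auto simp: U_def\<close>)
    have "Y d \<subseteq> ?W"
    proof
      fix G assume G: "G \<in> Y d"
      then have "G \<in> ?V" by (simp add: tangent_forms_iff)
      with g(2) obtain c where c: "G - (\<Sum>k<n. const (c k) * g k) \<in> ?W" by blast
      let ?H = "\<Sum>k<n. const (c k) * g k"
      have "G - (G - ?H) \<in> Y d"
        using mp.subspace_diff[OF subspace_tangent_forms G, of "G - ?H"] c F_image_subset[OF \<open>3 \<le> d\<close>] by blast
      then have H: "?H \<in> Y d" by simp
      have D: "\<forall>v. (\<forall>i<N. represents (v i) (p i)) \<longrightarrow> eval_mpoly D (\<lambda>(i, j). vec_nth (v i) j) \<noteq> 0"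
        using p unfolding U_def tuple_nonvanishing_def by blast
      have "eval_mpoly D (\<lambda>(i, j). vec_nth (\<chi> j. pt (p i) j) j) \<noteq> 0"
        by (rule D[rule_format, of "\<lambda>i. \<chi> j. pt (p i) j"]) (rule represents_pt)
      then have "det (mat n n (\<lambda>(r, k). eval_mpoly (E r k) (pt (p (r div 2))))) \<noteq> 0"
        by (simp add: evalD)
      moreover have "(\<Sum>k<n. eval_mpoly (E r k) (pt (p (r div 2))) * c k) = 0" if r: "r < n" for r
      proof -
        let ?q = "p (r div 2)"
        have i: "r div 2 \<in> {..<N}" using r by (simp add: n_def)
        then have q: "?q \<in> p ` {..<N}" by (rule imageI)
        have "p \<in> {..<N} \<rightarrow>\<^sub>E curve F" using p unfolding U_def by (rule IntD2)
        then have qF: "?q \<in> curve F" by (rule PiE_mem[OF _ i])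
        have H0: "eval_mpoly ?H (pt ?q) = 0" "dir_deriv ?H (pt ?q) (tangent F ?q) = 0"
          using H q unfolding tangent_forms_iff by blast+
        have Hf: "?H \<in> forms d" using H by (simp only: tangent_forms_iff)
        have "\<exists>a. \<forall>x. dir_deriv ?H (pt ?q) x = a * dir_deriv F (pt ?q) x"
          by (rule gradient_parallel[OF simple_point_tangent(1)[OF simple[OF qF]] _
                simple_point_tangent(2)[OF simple[OF qF]] gradient_pt_nonzero[OF qF] _ H0(2)])
             (use dir_deriv_euler[OF F_forms, of "pt ?q"] dir_deriv_euler[OF Hf, of "pt ?q"] H0(1) qF
               in \<open>simp_all only: curve_iff mult_zero_right\<close>)
        then obtain a where a: "\<And>x. dir_deriv ?H (pt ?q) x = a * dir_deriv F (pt ?q) x" by (elim exE) (rule that, erule spec)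
        \<comment> \<open>The gradient of \<open>?H\<close> is a multiple of that of
          \<open>F\<close>, which is orthogonal to its own cross product with any vector.\<close>
        have "dir_deriv ?H (pt ?q) (cross (gradient F (pt ?q)) (u (r div 2))) = 0"
          unfolding a unfolding dir_deriv_gradient by simp
        then show ?thesis unfolding row using H0(1) by simp
      qed
      ultimately have "\<forall>k<n. c k = 0" unfolding det_eq_0_iff_kernel by blast
      then have "?H = 0" by (intro sum.neutral) simp
      with c show "G \<in> ?W" by simp
    qed
    then show ?thesis using F_image_subset[OF \<open>3 \<le> d\<close>] by blast
  qed
  have "p1 \<in> tuple_nonvanishing N D"
    unfolding tuple_nonvanishing_def
  proof (intro CollectI conjI allI impI)
    show "p1 \<in> {..<N} \<rightarrow>\<^sub>E UNIV" using p1(2) by auto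
    fix v assume v: "\<forall>i<N. represents (v i) (p1 i)"
    let ?v = "\<lambda>i j. vec_nth (v i) j"
    \<comment> \<open>A kernel vector at \<open>p1\<close> yields a combination of the
      \<open>g k\<close> in \<open>tangent_forms F X {} d\<close>, hence a multiple of
      \<open>F\<close>; in a complement this forces the coefficients to vanish.\<close>
    have "\<not> (\<exists>c. (\<exists>k<n. c k \<noteq> 0) \<and> (\<forall>r<n. (\<Sum>k<n. eval_mpoly (E r k) (?v (r div 2)) * c k) = 0))"
    proof (intro notI, elim exE conjE)
      fix c k assume k: "k < n" "c k \<noteq> 0"
        and c: "\<forall>r<n. (\<Sum>k<n. eval_mpoly (E r k) (?v (r div 2)) * c k) = 0"
      let ?H = "\<Sum>k<n. const (c k) * g k"
      have Hf: "?H \<in> forms d" using g(1) by (intro forms_sum forms_const_mult) simp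
      have "?H \<in> tangent_forms F X {} d"
        unfolding tangent_forms_iff
      proof (intro conjI ballI Hf)
        fix q assume "q \<in> X"
        then obtain i where i: "i < N" "q = p1 i" using p1(1) by blast
        have qF: "q \<in> curve F" using \<open>q \<in> X\<close> X(1) by blast
        from v i obtain a where a: "a \<noteq> 0" "?v i = (\<lambda>j. a * pt q j)"
          unfolding represents_iff_pt by blast
        have "2 * i < n" "2 * i + 1 < n" using i by (simp_all add: n_def)
        with c have "(\<Sum>k<n. eval_mpoly (E (2 * i) k) (?v (2 * i div 2)) * c k) = 0"
          "(\<Sum>k<n. eval_mpoly (E (2 * i + 1) k) (?v ((2 * i + 1) div 2)) * c k) = 0" by blast+
        then have H: "eval_mpoly ?H (?v i) = 0" "dir_deriv ?H (?v i) (cross (gradient F (?v i)) (u i)) = 0"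
          unfolding row by simp_all
        show "eval_mpoly ?H (pt q) = 0"
          using H(1) eval_homogeneous[OF Hf, of a "pt q"] a by (simp del: eval_sum)
        have Fv: "eval_mpoly F (?v i) = 0"
          using eval_homogeneous[OF F_forms, of a "pt q"] a qF by (simp add: curve_iff)
        have v0: "?v i \<noteq> zero3"
        proof
          assume "?v i = zero3"
          with a have "pt q = zero3" by (simp add: fun_eq_iff)
          then show False by simp
        qed
        have "dot3 (pt q) (u i) = 1" using u i(2) by simp
        then have uv: "dot3 (?v i) (u i) \<noteq> 0" unfolding a(2) using a(1) by (simp add: dot3_commute[of _ "u i"])
        have "a * dir_deriv F (?v i) (tangent F q) = 0"
          using dir_deriv_homogeneous[OF F_forms, of a "pt q" "tangent F q"]
            simple_point_tangent(2)[OF simple[OF qF]] by (simp add: a(2))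
        with a(1) have "dir_deriv F (?v i) (tangent F q) = 0" by simp
        from tangent_derivative_zero[OF Fv gradient_nonzero[OF v0 Fv] uv Hf H this]
        have "dir_deriv ?H (?v i) (tangent F q) = 0" .
        then have "a ^ d * dir_deriv ?H (pt q) (tangent F q) = 0"
          using dir_deriv_homogeneous[OF Hf, of a "pt q" "tangent F q"] unfolding a(2) by simp
        then show "dir_deriv ?H (pt q) (tangent F q) = 0" using a(1) by simp
      qed simp
      then have "c k = 0" using g(3)[OF _ k(1)] X(4) by simp
      with k show False by simp
    qed
    then have "det (mat n n (\<lambda>(r, k). eval_mpoly (E r k) (?v (r div 2)))) \<noteq> 0"
      unfolding det_eq_0_iff_kernel .
    then show "eval_mpoly D (\<lambda>(i, j). vec_nth (v i) j) \<noteq> 0" by (simp add: evalD)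
  qed
  then have "U \<noteq> {}" using p1(2) by (auto simp: U_def)
  moreover have "openin (zariski_curve_power N F) U"
    unfolding U_def by (rule openin_tuple_nonvanishing[OF multi])
  ultimately show ?thesis using rigid unfolding N_def d_def by blast
qed

end

lemma configuration_rigid:
  fixes F :: "(3, 'k::alg_closed_field) mpoly"
  assumes c: "cubic_configuration t 0 F X" and t: "t \<ge> 6"
    and rigid: "tangent_forms F X {} (2 * t) = (*) F ` forms (2 * t - 3)"
  shows "\<Delta>h_double X (2 * t) = 3" "i > 2 * t \<Longrightarrow> \<Delta>h_double X i = 0"
proof -
  have t': "(0 :: nat) \<le> 2" "t + 0 > 5" using t by simp_all
  note d = configuration_first_differences[OF c t']
  show "\<Delta>h_double X (2 * t) = 3" using d(7) rigid by simp
  show "\<Delta>h_double X i = 0" if "i > 2 * t"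
  proof (cases "i = 2 * t + 1")
    case True
    then show ?thesis using d(8) rigid by simp
  next
    case False
    then show ?thesis using d(6)[of i] that by simp
  qed
qed

theorem theorem3p4:
  fixes t \<delta> :: nat
  assumes "\<delta> \<le> 2" and "int t > 5 - int \<delta>"
  shows
    "(\<forall>(F :: (3, 'k::alg_closed_field) mpoly) X. cubic_configuration t \<delta> F X \<longrightarrow>
        (\<forall>i\<in>{0..5}. \<Delta>h_double X i = int i + 1) \<and>
        (\<forall>i\<in>{5..t + 3}. \<Delta>h_double X i = 6) \<and>
        \<Delta>h_double X (t + 4) = 3 + int \<delta> \<and>
        (\<forall>i\<in>{t + 5..2 * t + \<delta> - 1}. \<Delta>h_double X i = 3) \<and>
        (\<delta> = 1 \<or> \<delta> = 2 \<longrightarrow>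
           \<Delta>h_double X (2 * t + \<delta>) = 3 - int \<delta> \<and>
           (\<forall>i>2 * t + \<delta>. \<Delta>h_double X i = 0)) \<and>
        (\<delta> = 0 \<longrightarrow>
           (\<Delta>h_double X (2 * t) = 3 \<and> (\<forall>i>2 * t. \<Delta>h_double X i = 0)) \<or>
           (\<Delta>h_double X (2 * t) = 2 \<and> \<Delta>h_double X (2 * t + 1) = 1 \<and>
            (\<forall>i\<ge>2 * t + 2. \<Delta>h_double X i = 0)))) \<and>
     (\<delta> = 0 \<longrightarrow>
        (\<exists>(F :: (3, 'k) mpoly) X. cubic_configuration t \<delta> F X \<and>
           \<Delta>h_double X (2 * t) = 3 \<and> (\<forall>i>2 * t. \<Delta>h_double X i = 0)) \<and>
        (\<exists>(F :: (3, 'k) mpoly) X. cubic_configuration t \<delta> F X \<and>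
           \<Delta>h_double X (2 * t) = 2 \<and> \<Delta>h_double X (2 * t + 1) = 1 \<and>
           (\<forall>i\<ge>2 * t + 2. \<Delta>h_double X i = 0))) \<and>
     (\<delta> = 0 \<longrightarrow>
        (\<forall>F :: (3, 'k) mpoly. irreducible_cubic F \<and> smooth_curve F \<longrightarrow>
           (\<exists>U. openin (zariski_curve_power (3 * t) F) U \<and> U \<noteq> {} \<and>
              (\<forall>p\<in>U. cubic_configuration t \<delta> F (p ` {..<3 * t}) \<longrightarrow>
                 \<Delta>h_double (p ` {..<3 * t}) (2 * t) = 3 \<and>
                 (\<forall>i>2 * t. \<Delta>h_double (p ` {..<3 * t}) i = 0)))))"
proof (intro conjI allI impI ballI)
  have \<delta>: "\<delta> \<le> 2" "t + \<delta> > 5" using assms by linarith+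
  {
    fix F :: "(3, 'k) mpoly" and X
    assume c: "cubic_configuration t \<delta> F X"
    note d = configuration_first_differences[OF c \<delta>]
    show "\<Delta>h_double X i = int i + 1" if "i \<in> {0..5}" for i using d(1) that by simp
    show "\<Delta>h_double X i = 6" if "i \<in> {5..t + 3}" for i using d(2) that by simp
    show "\<Delta>h_double X (t + 4) = 3 + int \<delta>" by (rule d(3))
    show "\<Delta>h_double X i = 3" if "i \<in> {t + 5..2 * t + \<delta> - 1}" for i using d(4) that by simp
    show "\<Delta>h_double X (2 * t + \<delta>) = 3 - int \<delta>" if "\<delta> = 1 \<or> \<delta> = 2" using d(5) that by simp
    show "\<Delta>h_double X i = 0" if "\<delta> = 1 \<or> \<delta> = 2" "i > 2 * t + \<delta>" for i using d(6) that by blast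
    show "(\<Delta>h_double X (2 * t) = 3 \<and> (\<forall>i>2 * t. \<Delta>h_double X i = 0)) \<or>
        (\<Delta>h_double X (2 * t) = 2 \<and> \<Delta>h_double X (2 * t + 1) = 1 \<and> (\<forall>i\<ge>2 * t + 2. \<Delta>h_double X i = 0))"
      if "\<delta> = 0"
    proof (cases "tangent_forms F X {} (2 * t) = (*) F ` forms (2 * t - 3)")
      case True
      then show ?thesis
        using configuration_rigid[OF c[unfolded that] _ True] \<delta>(2) that by (intro disjI1) simp
    next
      case False
      then show ?thesis using d(6-8) that by auto
    qed
  }
  have t: "t \<ge> 6" if "\<delta> = 0" using \<delta>(2) that by simp
  show "\<exists>(F :: (3, 'k) mpoly) X. cubic_configuration t \<delta> F X \<and>
      \<Delta>h_double X (2 * t) = 3 \<and> (\<forall>i>2 * t. \<Delta>h_double X i = 0)" if "\<delta> = 0"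
    using ex_generic_configuration[OF t[OF that]] unfolding that .
  show "\<exists>(F :: (3, 'k) mpoly) X. cubic_configuration t \<delta> F X \<and>
      \<Delta>h_double X (2 * t) = 2 \<and> \<Delta>h_double X (2 * t + 1) = 1 \<and>
      (\<forall>i\<ge>2 * t + 2. \<Delta>h_double X i = 0)" if "\<delta> = 0"
    using ex_special_configuration[OF t[OF that]] unfolding that .
  show "\<exists>U. openin (zariski_curve_power (3 * t) F) U \<and> U \<noteq> {} \<and>
      (\<forall>p\<in>U. cubic_configuration t \<delta> F (p ` {..<3 * t}) \<longrightarrow>
         \<Delta>h_double (p ` {..<3 * t}) (2 * t) = 3 \<and>
         (\<forall>i>2 * t. \<Delta>h_double (p ` {..<3 * t}) i = 0))"
    if \<delta>0: "\<delta> = 0" and F: "irreducible_cubic F \<and> smooth_curve F" for F :: "(3, 'k) mpoly"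
  proof -
    interpret smooth_cubic F by unfold_locales (use F in auto)
    have "t \<ge> 2" using t[OF \<delta>0] by simp
    from ex_open_rigid[OF this] obtain U where
      U: "openin (zariski_curve_power (3 * t) F) U" "U \<noteq> {}"
        "\<forall>p\<in>U. tangent_forms F (p ` {..<3 * t}) {} (2 * t) = (*) F ` forms (2 * t - 3)"
      by (elim exE conjE)
    show ?thesis
    proof (intro exI[of _ U] conjI ballI impI U(1,2))
      fix p assume p: "p \<in> U" "cubic_configuration t \<delta> F (p ` {..<3 * t})"
      note rigid = configuration_rigid[OF p(2)[unfolded \<delta>0] t[OF \<delta>0] U(3)[rule_format, OF p(1)]]
      show "\<Delta>h_double (p ` {..<3 * t}) (2 * t) = 3" by (rule rigid(1))
      show "\<forall>i>2 * t. \<Delta>h_double (p ` {..<3 * t}) i = 0" using rigid(2) by blast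
    qed
  qed
qed

end
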